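(* Let $n,l$ be positive integers, $\alpha\in\mathbb{C}$, and for each partition $\lambda\vdash nl$ let $F^\lambda_{n,l}(\alpha)$ be the transition matrix defined in the context. Then the multiplicity of $\mathcal{M}_n^\lambda$ in $\mathcal{U}(\mathfrak{gl}_n)\cdot\det^{(\alpha)}(X)^l$ equals the rank of $F_{n,l}^\lambda(\alpha)$; that is, $$\mathcal{U}(\mathfrak{gl}_n)\cdot\det{}^{(\alpha)}(X)^l\;\cong\;\bigoplus_{\substack{\lambda\vdash nl\\ \ell(\lambda)\le n}}\bigl(\mathcal{M}_n^\lambda\bigr)^{\oplus\operatorname{rk}F_{n,l}^\lambda(\alpha)} .$$
   Context: $\mathcal{A}(\mathrm{Mat}_n)$ is the polynomial algebra over $\mathbb{C}$ in $x_{ij}$ ($1\le i,j\le n$), $X=(x_{ij})$; $\mathcal{U}(\mathfrak{gl}_n)$ acts on it by $E_{ij}\cdot f=\sum_{k=1}^n x_{ik}\,\partial f/\partial x_{jk}$. The $\alpha$-determinant of a matrix $Y=(y_{ij})$ is $\det^{(\alpha)}(Y)=\sum_{\sigma\in\mathfrak{S}_n}\alpha^{\nu(\sigma)}y_{\sigma(1)1}\cdots y_{\sigma(n)n}$, where $\nu(\sigma)$ is $n$ minus the number of cycles of $\sigma$ ($0^0=1$). $\mathcal{M}_n^\lambda$ is the irreducible highest weight module of highest weight $\lambda$, $\ell(\lambda)$ is the number of parts of $\lambda$, and $K_{\lambda(l^n)}$ is the Kostka number (semistandard tableaux of shape $\lambda$, weight $(l,\dots,l)$). Let $\mathbb{M}_{n,l}$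 be the set of $n\times n$ matrices $M=(m_{ij})$ with nonnegative integer entries and all column sums equal to $l$. Let $\boldsymbol e_1,\dots,\boldsymbol e_n$ be the standard basis of $\mathbb{C}^n$; the space $(\mathrm{Sym}^l(\mathbb{C}^n))^{\otimes n}$, with its natural $\mathcal{U}(\mathfrak{gl}_n)$-action, has basis $\boldsymbol e^M=\boldsymbol e_1^{m_{11}}\cdots\boldsymbol e_n^{m_{n1}}\otimes\cdots\otimes\boldsymbol e_1^{m_{1n}}\cdots\boldsymbol e_n^{m_{nn}}$, $M\in\mathbb{M}_{n,l}$. For $N\in\mathbb{M}_{n,1}$ write $N=(\delta_{i,k_j})_{i,j}$ with $k_1,\dots,k_n\in\{1,\dots,n\}$ and put $D^{(\alpha)}(N)=\det^{(\alpha)}\bigl((x_{k_i j})_{1\le i,j\le n}\bigr)$. For $M\in\mathbb{M}_{n,l}$ put $$D^{(\alpha)}(M)=\frac{\prod_{i,j}m_{ij}!}{(l!)^n}\sum_{(M_1,\dots,M_l)}D^{(\alpha)}(M_1)\cdots D^{(\alpha)}(M_l),$$ the sum over all sequences $(M_1,\dots,M_l)\in(\mathbb{M}_{n,1})^l$ with $M_1+\dots+M_l=M$. Let $\Phi^{(\alpha)}:(\mathrm{Sym}^l(\mathbb{C}^n))^{\otimes n}\to\mathcal{A}(\mathrm{Mat}_n)$ be the linear map with $\Phi^{(\alpha)}(\boldsymbol e^M)=D^{(\alpha)}(M)$; it is a $\mathcal{U}(\mathfrak{gl}_n)$-intertwiner with image $\mathcal{U}(\mathfrak{gl}_n)\cdot\det^{(\alpha)}(X)^l$,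 and $\Phi^{(0)}$ is injective with image containing the image of every $\Phi^{(\alpha)}$. For $\lambda\vdash nl$ fix a basis $v_1^\lambda,\dots,v^\lambda_{K_{\lambda(l^n)}}$ of the space of highest weight vectors of weight $\lambda$ in $(\mathrm{Sym}^l(\mathbb{C}^n))^{\otimes n}$. The transition matrix $F_{n,l}^\lambda(\alpha)$ is the square matrix of size $K_{\lambda(l^n)}$ determined by $\Phi^{(\alpha)}(v_j^\lambda)=\sum_i (F_{n,l}^\lambda(\alpha))_{ij}\,\Phi^{(0)}(v_i^\lambda)$ for all $j$ (it depends on the chosen basis only up to conjugacy). *)

theory Defs
  imports
    Complex_Main
    "HOL-Library.FuncSet"
    "HOL-Library.Poly_Mapping"
    "HOL-Combinatorics.Orbits"
    "Jordan_Normal_Form.DL_Rank"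
begin

text \<open>
  All matrix, row, column and basis indices are 0-based: the index set
  \<open>{1, ..., n}\<close> is rendered as \<open>{..<n}\<close>.
\<close>

section \<open>Modules over the universal enveloping algebra of the general linear Lie algebra\<close>

text \<open>
  A module over \<open>U(gl_n)\<close> is the same thing as a representation of the Lie algebra
  \<open>gl_n\<close>, i.e. a complex vector space with linear operators \<open>E i j\<close> (\<open>i, j < n\<close>) satisfying
  the commutation relations of the matrix units.  The vector space is a subspace
  \<open>mspace V\<close> of the vector space given by the ambient type and the scaling \<open>mscale V\<close>.
\<close>

record 'a gl_module =
  mspace :: "'a set"
  mscale :: "complex \<Rightarrow> 'a \<Rightarrow> 'a"
  mact :: "nat \<Rightarrow> nat \<Rightarrow> 'a \<Rightarrow> 'a"

definition is_gl_module :: "nat \<Rightarrow> 'a::ab_group_add gl_module \<Rightarrow> bool" where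
  "is_gl_module n V \<longleftrightarrow>
     vector_space (mscale V) \<and>
     Modules.module.subspace (mscale V) (mspace V) \<and>
     (\<forall>i<n. \<forall>j<n. \<forall>v\<in>mspace V. mact V i j v \<in> mspace V) \<and>
     (\<forall>i<n. \<forall>j<n. \<forall>v\<in>mspace V. \<forall>w\<in>mspace V.
        mact V i j (v + w) = mact V i j v + mact V i j w) \<and>
     (\<forall>i<n. \<forall>j<n. \<forall>c. \<forall>v\<in>mspace V. mact V i j (mscale V c v) = mscale V c (mact V i j v)) \<and>
     (\<forall>i<n. \<forall>j<n. \<forall>k<n. \<forall>m<n. \<forall>v\<in>mspace V.
        mact V i j (mact V k m v) - mact V k m (mact V i j v) =
          (if j = k then mact V i m v else 0) - (if m = i then mact V k j v else 0))"

definition is_submodule :: "nat \<Rightarrow> 'a::ab_group_add gl_module \<Rightarrow> 'a set \<Rightarrow> bool" where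
  "is_submodule n V S \<longleftrightarrow>
     S \<subseteq> mspace V \<and> Modules.module.subspace (mscale V) S \<and>
     (\<forall>i<n. \<forall>j<n. \<forall>v\<in>S. mact V i j v \<in> S)"

definition irreducible_module :: "nat \<Rightarrow> 'a::ab_group_add gl_module \<Rightarrow> bool" where
  "irreducible_module n V \<longleftrightarrow>
     mspace V \<noteq> {0} \<and> (\<forall>S. is_submodule n V S \<longrightarrow> S = {0} \<or> S = mspace V)"

text \<open>
  The cyclic submodule \<open>U(gl_n) \<cdot> v\<close>: the algebra \<open>U(gl_n)\<close> is spanned by the words in
  the generators \<open>E i j\<close>.
\<close>

definition cyclic_submodule :: "nat \<Rightarrow> 'a::ab_group_add gl_module \<Rightarrow> 'a \<Rightarrow> 'a gl_module" where
  "cyclic_submodule n V v = V\<lparr>mspace := Modules.module.span (mscale V)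
     {foldr (\<lambda>(i, j). mact V i j) ws v |ws. set ws \<subseteq> {..<n} \<times> {..<n}}\<rparr>"

text \<open>
  Partitions are weakly decreasing lists of positive integers.  As a weight, a partition is
  padded by zeros.
\<close>

definition is_partition :: "nat list \<Rightarrow> nat \<Rightarrow> bool" where
  "is_partition \<mu> N \<longleftrightarrow> sorted_wrt (\<ge>) \<mu> \<and> 0 \<notin> set \<mu> \<and> sum_list \<mu> = N"

definition part :: "nat list \<Rightarrow> nat \<Rightarrow> nat" where
  "part \<mu> i = (if i < length \<mu> then \<mu> ! i else 0)"

text \<open>The space of highest weight vectors of weight \<open>\<mu>\<close>, including the zero vector.\<close>

definition hw_vectors :: "nat \<Rightarrow> 'a::ab_group_add gl_module \<Rightarrow> nat list \<Rightarrow> 'a set" where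
  "hw_vectors n V \<mu> = {v \<in> mspace V.
     (\<forall>i j. i < j \<and> j < n \<longrightarrow> mact V i j v = 0) \<and>
     (\<forall>i<n. mact V i i v = mscale V (of_nat (part \<mu> i)) v)}"

definition highest_weight_module :: "nat \<Rightarrow> 'a::ab_group_add gl_module \<Rightarrow> nat list \<Rightarrow> bool" where
  "highest_weight_module n V \<mu> \<longleftrightarrow>
     (\<exists>v\<in>hw_vectors n V \<mu>. v \<noteq> 0 \<and> mspace (cyclic_submodule n V v) = mspace V)"

definition irreducible_hw_module :: "nat \<Rightarrow> 'a::ab_group_add gl_module \<Rightarrow> nat list \<Rightarrow> bool" where
  "irreducible_hw_module n V \<mu> \<longleftrightarrow>
     is_gl_module n V \<and> irreducible_module n V \<and> highest_weight_module n V \<mu>"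

definition direct_sum :: "'i set \<Rightarrow> ('i \<Rightarrow> 'a::ab_group_add gl_module) \<Rightarrow> ('i \<Rightarrow>\<^sub>0 'a) gl_module" where
  "direct_sum I V =
     \<lparr>mspace = {f. Poly_Mapping.keys f \<subseteq> I \<and> (\<forall>x\<in>I. Poly_Mapping.lookup f x \<in> mspace (V x))},
      mscale = (\<lambda>c. Poly_Mapping.mapp (\<lambda>x. mscale (V x) c)),
      mact = (\<lambda>i j. Poly_Mapping.mapp (\<lambda>x. mact (V x) i j))\<rparr>"

definition gl_isomorphic ::
    "nat \<Rightarrow> 'a::ab_group_add gl_module \<Rightarrow> 'b::ab_group_add gl_module \<Rightarrow> bool" where
  "gl_isomorphic n V W \<longleftrightarrow> (\<exists>\<phi>. bij_betw \<phi> (mspace V) (mspace W) \<and>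
     (\<forall>v\<in>mspace V. \<forall>w\<in>mspace V. \<phi> (v + w) = \<phi> v + \<phi> w) \<and>
     (\<forall>c. \<forall>v\<in>mspace V. \<phi> (mscale V c v) = mscale W c (\<phi> v)) \<and>
     (\<forall>i<n. \<forall>j<n. \<forall>v\<in>mspace V. \<phi> (mact V i j v) = mact W i j (\<phi> v)))"

definition is_basis_family ::
    "(complex \<Rightarrow> 'a::ab_group_add \<Rightarrow> 'a) \<Rightarrow> nat \<Rightarrow> (nat \<Rightarrow> 'a) \<Rightarrow> 'a set \<Rightarrow> bool" where
  "is_basis_family s K v S \<longleftrightarrow>
     inj_on v {..<K} \<and> \<not> Modules.module.dependent s (v ` {..<K}) \<and>
     Modules.module.span s (v ` {..<K}) = S"


section \<open>Kostka numbers\<close>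

definition cells :: "nat list \<Rightarrow> (nat \<times> nat) set" where
  "cells \<mu> = {(r, c). r < length \<mu> \<and> c < \<mu> ! r}"

definition semistandard_tableaux :: "nat list \<Rightarrow> nat list \<Rightarrow> (nat \<times> nat \<Rightarrow> nat) set" where
  "semistandard_tableaux \<mu> \<eta> = {T \<in> cells \<mu> \<rightarrow>\<^sub>E {..<length \<eta>}.
     (\<forall>r c c'. (r, c) \<in> cells \<mu> \<and> (r, c') \<in> cells \<mu> \<and> c < c' \<longrightarrow> T (r, c) \<le> T (r, c')) \<and>
     (\<forall>r r' c. (r, c) \<in> cells \<mu> \<and> (r', c) \<in> cells \<mu> \<and> r < r' \<longrightarrow> T (r, c) < T (r', c)) \<and>
     (\<forall>k<length \<eta>. card {x \<in> cells \<mu>. T x = k} = \<eta> ! k)}"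

definition kostka :: "nat list \<Rightarrow> nat list \<Rightarrow> nat" where
  "kostka \<mu> \<eta> = card (semistandard_tableaux \<mu> \<eta>)"


section \<open>Polynomials and the alpha-determinant\<close>

type_synonym 'v mpoly = "('v \<Rightarrow>\<^sub>0 nat) \<Rightarrow>\<^sub>0 complex"

definition cscale :: "complex \<Rightarrow> ('k \<Rightarrow>\<^sub>0 complex) \<Rightarrow> ('k \<Rightarrow>\<^sub>0 complex)" where
  "cscale c = Poly_Mapping.map ((*) c)"

definition Var :: "'v \<Rightarrow> 'v mpoly" where
  "Var v = Poly_Mapping.single (Poly_Mapping.single v 1) 1"

definition partial_deriv :: "'v \<Rightarrow> 'v mpoly \<Rightarrow> 'v mpoly" where
  "partial_deriv v p = (\<Sum>m\<in>Poly_Mapping.keys p.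
     Poly_Mapping.single (m - Poly_Mapping.single v 1)
       (of_nat (Poly_Mapping.lookup m v) * Poly_Mapping.lookup p m))"

text \<open>The algebra of polynomials in the entries \<open>x_{ij}\<close>, where \<open>x_{ij}\<close> is \<open>Var (i, j)\<close>.\<close>

definition poly_module :: "nat \<Rightarrow> (nat \<times> nat) mpoly gl_module" where
  "poly_module n =
     \<lparr>mspace = {p. \<forall>m\<in>Poly_Mapping.keys p. Poly_Mapping.keys m \<subseteq> {..<n} \<times> {..<n}},
      mscale = cscale,
      mact = (\<lambda>i j f. \<Sum>k<n. Var (i, k) * partial_deriv (j, k) f)\<rparr>"

text \<open>The number of cycles counts fixed points as cycles of length one.\<close>

definition perm_nu :: "nat \<Rightarrow> (nat \<Rightarrow> nat) \<Rightarrow> nat" where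
  "perm_nu n \<sigma> = n - card (orbit \<sigma> ` {..<n})"

definition alpha_det :: "complex \<Rightarrow> 'v mpoly mat \<Rightarrow> 'v mpoly" where
  "alpha_det \<alpha> Y = (\<Sum>\<sigma> | \<sigma> permutes {..<dim_row Y}.
     cscale (\<alpha> ^ perm_nu (dim_row Y) \<sigma>) (\<Prod>j<dim_row Y. Y $$ (\<sigma> j, j)))"

definition X_mat :: "nat \<Rightarrow> (nat \<times> nat) mpoly mat" where
  "X_mat n = mat n n (\<lambda>(i, j). Var (i, j))"


section \<open>The tensor power of the symmetric power\<close>

text \<open>
  The symmetric algebra of \<open>\<complex>^n\<close> is the algebra of polynomials in the basis vectors
  \<open>e_i\<close>, here \<open>Var i\<close> for \<open>i < n\<close>.  The tensor power of the space of such polynomials is the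
  free vector space on tuples (lists) of monomials.
\<close>

definition Sym :: "nat \<Rightarrow> nat \<Rightarrow> nat mpoly set" where
  "Sym n l = {p. \<forall>m\<in>Poly_Mapping.keys p.
     Poly_Mapping.keys m \<subseteq> {..<n} \<and> (\<Sum>i<n. Poly_Mapping.lookup m i) = l}"

type_synonym tensor = "(nat \<Rightarrow>\<^sub>0 nat) list \<Rightarrow>\<^sub>0 complex"

fun pure_tensor :: "nat mpoly list \<Rightarrow> tensor" where
  "pure_tensor [] = Poly_Mapping.single [] 1"
| "pure_tensor (f # fs) =
     (\<Sum>m\<in>Poly_Mapping.keys f. \<Sum>ms\<in>Poly_Mapping.keys (pure_tensor fs).
        Poly_Mapping.single (m # ms)
          (Poly_Mapping.lookup f m * Poly_Mapping.lookup (pure_tensor fs) ms))"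

text \<open>
  On the symmetric algebra \<open>E i j\<close> acts as the derivation with \<open>e_j \<mapsto> e_i\<close> and
  \<open>e_k \<mapsto> 0\<close> for \<open>k \<noteq> j\<close>; on tensors it acts by the Leibniz rule.
\<close>

definition sym_act :: "nat \<Rightarrow> nat \<Rightarrow> nat mpoly \<Rightarrow> nat mpoly" where
  "sym_act i j f = Var i * partial_deriv j f"

definition tensor_act :: "nat \<Rightarrow> nat \<Rightarrow> tensor \<Rightarrow> tensor" where
  "tensor_act i j t = (\<Sum>ms\<in>Poly_Mapping.keys t. cscale (Poly_Mapping.lookup t ms)
     (let fs = map (\<lambda>m. Poly_Mapping.single m 1) ms
      in \<Sum>k<length fs. pure_tensor (fs[k := sym_act i j (fs ! k)])))"

definition sym_tensor_module :: "nat \<Rightarrow> nat \<Rightarrow> tensor gl_module" where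
  "sym_tensor_module n l =
     \<lparr>mspace = Modules.module.span cscale
        {pure_tensor fs |fs. length fs = n \<and> set fs \<subseteq> Sym n l},
      mscale = cscale,
      mact = tensor_act\<rparr>"

definition col_sum_matrices :: "nat \<Rightarrow> nat \<Rightarrow> nat mat set" where
  "col_sum_matrices n l = {M \<in> carrier_mat n n. \<forall>j<n. (\<Sum>i<n. M $$ (i, j)) = l}"

definition basis_tensor :: "nat \<Rightarrow> nat mat \<Rightarrow> tensor" where
  "basis_tensor n M = pure_tensor (map (\<lambda>j. \<Prod>i<n. Var i ^ (M $$ (i, j))) [0..<n])"

text \<open>The tuple of exponents at which \<open>basis_tensor n M\<close> has its only nonzero coefficient, 1.\<close>

definition tensor_exponents :: "nat \<Rightarrow> nat mat \<Rightarrow> (nat \<Rightarrow>\<^sub>0 nat) list" where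
  "tensor_exponents n M = map (\<lambda>j. \<Sum>i<n. Poly_Mapping.single i (M $$ (i, j))) [0..<n]"


section \<open>The intertwiner and the transition matrix\<close>

text \<open>
  For a matrix \<open>N\<close> with entries 0, 1 and column sums 1, \<open>col_position n N j\<close> is the row of
  the entry 1 in column \<open>j\<close>.
\<close>

definition col_position :: "nat \<Rightarrow> nat mat \<Rightarrow> nat \<Rightarrow> nat" where
  "col_position n N j = (THE i. i < n \<and> N $$ (i, j) = 1)"

definition D_unit :: "nat \<Rightarrow> complex \<Rightarrow> nat mat \<Rightarrow> (nat \<times> nat) mpoly" where
  "D_unit n \<alpha> N = alpha_det \<alpha> (mat n n (\<lambda>(i, j). Var (col_position n N i, j)))"

definition D_poly :: "nat \<Rightarrow> nat \<Rightarrow> complex \<Rightarrow> nat mat \<Rightarrow> (nat \<times> nat) mpoly" where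
  "D_poly n l \<alpha> M =
     cscale (of_nat (\<Prod>i<n. \<Prod>j<n. fact (M $$ (i, j))) / of_nat (fact l ^ n))
       (\<Sum>Ms | length Ms = l \<and> set Ms \<subseteq> col_sum_matrices n 1 \<and>
               (\<forall>i<n. \<forall>j<n. (\<Sum>p<l. (Ms ! p) $$ (i, j)) = M $$ (i, j)).
          \<Prod>p<l. D_unit n \<alpha> (Ms ! p))"

definition Phi :: "nat \<Rightarrow> nat \<Rightarrow> complex \<Rightarrow> tensor \<Rightarrow> (nat \<times> nat) mpoly" where
  "Phi n l \<alpha> t = (\<Sum>M\<in>col_sum_matrices n l.
     cscale (Poly_Mapping.lookup t (tensor_exponents n M)) (D_poly n l \<alpha> M))"

lemma basis_tensor_eq: "basis_tensor n M = Poly_Mapping.single (tensor_exponents n M) 1"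
proof -
  have pow: "Var v ^ k = Poly_Mapping.single (Poly_Mapping.single v k) (1::complex)"
    for v :: nat and k :: nat
    by (induction k) (simp_all add: Var_def mult_single single_add[symmetric])
  have prod: "(\<Prod>i<n. Var i ^ f i) =
      Poly_Mapping.single (\<Sum>i<n. Poly_Mapping.single i (f i)) (1::complex)" for f :: "nat \<Rightarrow> nat"
    by (induction n) (simp_all add: pow mult_single add.commute)
  have pure: "pure_tensor (map (\<lambda>m. Poly_Mapping.single m 1) ms) = Poly_Mapping.single ms 1" for ms
    by (induction ms) simp_all
  show ?thesis
    using pure[of "tensor_exponents n M"]
    by (simp add: basis_tensor_def tensor_exponents_def prod comp_def)
qed

lemma tensor_exponents_inj:
  assumes "M \<in> carrier_mat n n" "M' \<in> carrier_mat n n"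
    and eq: "tensor_exponents n M = tensor_exponents n M'"
  shows "M = M'"
proof (rule eq_matI)
  fix i j assume "i < dim_row M'" "j < dim_col M'"
  hence i: "i < n" and j: "j < n" using assms by auto
  have l: "Poly_Mapping.lookup (tensor_exponents n A ! j) i = A $$ (i, j)" for A
    using i j by (simp add: tensor_exponents_def lookup_sum lookup_single when_def)
  show "M $$ (i, j) = M' $$ (i, j)" using l[of M] l[of M'] eq by simp
qed (use assms in auto)

lemma finite_col_sum_matrices: "finite (col_sum_matrices n l)"
proof -
  have "col_sum_matrices n l \<subseteq> (\<lambda>f. mat n n f) ` (({..<n} \<times> {..<n}) \<rightarrow>\<^sub>E {..l})"
  proof
    fix M assume M: "M \<in> col_sum_matrices n l"
    have le: "M $$ (i, j) \<le> l" if "i < n" "j < n" for i j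
      using M that member_le_sum[of i "{..<n}" "\<lambda>i. M $$ (i, j)"]
      by (auto simp: col_sum_matrices_def)
    have "M = mat n n (restrict (\<lambda>ij. M $$ ij) ({..<n} \<times> {..<n}))"
      using M by (intro eq_matI) (auto simp: col_sum_matrices_def)
    moreover have "restrict (\<lambda>ij. M $$ ij) ({..<n} \<times> {..<n}) \<in> ({..<n} \<times> {..<n}) \<rightarrow>\<^sub>E {..l}"
      using le by auto
    ultimately show "M \<in> (\<lambda>f. mat n n f) ` (({..<n} \<times> {..<n}) \<rightarrow>\<^sub>E {..l})" by blast
  qed
  moreover have "finite (({..<n} \<times> {..<n}) \<rightarrow>\<^sub>E {..l} :: (nat \<times> nat \<Rightarrow> nat) set)"
    by (intro finite_PiE) auto
  ultimately show ?thesis using finite_surj by blast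
qed

lemma Phi_basis_tensor:
  assumes "M \<in> col_sum_matrices n l"
  shows "Phi n l \<alpha> (basis_tensor n M) = D_poly n l \<alpha> M"
proof -
  have zero: "cscale 0 p = 0" and one: "cscale 1 p = p" for p :: "(nat \<times> nat) mpoly"
    unfolding cscale_def by (transfer; auto simp: when_def fun_eq_iff)+
  have "Phi n l \<alpha> (basis_tensor n M) =
      (\<Sum>M'\<in>col_sum_matrices n l. if M' = M then D_poly n l \<alpha> M' else 0)"
    unfolding Phi_def basis_tensor_eq
  proof (rule sum.cong[OF refl])
    fix M' assume M': "M' \<in> col_sum_matrices n l"
    have "tensor_exponents n M = tensor_exponents n M' \<longleftrightarrow> M' = M"
      using tensor_exponents_inj[of M n M'] assms M' by (auto simp: col_sum_matrices_def)
    thus "cscale (Poly_Mapping.lookup (Poly_Mapping.single (tensor_exponents n M) 1)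
        (tensor_exponents n M')) (D_poly n l \<alpha> M') = (if M' = M then D_poly n l \<alpha> M' else 0)"
      by (simp add: lookup_single zero one)
  qed
  also have "\<dots> = D_poly n l \<alpha> M"
    using assms finite_col_sum_matrices by simp
  finally show ?thesis .
qed

text \<open>
  \<open>THE\<close> is meaningful when \<open>v\<close> is a basis of the highest weight vectors of weight \<open>\<mu>\<close>:
  \<open>Phi n l 0\<close> is injective on the tensor space, its image contains that of \<open>Phi n l \<alpha>\<close>,
  and both maps are intertwiners.
\<close>

definition transition_matrix ::
    "nat \<Rightarrow> nat \<Rightarrow> complex \<Rightarrow> nat list \<Rightarrow> (nat \<Rightarrow> tensor) \<Rightarrow> complex mat" where
  "transition_matrix n l \<alpha> \<mu> v =
     (let K = kostka \<mu> (replicate n l) in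
      THE F. F \<in> carrier_mat K K \<and>
        (\<forall>j<K. Phi n l \<alpha> (v j) = (\<Sum>i<K. cscale (F $$ (i, j)) (Phi n l 0 (v i)))))"

abbreviation mat_rank :: "complex mat \<Rightarrow> nat" where
  "mat_rank F \<equiv> vec_space.rank (dim_row F) F"

end

theory Submission
  imports Defs "HOL-Library.Product_Plus"
begin

text \<open>
  Writing the exponents of a basis tensor as a matrix identifies the tensor space with the space
  \<open>P\<close> of polynomials all of whose monomials have column degrees \<open>l\<close>.  Under this identification
  \<open>Phi\<close> becomes an endomorphism \<open>T\<close> of the \<open>gl_n\<close>-module \<open>P\<close>.  The module \<open>P\<close> is generated by
  \<open>x_11^l \<cdots> x_nn^l\<close>, which \<open>T\<close> sends to the power of the alpha-determinant, so the cyclic module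
  in question is \<open>T P\<close>.

  \<open>E j i\<close> is adjoint to \<open>E i j\<close> for the Fischer inner product.  Hence orthogonal complements of
  submodules are submodules, and every submodule of \<open>P\<close> is the orthogonal sum of the irreducible
  modules generated by orthogonal bases of its spaces of highest weight vectors.  The multiplicity
  of the module of highest weight \<open>\<mu>\<close> in \<open>T P\<close> is therefore the dimension of the space of highest
  weight vectors of weight \<open>\<mu>\<close> in \<open>T P\<close>.  Lifting along the orthogonal complement of the kernel of
  \<open>T\<close>, this space is the image under \<open>T\<close> of the highest weight vectors of \<open>P\<close>, and its dimension is
  the rank of the transition matrix, because \<open>T\<close> is bijective for \<open>\<alpha> = 0\<close>.
\<close>

section \<open>Highest weight modules\<close>

text \<open>The modules \<open>\<M> \<mu>\<close> are arbitrary: they live over another type, carry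
  no inner product and are not assumed finite-dimensional or spanned by weight vectors. That such an
  irreducible module is determined by its highest weight has to rest on the commutation relations
  alone, which is why the locale below treats a general module. Irreducibility and decomposition are
  proved on the polynomial side, where \<open>col_space n l\<close> has a finite basis of monomials
  and orthogonal projections exist. The Fischer weight \<open>mfact m\<close>, the product of the
  factorials of the exponents, makes differentiation adjoint to multiplication. The same product
  occurs in the normalisation of \<open>D_poly\<close>, where it makes \<open>Phi\<close> commute
  with the action. That \<open>Phi\<close> is an intertwiner, and bijective onto the
  column-homogeneous polynomials at parameter 0, is derived from the definitions. The size
  \<open>kostka \<mu> (replicate n l)\<close> of the transition matrix is the length of the bases
  given by hypothesis.\<close>

locale gl_rep =
  fixes n :: nat and V :: "'a::ab_group_add gl_module"
  assumes gl_module: "is_gl_module n V"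
begin

sublocale vector_space "mscale V"
  using gl_module by (simp add: is_gl_module_def)

lemma subspace_mspace: "subspace (mspace V)"
  and act_closed: "i < n \<Longrightarrow> j < n \<Longrightarrow> x \<in> mspace V \<Longrightarrow> mact V i j x \<in> mspace V"
  and act_add: "i < n \<Longrightarrow> j < n \<Longrightarrow> x \<in> mspace V \<Longrightarrow> y \<in> mspace V \<Longrightarrow>
    mact V i j (x + y) = mact V i j x + mact V i j y"
  and act_scale: "i < n \<Longrightarrow> j < n \<Longrightarrow> x \<in> mspace V \<Longrightarrow>
    mact V i j (mscale V c x) = mscale V c (mact V i j x)"
  and act_commute: "i < n \<Longrightarrow> j < n \<Longrightarrow> k < n \<Longrightarrow> m < n \<Longrightarrow> x \<in> mspace V \<Longrightarrow>
    mact V i j (mact V k m x) = mact V k m (mact V i j x) +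
      ((if j = k then mact V i m x else 0) - (if m = i then mact V k j x else 0))"
  using gl_module by (auto simp: is_gl_module_def algebra_simps)

lemmas mspace_zero = subspace_0[OF subspace_mspace]
  and mspace_add = subspace_add[OF subspace_mspace]
  and mspace_scale = subspace_scale[OF subspace_mspace]
  and mspace_diff = subspace_diff[OF subspace_mspace]

lemma act_zero: "i < n \<Longrightarrow> j < n \<Longrightarrow> mact V i j 0 = 0"
  using act_scale[of i j 0 0] mspace_zero by simp

lemma act_diff: "i < n \<Longrightarrow> j < n \<Longrightarrow> x \<in> mspace V \<Longrightarrow> y \<in> mspace V \<Longrightarrow>
    mact V i j (x - y) = mact V i j x - mact V i j y"
  using act_add[of i j "x - y" y] mspace_diff by simp

lemma is_submoduleD:
  assumes "is_submodule n V S"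
  shows "S \<subseteq> mspace V" "subspace S" "i < n \<Longrightarrow> j < n \<Longrightarrow> x \<in> S \<Longrightarrow> mact V i j x \<in> S"
  using assms by (auto simp: is_submodule_def)

lemma is_submodule_rep:
  assumes "is_submodule n V S"
  shows "is_gl_module n (V\<lparr>mspace := S\<rparr>)"
  using assms gl_module by (auto simp: is_submodule_def is_gl_module_def subset_iff)

lemma word_in_submodule:
  assumes "is_submodule n V S" "x \<in> S" "set ws \<subseteq> {..<n} \<times> {..<n}"
  shows "foldr (\<lambda>(i, j). mact V i j) ws x \<in> S"
  using assms(3) by (induction ws) (auto intro: assms(2) is_submoduleD(3)[OF assms(1)])

lemma mspace_submodule: "is_submodule n V (mspace V)"
  by (simp add: is_submodule_def subspace_mspace act_closed)

text \<open>\<open>mact\<close> is additive and homogeneous only on \<open>mspace V\<close>, so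
  general facts on linear maps do not apply directly; instead the vectors of \<open>mspace V\<close>
  that are mapped into the span form a subspace containing \<open>B\<close>.\<close>

lemma act_span_closed:
  assumes "B \<subseteq> mspace V" "\<And>x. x \<in> B \<Longrightarrow> mact V i j x \<in> span B" "i < n" "j < n" "x \<in> span B"
  shows "mact V i j x \<in> span B"
proof -
  have sub: "span B \<subseteq> mspace V" by (intro span_minimal assms subspace_mspace)
  have "span B \<subseteq> {x \<in> mspace V. mact V i j x \<in> span B}"
  proof (rule span_minimal)
    show "subspace {x \<in> mspace V. mact V i j x \<in> span B}"
      using assms(3,4) by (intro subspaceI)
        (auto simp: act_zero act_add act_scale mspace_zero mspace_add mspace_scale span_zero
          intro: span_add span_scale)
    show "B \<subseteq> {x \<in> mspace V. mact V i j x \<in> span B}" using assms by auto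
  qed
  thus ?thesis using assms(5) by auto
qed

lemma cyclic_submodule_is_submodule:
  assumes "x \<in> mspace V"
  shows "is_submodule n V (mspace (cyclic_submodule n V x))"
proof -
  let ?W = "{foldr (\<lambda>(i, j). mact V i j) ws x |ws. set ws \<subseteq> {..<n} \<times> {..<n}}"
  have W: "?W \<subseteq> mspace V" using word_in_submodule[OF mspace_submodule assms] by auto
  have step: "mact V i j y \<in> span ?W" if ij: "i < n" "j < n" and y: "y \<in> ?W" for i j y
  proof -
    obtain ws where "y = foldr (\<lambda>(i, j). mact V i j) ws x" "set ws \<subseteq> {..<n} \<times> {..<n}"
      using y by auto
    hence "mact V i j y = foldr (\<lambda>(i, j). mact V i j) ((i, j) # ws) x"
      "set ((i, j) # ws) \<subseteq> {..<n} \<times> {..<n}" using ij by auto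
    thus ?thesis by (intro span_base) blast
  qed
  show ?thesis unfolding is_submodule_def cyclic_submodule_def
    using act_span_closed[OF W] step span_minimal[OF W subspace_mspace] by auto
qed

lemma cyclic_submodule_contains: "x \<in> mspace (cyclic_submodule n V x)"
proof -
  have "x = foldr (\<lambda>(i, j). mact V i j) [] x" "set [] \<subseteq> {..<n} \<times> {..<n}" by auto
  thus ?thesis unfolding cyclic_submodule_def by (simp, intro span_base) blast
qed

lemma cyclic_submodule_least:
  assumes "is_submodule n V S" "x \<in> S"
  shows "mspace (cyclic_submodule n V x) \<subseteq> S"
proof -
  have "span {foldr (\<lambda>(i, j). mact V i j) ws x |ws. set ws \<subseteq> {..<n} \<times> {..<n}} \<subseteq> S"
    using word_in_submodule[OF assms] by (intro span_minimal is_submoduleD(2)[OF assms(1)]) auto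
  thus ?thesis by (simp add: cyclic_submodule_def)
qed

section \<open>The lower triangular part acting on a highest weight vector\<close>

inductive lowering_word :: "'a \<Rightarrow> 'a \<Rightarrow> nat \<Rightarrow> bool" for w where
  base: "lowering_word w w 0"
| lower: "lowering_word w x d \<Longrightarrow> b < a \<Longrightarrow> a < n \<Longrightarrow> lowering_word w (mact V a b x) (d + (a - b))"

text \<open>This is U(n^-) w, with n^- spanned by the \<open>E a b\<close>, \<open>b < a\<close>.
  The number carried by \<open>lowering_word\<close> is the total drop in height,
  \<open>a - b\<close> for each letter, and is 0 only for the empty word.\<close>

definition lowered :: "'a \<Rightarrow> 'a set" where
  "lowered w = span {x. \<exists>d. lowering_word w x d}"

lemma hw_vectorsD:
  assumes "w \<in> hw_vectors n V \<mu>"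
  shows "w \<in> mspace V" "i < j \<Longrightarrow> j < n \<Longrightarrow> mact V i j w = 0"
    "i < n \<Longrightarrow> mact V i i w = mscale V (of_nat (part \<mu> i)) w"
  using assms by (auto simp: hw_vectors_def)

lemma lowering_word_in_submodule:
  assumes "lowering_word w x d" "is_submodule n V S" "w \<in> S"
  shows "x \<in> S"
  using assms(1) by induction (auto intro: is_submoduleD(3)[OF assms(2)] assms(3))

text \<open>Raising operators are moved to the right past the lowering ones, one commutator at a time.\<close>

lemma act_lowering_word:
  assumes "w \<in> hw_vectors n V \<mu>" "lowering_word w x d"
  shows "\<forall>i<n. \<forall>j<n. mact V i j x \<in> lowered w"
  using assms(2)
proof induction
  case base
  show ?case
  proof (intro allI impI)
    fix i j assume ij: "i < n" "j < n"
    consider "i < j" | "i = j" | "j < i" by linarith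
    thus "mact V i j w \<in> lowered w"
    proof cases
      case 3
      thus ?thesis unfolding lowered_def
        using lowering_word.lower[OF lowering_word.base 3 ij(1)] by (blast intro: span_base)
    next
      case 2
      have "w \<in> lowered w" unfolding lowered_def using lowering_word.base by (blast intro: span_base)
      thus ?thesis using 2 ij hw_vectorsD(3)[OF assms(1)] by (simp add: lowered_def span_scale)
    qed (use hw_vectorsD[OF assms(1)] ij in \<open>auto simp: lowered_def span_zero\<close>)
  qed
next
  case (lower x d b a)
  have x: "x \<in> mspace V"
    using lowering_word_in_submodule[OF lower(1) mspace_submodule] hw_vectorsD[OF assms(1)] by auto
  have low: "mact V a b y \<in> lowered w" if "y \<in> lowered w" for y
    unfolding lowered_def
  proof (rule act_span_closed)
    show "{x. \<exists>d. lowering_word w x d} \<subseteq> mspace V"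
      using lowering_word_in_submodule[OF _ mspace_submodule] hw_vectorsD[OF assms(1)] by auto
    fix y assume "y \<in> {x. \<exists>d. lowering_word w x d}"
    thus "mact V a b y \<in> span {x. \<exists>d. lowering_word w x d}"
      using lowering_word.lower lower(2,3) by (blast intro: span_base)
  qed (use that lower in \<open>auto simp: lowered_def\<close>)
  show ?case
  proof (intro allI impI)
    fix i j assume ij: "i < n" "j < n"
    have ab: "a < n" "b < n" using lower by auto
    show "mact V i j (mact V a b x) \<in> lowered w"
      \<comment> \<open>The induction hypothesis speaks of all \<open>i\<close> and \<open>j\<close>
        at once, so it covers the exchanged term, by \<open>low\<close>, and both commutator terms
        \<open>E i b x\<close> and \<open>E a j x\<close>.\<close>
      unfolding act_commute[OF ij ab x] using lower.IH ij ab low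
      by (auto simp: lowered_def span_zero intro!: span_add span_diff span_neg)
  qed
qed

text \<open>The equality U(gl_n) w = U(n^-) w: by \<open>act_lowering_word\<close> the right-hand
  side is stable under every \<open>E i j\<close>, and it contains \<open>w\<close>.\<close>

lemma cyclic_submodule_hw:
  assumes "w \<in> hw_vectors n V \<mu>"
  shows "mspace (cyclic_submodule n V w) = lowered w"
proof
  have "is_submodule n V (lowered w)"
    unfolding is_submodule_def
  proof (intro conjI allI impI ballI)
    have *: "{x. \<exists>d. lowering_word w x d} \<subseteq> mspace V"
      using lowering_word_in_submodule[OF _ mspace_submodule] hw_vectorsD[OF assms(1)] by auto
    show "lowered w \<subseteq> mspace V" unfolding lowered_def by (rule span_minimal[OF * subspace_mspace])
    show "mact V i j x \<in> lowered w" if "i < n" "j < n" "x \<in> lowered w" for i j x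
      unfolding lowered_def
      by (rule act_span_closed[OF *])
        (use that act_lowering_word[OF assms] in \<open>auto simp: lowered_def\<close>)
  qed (simp add: lowered_def)
  thus "mspace (cyclic_submodule n V w) \<subseteq> lowered w"
    by (rule cyclic_submodule_least) (auto simp: lowered_def intro: span_base lowering_word.base)
  show "lowered w \<subseteq> mspace (cyclic_submodule n V w)"
    unfolding lowered_def
    using lowering_word_in_submodule[OF _ cyclic_submodule_is_submodule] hw_vectorsD[OF assms]
      cyclic_submodule_is_submodule[of w]
    by (intro span_minimal) (auto simp: cyclic_submodule_contains is_submodule_def)
qed

text \<open>
  The element \<open>diag (n, n - 1, ..., 1)\<close> of the Cartan subalgebra separates the highest weight from
  all lower ones: \<open>E a b\<close> with \<open>b < a\<close> decreases its eigenvalue by \<open>a - b\<close>.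
\<close>

definition height_op :: "'a \<Rightarrow> 'a" where
  "height_op x = (\<Sum>i<n. mscale V (of_nat (n - i)) (mact V i i x))"

lemma height_op_closed: "x \<in> mspace V \<Longrightarrow> height_op x \<in> mspace V"
  unfolding height_op_def by (intro subspace_sum[OF subspace_mspace] mspace_scale act_closed) auto

lemma height_op_add: "x \<in> mspace V \<Longrightarrow> y \<in> mspace V \<Longrightarrow>
    height_op (x + y) = height_op x + height_op y"
  unfolding height_op_def by (simp add: act_add scale_right_distrib sum.distrib)

lemma height_op_scale: "x \<in> mspace V \<Longrightarrow> height_op (mscale V c x) = mscale V c (height_op x)"
  unfolding height_op_def by (simp add: act_scale scale_sum_right mult.commute)

lemma height_op_lower:
  assumes "x \<in> mspace V" "b < n" "a < n"
  shows "height_op (mact V a b x) = mact V a b (height_op x) +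
    mscale V (of_nat b - of_nat a) (mact V a b x)"
proof -
  have "height_op (mact V a b x) = (\<Sum>i<n. mact V a b (mscale V (of_nat (n - i)) (mact V i i x)) +
     (mscale V (of_nat (n - i)) (if i = a then mact V a b x else 0) -
      mscale V (of_nat (n - i)) (if i = b then mact V a b x else 0)))"
    unfolding height_op_def using assms
    by (intro sum.cong refl) (auto simp: act_commute[of _ _ a b] act_scale act_closed
      scale_right_distrib scale_right_diff_distrib)
  also have "\<dots> = (\<Sum>i<n. mact V a b (mscale V (of_nat (n - i)) (mact V i i x))) +
     (mscale V (of_nat (n - a)) (mact V a b x) - mscale V (of_nat (n - b)) (mact V a b x))"
    using assms by (simp add: sum.distrib sum_subtractf if_distrib[of "mscale V _"] cong: if_cong)
  also have "mscale V (of_nat (n - a)) (mact V a b x) - mscale V (of_nat (n - b)) (mact V a b x) =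
     mscale V (of_nat b - of_nat a) (mact V a b x)"
    using assms by (simp add: scale_left_diff_distrib[symmetric] of_nat_diff)
  also have "(\<Sum>i<n. mact V a b (mscale V (of_nat (n - i)) (mact V i i x))) = mact V a b (height_op x)"
  proof -
    have "mact V a b (sum f A) = (\<Sum>i\<in>A. mact V a b (f i))"
      if "finite A" "\<And>i. i \<in> A \<Longrightarrow> f i \<in> mspace V" for f A
      using that by (induction A rule: finite_induct)
        (auto simp: act_zero act_add subspace_sum[OF subspace_mspace] assms)
    from this[of "{..<n}" "\<lambda>i. mscale V (of_nat (n - i)) (mact V i i x)"]
    show ?thesis unfolding height_op_def using assms by (simp add: mspace_scale act_closed)
  qed
  finally show ?thesis .
qed

lemma height_op_lowering_word:
  assumes "w \<in> mspace V" "height_op w = mscale V h w" "lowering_word w x d"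
  shows "x \<in> mspace V \<and> height_op x = mscale V (h - of_nat d) x"
  using assms(3)
proof induction
  case base
  then show ?case using assms by simp
next
  case (lower x d b a)
  hence "height_op (mact V a b x) =
      mscale V (h - of_nat d + (of_nat b - of_nat a)) (mact V a b x)"
    by (subst height_op_lower) (auto simp: act_scale scale_left_distrib)
  moreover have "h - of_nat d + (of_nat b - of_nat a) = h - of_nat (d + (a - b))"
    using lower by (simp add: of_nat_diff)
  ultimately show ?case using lower by (auto intro: act_closed)
qed

text \<open>This is the product of the operators \<open>height_op - (h - e)\<close> over
  \<open>e = 1, ..., d\<close>. It annihilates the heights \<open>h - 1, ..., h - d\<close> and acts
  on height \<open>h\<close> as the factorial of \<open>d\<close>, so it cuts off what lies below
  the highest weight vector.\<close>

primrec cut_op :: "complex \<Rightarrow> nat \<Rightarrow> 'a \<Rightarrow> 'a" where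
  "cut_op h 0 x = x"
| "cut_op h (Suc d) x = height_op (cut_op h d x) - mscale V (h - of_nat (Suc d)) (cut_op h d x)"

lemma cut_op_closed: "x \<in> mspace V \<Longrightarrow> cut_op h d x \<in> mspace V"
  by (induction d) (auto intro: mspace_diff height_op_closed mspace_scale)

lemma cut_op_add: "x \<in> mspace V \<Longrightarrow> y \<in> mspace V \<Longrightarrow>
    cut_op h d (x + y) = cut_op h d x + cut_op h d y"
  by (induction d) (auto simp: height_op_add cut_op_closed scale_right_distrib)

lemma cut_op_scale: "x \<in> mspace V \<Longrightarrow> cut_op h d (mscale V c x) = mscale V c (cut_op h d x)"
  by (induction d) (auto simp: height_op_scale cut_op_closed scale_right_diff_distrib mult.commute)

lemma cut_op_mono:
  assumes "x \<in> mspace V" "cut_op h d x = 0" "d \<le> e"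
  shows "cut_op h e x = 0"
  using assms(3)
proof (induction e rule: dec_induct)
  case (step e)
  have "height_op 0 = 0" using height_op_scale[OF mspace_zero, of 0] by simp
  thus ?case using step by simp
qed (simp add: assms)

lemma cut_op_eigenvector:
  assumes "x \<in> mspace V" "height_op x = mscale V (h - of_nat c) x"
  shows "cut_op h d x = mscale V (\<Prod>e=1..d. of_nat e - of_nat c) x"
proof (induction d)
  case (Suc d)
  show ?case
    unfolding cut_op.simps Suc height_op_scale[OF assms(1)] assms(2)
    unfolding scale_scale scale_left_diff_distrib[symmetric]
    by (rule arg_cong[of _ _ "\<lambda>c. mscale V c x"]) (simp add: algebra_simps)
qed simp

lemma hw_height:
  assumes "w \<in> hw_vectors n V \<mu>"
  shows "height_op w = mscale V (\<Sum>i<n. of_nat (n - i) * of_nat (part \<mu> i)) w"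
  unfolding height_op_def using hw_vectorsD[OF assms] by (simp add: scale_sum_left)

text \<open>Modulo vectors killed by some \<open>cut_op h d\<close>, every element of U(n^-) w is a
  multiple of \<open>w\<close>. For a highest weight vector \<open>s\<close> of the same weight the
  remainder \<open>s - c w\<close> has height \<open>h\<close> again, where \<open>cut_op\<close> is
  multiplication by a nonzero factorial; so the remainder vanishes.\<close>

lemma hw_vectors_cyclic_submodule:
  assumes w: "w \<in> hw_vectors n V \<mu>" and s: "s \<in> hw_vectors n V \<mu>"
    and "s \<in> mspace (cyclic_submodule n V w)"
  shows "\<exists>c. s = mscale V c w"
proof -
  define h :: complex where "h = (\<Sum>i<n. of_nat (n - i) * of_nat (part \<mu> i))"
  note wV = hw_vectorsD(1)[OF w] and sV = hw_vectorsD(1)[OF s]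
  have wh: "height_op w = mscale V h w" and sh: "height_op s = mscale V h s"
    using hw_height[OF w] hw_height[OF s] by (simp_all add: h_def)
  let ?T = "{x \<in> mspace V. \<exists>c d. cut_op h d (x - mscale V c w) = 0}"
  have "lowered w \<subseteq> ?T"
    unfolding lowered_def
  proof (rule span_minimal)
    show "subspace ?T"
    proof (intro subspaceI, goal_cases)
      case 1
      have "cut_op h 0 (0 - mscale V 0 w) = 0" by simp
      thus ?case using mspace_zero by blast
    next
      case (2 x y)
      then obtain c d c' d' where xy: "x \<in> mspace V" "y \<in> mspace V"
        "cut_op h d (x - mscale V c w) = 0" "cut_op h d' (y - mscale V c' w) = 0" by auto
      \<comment> \<open>The two remainders may be cut off at different depths; by
        \<open>cut_op_mono\<close> the larger depth serves for both.\<close>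
      let ?d = "max d d'"
      have "cut_op h ?d (x - mscale V c w) = 0" "cut_op h ?d (y - mscale V c' w) = 0"
        by (rule cut_op_mono[OF _ xy(3)] cut_op_mono[OF _ xy(4)];
            use xy wV in \<open>simp add: mspace_diff mspace_scale\<close>)+
      moreover have eq: "x + y - mscale V (c + c') w = (x - mscale V c w) + (y - mscale V c' w)"
        by (simp add: scale_left_distrib)
      ultimately have "cut_op h ?d (x + y - mscale V (c + c') w) = 0"
        unfolding eq using xy wV by (subst cut_op_add) (auto intro: mspace_diff mspace_scale)
      thus ?case using xy by (auto intro: mspace_add)
    next
      case (3 a x)
      then obtain c d where x: "x \<in> mspace V" "cut_op h d (x - mscale V c w) = 0" by auto
      have "mscale V a x - mscale V (a * c) w = mscale V a (x - mscale V c w)"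
        by (simp add: scale_right_diff_distrib)
      hence "cut_op h d (mscale V a x - mscale V (a * c) w) = 0"
        using x wV by (simp only: cut_op_scale mspace_diff mspace_scale scale_zero_right)
      thus ?case using x by (auto intro: mspace_scale)
    qed
  next
    have "x \<in> ?T" if d: "lowering_word w x d" for x d
    proof -
    note x = height_op_lowering_word[OF wV wh d]
    show ?thesis
    proof (cases "d = 0")
      case True
      have "x = w" using d[unfolded True] by cases auto
      hence "cut_op h 0 (x - mscale V 1 w) = 0" by simp
      thus ?thesis using x by blast
    next
      case False
      \<comment> \<open>A word of positive drop \<open>d\<close> needs no multiple of
        \<open>w\<close>: in the scalar by which \<open>cut_op h d\<close> acts, the factor with
        \<open>e = d\<close> is 0.\<close>
      hence "cut_op h d (x - mscale V 0 w) = 0"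
        using cut_op_eigenvector[of x h d d] x by (auto simp: prod_zero_iff)
      thus ?thesis using x by blast
    qed
    qed
    thus "{x. \<exists>d. lowering_word w x d} \<subseteq> ?T" by blast
  qed
  then obtain c d where cd: "cut_op h d (s - mscale V c w) = 0"
    using assms(3) unfolding cyclic_submodule_hw[OF w] by blast
  have "height_op (s - mscale V c w) = mscale V (h - of_nat 0) (s - mscale V c w)"
    using height_op_add[of "s - mscale V c w" "mscale V c w"] wV sV sh wh
    by (simp add: mspace_diff mspace_scale height_op_scale scale_right_diff_distrib mult.commute)
  hence "cut_op h d (s - mscale V c w) = mscale V (\<Prod>e=1..d. of_nat e - of_nat 0) (s - mscale V c w)"
    using wV sV by (intro cut_op_eigenvector) (auto intro: mspace_diff mspace_scale)
  hence "s - mscale V c w = 0" using cd by (auto simp: prod_zero_iff)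
  thus ?thesis by auto
qed

end

section \<open>Uniqueness of the irreducible module with a given highest weight\<close>

definition product_module :: "'a::ab_group_add gl_module \<Rightarrow> 'b::ab_group_add gl_module \<Rightarrow> ('a \<times> 'b) gl_module"
  where "product_module V W = \<lparr>mspace = mspace V \<times> mspace W,
    mscale = (\<lambda>c. map_prod (mscale V c) (mscale W c)),
    mact = (\<lambda>i j. map_prod (mact V i j) (mact W i j))\<rparr>"

lemma is_gl_module_product:
  assumes "is_gl_module n V" "is_gl_module n W"
  shows "is_gl_module n (product_module V W)"
proof -
  interpret V: gl_rep n V by unfold_locales fact
  interpret W: gl_rep n W by unfold_locales fact
  interpret P: vector_space "mscale (product_module V W)"
    by unfold_locales (auto simp: product_module_def V.scale_right_distrib W.scale_right_distrib
      V.scale_left_distrib W.scale_left_distrib)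
  show ?thesis
    unfolding is_gl_module_def
  proof (intro conjI allI impI ballI)
    show "P.subspace (mspace (product_module V W))"
      by (rule P.subspaceI) (auto simp: product_module_def V.mspace_zero W.mspace_zero
        V.mspace_add W.mspace_add V.mspace_scale W.mspace_scale zero_prod_def)
    fix i j k m v
    assume ij: "i < n" "j < n" "k < n" "m < n" and "v \<in> mspace (product_module V W)"
    then obtain x y where v: "v = (x, y)" and xy: "x \<in> mspace V" "y \<in> mspace W"
      by (auto simp: product_module_def)
    show "mact (product_module V W) i j (mact (product_module V W) k m v) -
        mact (product_module V W) k m (mact (product_module V W) i j v) =
        (if j = k then mact (product_module V W) i m v else 0) -
        (if m = i then mact (product_module V W) k j v else 0)"
      using V.act_commute[OF ij xy(1)] W.act_commute[OF ij xy(2)]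
      by (auto simp: v product_module_def zero_prod_def)
  qed (rule P.vector_space_axioms, auto simp: product_module_def V.act_closed W.act_closed V.act_add
    W.act_add V.act_scale W.act_scale)
qed

text \<open>
  The submodule of the product generated by the pair of highest weight vectors is the graph of an
  isomorphism: it contains no other highest weight vectors of that weight than the multiples of
  this pair.
\<close>

lemma irreducible_hw_modules_isomorphic:
  fixes V :: "'a::ab_group_add gl_module" and W :: "'b::ab_group_add gl_module"
  assumes "irreducible_hw_module n V \<mu>" "irreducible_hw_module n W \<mu>"
  shows "gl_isomorphic n V W"
proof -
  have mods: "is_gl_module n V" "is_gl_module n W"
    and irr: "irreducible_module n V" "irreducible_module n W"
    using assms by (auto simp: irreducible_hw_module_def)
  obtain x0 y0 where x0: "x0 \<in> hw_vectors n V \<mu>" "x0 \<noteq> 0" and y0: "y0 \<in> hw_vectors n W \<mu>" "y0 \<noteq> 0"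
    using assms by (auto simp: irreducible_hw_module_def highest_weight_module_def)
  define P where "P = product_module V W"
  interpret V: gl_rep n V by unfold_locales fact
  interpret W: gl_rep n W by unfold_locales fact
  interpret P: gl_rep n P unfolding P_def by unfold_locales (intro is_gl_module_product mods)
  have P: "mspace P = mspace V \<times> mspace W" "mscale P c (x, y) = (mscale V c x, mscale W c y)"
    "mact P i j (x, y) = (mact V i j x, mact W i j y)" for c i j x y
    by (auto simp: P_def product_module_def)
  have hw: "(x, y) \<in> hw_vectors n P \<mu>" if "x \<in> hw_vectors n V \<mu>" "y \<in> hw_vectors n W \<mu>" for x y
    using that by (auto simp: hw_vectors_def P zero_prod_def)
  have zero_hw: "0 \<in> hw_vectors n V \<mu>" "0 \<in> hw_vectors n W \<mu>"
    by (auto simp: hw_vectors_def V.mspace_zero W.mspace_zero V.act_zero W.act_zero)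
  define N where "N = mspace (cyclic_submodule n P (x0, y0))"
  have N: "is_submodule n P N" and x0y0: "(x0, y0) \<in> N"
    unfolding N_def using P.cyclic_submodule_is_submodule P.hw_vectorsD(1) hw x0 y0
      P.cyclic_submodule_contains by blast+
  have N_zero: "(0, 0) \<in> N" using P.subspace_0[OF P.is_submoduleD(2)[OF N]] by (simp add: zero_prod_def)
  have N_add: "(x + x', y + y') \<in> N" if "(x, y) \<in> N" "(x', y') \<in> N" for x y x' y'
    using P.subspace_add[OF P.is_submoduleD(2)[OF N] that] by simp
  have N_scale: "(mscale V c x, mscale W c y) \<in> N" if "(x, y) \<in> N" for x y c
    using P.subspace_scale[OF P.is_submoduleD(2)[OF N] that] by (simp add: P)
  have N_act: "(mact V i j x, mact W i j y) \<in> N" if "(x, y) \<in> N" "i < n" "j < n" for x y i j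
    using P.is_submoduleD(3)[OF N that(2,3,1)] by (simp add: P)
  have N_sub: "x \<in> mspace V" "y \<in> mspace W" if "(x, y) \<in> N" for x y
    using P.is_submoduleD(1)[OF N] that by (auto simp: P)
  have N_hw: "\<exists>c. (x, y) = mscale P c (x0, y0)"
    if "x \<in> hw_vectors n V \<mu>" "y \<in> hw_vectors n W \<mu>" "(x, y) \<in> N" for x y
    using that hw x0 y0 unfolding N_def by (intro P.hw_vectors_cyclic_submodule) blast+
  have "is_submodule n W {y. (0, y) \<in> N}"
    unfolding is_submodule_def
  proof (intro conjI allI impI ballI)
    show "W.subspace {y. (0, y) \<in> N}"
      using N_add[of 0 _ 0] N_scale[of 0] by (intro W.subspaceI) (auto simp: N_zero)
    show "mact W i j y \<in> {y. (0, y) \<in> N}" if "i < n" "j < n" "y \<in> {y. (0, y) \<in> N}" for i j y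
      using N_act[of 0 y i j] that by (simp add: V.act_zero)
  qed (use N_sub in auto)
  moreover have "{y. (0, y) \<in> N} \<noteq> mspace W"
  proof
    assume "{y. (0, y) \<in> N} = mspace W"
    hence "(0, y0) \<in> N" using W.hw_vectorsD(1)[OF y0(1)] by auto
    \<comment> \<open>If \<open>(0, y0)\<close> is \<open>c\<close> times \<open>(x0, y0)\<close>,
      then \<open>c = 0\<close> because \<open>x0\<close> is nonzero, and \<open>y0 = 0\<close>
      follows.\<close>
    from N_hw[OF zero_hw(1) y0(1) this] show False using x0(2) y0(2) by (auto simp: P)
  qed
  ultimately have ker2: "y = 0" if "(0, y) \<in> N" for y
    using irr(2) that unfolding irreducible_module_def by blast
  have "is_submodule n V {x. (x, 0) \<in> N}"
    unfolding is_submodule_def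
  proof (intro conjI allI impI ballI)
    show "V.subspace {x. (x, 0) \<in> N}"
      using N_add[of _ 0 _ 0] N_scale[of _ 0] by (intro V.subspaceI) (auto simp: N_zero)
    show "mact V i j y \<in> {y. (y, 0) \<in> N}" if "i < n" "j < n" "y \<in> {y. (y, 0) \<in> N}" for i j y
      using N_act[of y 0 i j] that by (simp add: W.act_zero)
  qed (use N_sub in auto)
  moreover have "{x. (x, 0) \<in> N} \<noteq> mspace V"
  proof
    assume "{x. (x, 0) \<in> N} = mspace V"
    hence "(x0, 0) \<in> N" using V.hw_vectorsD(1)[OF x0(1)] by auto
    from N_hw[OF x0(1) zero_hw(2) this] show False using x0(2) y0(2) by (auto simp: P)
  qed
  ultimately have ker1: "x = 0" if "(x, 0) \<in> N" for x
    using irr(1) that unfolding irreducible_module_def by blast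
  have "is_submodule n V (fst ` N)"
    unfolding is_submodule_def
  proof (intro conjI allI impI ballI)
    show "V.subspace (fst ` N)"
    proof (rule V.subspaceI)
      show "0 \<in> fst ` N" using N_zero by force
      show "x + y \<in> fst ` N" if "x \<in> fst ` N" "y \<in> fst ` N" for x y
        using that N_add by (auto simp: image_iff) (metis fst_conv)
      show "mscale V c x \<in> fst ` N" if "x \<in> fst ` N" for c x
        using that N_scale[of x] by (auto simp: image_iff) (metis fst_conv)
    qed
    show "mact V i j y \<in> fst ` N" if "i < n" "j < n" "y \<in> fst ` N" for i j y
      using that N_act by (auto simp: image_iff) (metis fst_conv)
  qed (use N_sub in auto)
  moreover have "x0 \<in> fst ` N" using x0y0 by force
  ultimately have dom: "fst ` N = mspace V" using irr(1) x0(2) unfolding irreducible_module_def by blast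
  have "is_submodule n W (snd ` N)"
    unfolding is_submodule_def
  proof (intro conjI allI impI ballI)
    show "W.subspace (snd ` N)"
    proof (rule W.subspaceI)
      show "0 \<in> snd ` N" using N_zero by force
      show "x + y \<in> snd ` N" if "x \<in> snd ` N" "y \<in> snd ` N" for x y
        using that N_add by (auto simp: image_iff) (metis snd_conv)
      show "mscale W c x \<in> snd ` N" if "x \<in> snd ` N" for c x
        using that N_scale[of _ x] by (auto simp: image_iff) (metis snd_conv)
    qed
    show "mact W i j y \<in> snd ` N" if "i < n" "j < n" "y \<in> snd ` N" for i j y
      using that N_act by (auto simp: image_iff) (metis snd_conv)
  qed (use N_sub in auto)
  moreover have "y0 \<in> snd ` N" using x0y0 by force
  ultimately have ran: "snd ` N = mspace W" using irr(2) y0(2) unfolding irreducible_module_def by blast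
  have N_diff: "(x - x', y - y') \<in> N" if "(x, y) \<in> N" "(x', y') \<in> N" for x y x' y'
    using P.subspace_diff[OF P.is_submoduleD(2)[OF N] that] by simp
  have fun_y: "y = y'" if "(x, y) \<in> N" "(x, y') \<in> N" for x y y'
    using ker2[of "y - y'"] N_diff[OF that] by simp
  have fun_x: "x = x'" if "(x, y) \<in> N" "(x', y) \<in> N" for x x' y
    using ker1[of "x - x'"] N_diff[OF that] by simp
  \<comment> \<open>By irreducibility both kernels of \<open>N\<close> vanish and both projections
    are onto, so \<open>N\<close> relates each vector of one module to exactly one of the
    other.\<close>
  define \<phi> where "\<phi> x = (THE y. (x, y) \<in> N)" for x
  have \<phi>: "\<phi> x = y" if "(x, y) \<in> N" for x y
    unfolding \<phi>_def using that fun_y by blast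
  have \<phi>_in: "(x, \<phi> x) \<in> N" if x: "x \<in> mspace V" for x
  proof -
    obtain y where "(x, y) \<in> N" using x dom by force
    thus ?thesis using \<phi> by simp
  qed
  have "bij_betw \<phi> (mspace V) (mspace W)"
    unfolding bij_betw_def
  proof
    show "inj_on \<phi> (mspace V)" by (rule inj_onI) (metis \<phi>_in fun_x)
    show "\<phi> ` mspace V = mspace W"
    proof
      show "\<phi> ` mspace V \<subseteq> mspace W" using \<phi>_in N_sub by blast
      show "mspace W \<subseteq> \<phi> ` mspace V"
      proof
        fix y assume "y \<in> mspace W"
        then obtain x where "(x, y) \<in> N" using ran by force
        thus "y \<in> \<phi> ` mspace V" using \<phi> N_sub by blast
      qed
    qed
  qed
  thus ?thesis unfolding gl_isomorphic_def
    by (intro exI[of _ \<phi>]) (auto intro!: \<phi> N_add N_scale N_act \<phi>_in)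
qed

section \<open>Polynomials as a module\<close>

lemma lookup_cscale [simp]: "Poly_Mapping.lookup (cscale c p) k = c * Poly_Mapping.lookup p k"
  by (simp add: cscale_def Poly_Mapping.map.rep_eq when_def)

interpretation cs: vector_space cscale
  by unfold_locales (auto intro!: poly_mapping_eqI simp: lookup_add algebra_simps)

lemma cscale_single [simp]: "cscale c (Poly_Mapping.single k d) = Poly_Mapping.single k (c * d)"
  by (rule poly_mapping_eqI) (simp add: lookup_single when_def)

lemma keys_cscale: "Poly_Mapping.keys (cscale c p) \<subseteq> Poly_Mapping.keys p"
  by (auto simp: in_keys_iff)

lemma cscale_mult_left: "cscale c (p * q) = cscale c p * (q :: 'v mpoly)"
  and cscale_mult_right: "cscale c (p * q) = p * cscale c q"
proof -
  have c: "cscale c p = Poly_Mapping.single 0 c * p" for c and p :: "'v mpoly"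
  proof -
    have *: "cscale c p = Poly_Mapping.map ((*) c) p" by (simp add: cscale_def)
    show ?thesis unfolding * by (rule mult_map_scale_conv_mult)
  qed
  show "cscale c (p * q) = cscale c p * q" "cscale c (p * q) = p * cscale c q"
    unfolding c by (simp_all add: mult_ac)
qed

lemma poly_mapping_expand:
  assumes "finite A" "Poly_Mapping.keys p \<subseteq> A"
  shows "p = (\<Sum>k\<in>A. cscale (Poly_Mapping.lookup p k) (Poly_Mapping.single k 1))"
  by (rule poly_mapping_eqI)
    (use assms in \<open>auto simp: lookup_sum lookup_single when_def in_keys_iff subset_iff sum.delta\<close>)

lemma poly_span_singles:
  "cs.span ((\<lambda>k. Poly_Mapping.single k 1) ` A) = {p. Poly_Mapping.keys p \<subseteq> A}"
proof
  show "cs.span ((\<lambda>k. Poly_Mapping.single k 1) ` A) \<subseteq> {p. Poly_Mapping.keys p \<subseteq> A}"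
  proof (intro cs.span_minimal cs.subspaceI)
    show "p + q \<in> {p. Poly_Mapping.keys p \<subseteq> A}"
      if "p \<in> {p. Poly_Mapping.keys p \<subseteq> A}" "q \<in> {p. Poly_Mapping.keys p \<subseteq> A}" for p q :: "'a \<Rightarrow>\<^sub>0 complex"
      using that keys_add[of p q] by auto
    show "cscale c p \<in> {p. Poly_Mapping.keys p \<subseteq> A}"
      if "p \<in> {p. Poly_Mapping.keys p \<subseteq> A}" for c and p :: "'a \<Rightarrow>\<^sub>0 complex"
      using that keys_cscale[of c p] by auto
  qed auto
  show "{p. Poly_Mapping.keys p \<subseteq> A} \<subseteq> cs.span ((\<lambda>k. Poly_Mapping.single k 1) ` A)"
  proof
    fix p :: "'a \<Rightarrow>\<^sub>0 complex" assume p: "p \<in> {p. Poly_Mapping.keys p \<subseteq> A}"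
    have "p = (\<Sum>k\<in>Poly_Mapping.keys p. cscale (Poly_Mapping.lookup p k) (Poly_Mapping.single k 1))"
      by (rule poly_mapping_expand) auto
    also have "\<dots> \<in> cs.span ((\<lambda>k. Poly_Mapping.single k 1) ` A)"
      using p by (intro cs.span_sum cs.span_scale cs.span_base) auto
    finally show "p \<in> cs.span ((\<lambda>k. Poly_Mapping.single k 1) ` A)" .
  qed
qed

definition lin_ext :: "('k \<Rightarrow> 'm \<Rightarrow>\<^sub>0 complex) \<Rightarrow> ('k \<Rightarrow>\<^sub>0 complex) \<Rightarrow> ('m \<Rightarrow>\<^sub>0 complex)" where
  "lin_ext g p = (\<Sum>k\<in>Poly_Mapping.keys p. cscale (Poly_Mapping.lookup p k) (g k))"

lemma lin_ext_eq:
  assumes "finite A" "Poly_Mapping.keys p \<subseteq> A"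
  shows "lin_ext g p = (\<Sum>k\<in>A. cscale (Poly_Mapping.lookup p k) (g k))"
  unfolding lin_ext_def using assms by (intro sum.mono_neutral_left) (auto simp: in_keys_iff)

lemma lin_ext_add: "lin_ext g (p + q) = lin_ext g p + lin_ext g q"
proof -
  let ?A = "Poly_Mapping.keys p \<union> Poly_Mapping.keys q"
  have "lin_ext g x = (\<Sum>k\<in>?A. cscale (Poly_Mapping.lookup x k) (g k))" if "x \<in> {p, q, p + q}" for x
    using that keys_add[of p q] by (intro lin_ext_eq) auto
  thus ?thesis by (simp add: lookup_add cs.scale_left_distrib sum.distrib)
qed

lemma lin_ext_scale: "lin_ext g (cscale c p) = cscale c (lin_ext g p)"
  by (subst lin_ext_eq[of "Poly_Mapping.keys p"])
    (auto simp: keys_cscale lin_ext_def cs.scale_sum_right)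

lemma linear_lin_ext: "Vector_Spaces.linear cscale cscale (lin_ext g)"
  by unfold_locales (auto simp: lin_ext_add lin_ext_scale)

lemma lin_ext_single [simp]: "lin_ext g (Poly_Mapping.single k c) = cscale c (g k)"
  by (simp add: lin_ext_def)

text \<open>Agreement is asked only on the monomials of \<open>p\<close>, so that identities known
  for column monomials alone extend to \<open>col_space\<close>.\<close>

lemma linear_agree:
  assumes "Vector_Spaces.linear cscale cscale f" "Vector_Spaces.linear cscale cscale g"
    "\<And>k. k \<in> Poly_Mapping.keys p \<Longrightarrow> f (Poly_Mapping.single k 1) = g (Poly_Mapping.single k 1)"
  shows "f p = g p"
proof -
  interpret f: Vector_Spaces.linear cscale cscale f by fact
  interpret g: Vector_Spaces.linear cscale cscale g by fact
  have "p = (\<Sum>k\<in>Poly_Mapping.keys p. cscale (Poly_Mapping.lookup p k) (Poly_Mapping.single k 1))"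
    by (rule poly_mapping_expand) auto
  moreover have "f \<dots> = g \<dots>" by (simp add: f.sum f.scale g.sum g.scale assms(3) del: cscale_single)
  ultimately show ?thesis by simp
qed

lemma linear_cscale_compose:
  assumes "Vector_Spaces.linear cscale cscale f" "Vector_Spaces.linear cscale cscale g"
  shows "Vector_Spaces.linear cscale cscale (\<lambda>p. f (g p))"
  using Vector_Spaces.linear_compose[OF assms(2,1)] by (simp add: o_def)

lemma linear_cscale_add:
  assumes "Vector_Spaces.linear cscale cscale f" "Vector_Spaces.linear cscale cscale g"
  shows "Vector_Spaces.linear cscale cscale (\<lambda>p. f p + g p)"
proof -
  interpret f: Vector_Spaces.linear cscale cscale f by fact
  interpret g: Vector_Spaces.linear cscale cscale g by fact
  show ?thesis by unfold_locales (auto simp: f.add g.add f.scale g.scale cs.scale_right_distrib)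
qed

lemma linear_cscale_sum:
  assumes "\<And>i. i \<in> A \<Longrightarrow> Vector_Spaces.linear cscale cscale (f i)"
  shows "Vector_Spaces.linear cscale cscale (\<lambda>p. \<Sum>i\<in>A. f i p)"
proof -
  have "f i (p + q) = f i p + f i q" "f i (cscale c p) = cscale c (f i p)" if "i \<in> A" for i p q c
    using assms[OF that] by (auto simp: Vector_Spaces.linear_iff)
  thus ?thesis by unfold_locales (auto simp: sum.distrib cs.scale_sum_right)
qed

section \<open>Partial derivatives and the operators \<open>E i j\<close>\<close>

lemma partial_deriv_lin_ext:
  "partial_deriv v = lin_ext (\<lambda>m. Poly_Mapping.single (m - Poly_Mapping.single v 1)
     (of_nat (Poly_Mapping.lookup m v)))"
  by (rule ext) (simp add: partial_deriv_def lin_ext_def mult.commute)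

lemma linear_partial_deriv: "Vector_Spaces.linear cscale cscale (partial_deriv v)"
  unfolding partial_deriv_lin_ext by (rule linear_lin_ext)

lemma linear_Var_mult: "Vector_Spaces.linear cscale cscale ((*) (Var v))"
  by unfold_locales (auto simp: distrib_left cscale_mult_right)

lemma partial_deriv_single: "partial_deriv v (Poly_Mapping.single m c) =
    Poly_Mapping.single (m - Poly_Mapping.single v 1) (c * of_nat (Poly_Mapping.lookup m v))"
  by (simp add: partial_deriv_lin_ext)

lemma Var_mult_single: "Var v * Poly_Mapping.single m c = Poly_Mapping.single (Poly_Mapping.single v 1 + m) c"
  by (simp add: Var_def mult_single)

lemma partial_deriv_mult: "partial_deriv v (p * q) = partial_deriv v p * q + p * partial_deriv v q"
proof -
  have mono: "partial_deriv v (Poly_Mapping.single m 1 * Poly_Mapping.single m' 1) =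
      partial_deriv v (Poly_Mapping.single m 1) * Poly_Mapping.single m' 1 +
      Poly_Mapping.single m 1 * partial_deriv v (Poly_Mapping.single m' 1)" for m m' :: "'a \<Rightarrow>\<^sub>0 nat"
  proof -
    \<comment> \<open>Subtraction of exponents truncates at 0, so the two exponents may differ when
      \<open>v\<close> does not occur in \<open>m\<close>; in that case the coefficient is
      0.\<close>
    have 1: "Poly_Mapping.single (m + m' - Poly_Mapping.single v 1) (of_nat (Poly_Mapping.lookup m v) :: complex) =
        Poly_Mapping.single (m - Poly_Mapping.single v 1 + m') (of_nat (Poly_Mapping.lookup m v))" for m m'
    proof (cases "Poly_Mapping.lookup m v = 0")
      case False
      hence "m + m' - Poly_Mapping.single v 1 = m - Poly_Mapping.single v 1 + m'"
        by (intro poly_mapping_eqI) (auto simp: lookup_add lookup_minus lookup_single when_def)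
      thus ?thesis by simp
    qed simp
    show ?thesis
      using 1[of m m'] 1[of m' m]
      by (simp add: mult_single partial_deriv_single lookup_add single_add add.commute)
  qed
  have lin_mult: "Vector_Spaces.linear cscale cscale (\<lambda>p. p * q)" "Vector_Spaces.linear cscale cscale (\<lambda>p. q * p)"
    for q :: "'a mpoly"
    by (unfold_locales; simp add: distrib_right cscale_mult_left)
      (unfold_locales; simp add: distrib_left cscale_mult_right)
  have lin1: "Vector_Spaces.linear cscale cscale (\<lambda>p. partial_deriv v p * q + p * partial_deriv v q)"
    for q :: "'a mpoly"
    by (rule linear_cscale_add[OF linear_cscale_compose[OF lin_mult(1) linear_partial_deriv] lin_mult(1)])
  have lin2: "Vector_Spaces.linear cscale cscale (\<lambda>q. partial_deriv v p * q + p * partial_deriv v q)"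
    for p :: "'a mpoly"
    by (rule linear_cscale_add[OF lin_mult(2) linear_cscale_compose[OF lin_mult(2) linear_partial_deriv]])
  have step: "partial_deriv v (Poly_Mapping.single m 1 * q) =
      partial_deriv v (Poly_Mapping.single m 1) * q + Poly_Mapping.single m 1 * partial_deriv v q" for m
    by (rule linear_agree[OF linear_cscale_compose[OF linear_partial_deriv lin_mult(2)] lin2]) (rule mono)
  show ?thesis
    by (rule linear_agree[OF linear_cscale_compose[OF linear_partial_deriv lin_mult(1)] lin1]) (rule step)
qed

lemma partial_deriv_Var: "partial_deriv v (Var w) = (if v = w then 1 else 0)"
  by (auto simp: Var_def partial_deriv_single lookup_single)

lemma partial_deriv_Var_mult:
  "partial_deriv v (Var w * p) = (if v = w then p else 0) + Var w * partial_deriv v p"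
  by (simp add: partial_deriv_mult partial_deriv_Var)

lemma partial_deriv_commute: "partial_deriv v (partial_deriv w p) = partial_deriv w (partial_deriv v p)"
proof (rule linear_agree[where p = p])
  fix m :: "'a \<Rightarrow>\<^sub>0 nat"
  have "m - Poly_Mapping.single w 1 - Poly_Mapping.single v 1 = m - Poly_Mapping.single v 1 - Poly_Mapping.single w 1"
    by (intro poly_mapping_eqI) (auto simp: lookup_minus)
  thus "partial_deriv v (partial_deriv w (Poly_Mapping.single m 1)) =
      partial_deriv w (partial_deriv v (Poly_Mapping.single m 1))"
    by (cases "v = w") (auto simp: partial_deriv_single lookup_minus lookup_single mult.commute)
qed (rule linear_cscale_compose[OF linear_partial_deriv linear_partial_deriv])+

abbreviation poly_act :: "nat \<Rightarrow> nat \<Rightarrow> nat \<Rightarrow> (nat \<times> nat) mpoly \<Rightarrow> (nat \<times> nat) mpoly" where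
  "poly_act n \<equiv> mact (poly_module n)"

lemma poly_act_def: "poly_act n i j p = (\<Sum>k<n. Var (i, k) * partial_deriv (j, k) p)"
  by (simp add: poly_module_def)

lemma linear_poly_act: "Vector_Spaces.linear cscale cscale (poly_act n i j)"
  unfolding poly_act_def[abs_def]
  by (rule linear_cscale_sum) (rule linear_cscale_compose[OF linear_Var_mult linear_partial_deriv])

text \<open>Each composite is a first-order term, arising when the outer derivative hits the
  variable in front of the inner one, plus a second-order term. The latter is symmetric in the two
  operators and cancels in the commutator.\<close>

lemma poly_act_commute:
  assumes "i < n" "j < n" "k < n" "l < n"
  shows "poly_act n i j (poly_act n k l p) - poly_act n k l (poly_act n i j p) =
    (if j = k then poly_act n i l p else 0) - (if l = i then poly_act n k j p else 0)"
proof -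
  have pd: "partial_deriv v (\<Sum>a\<in>A. f a) = (\<Sum>a\<in>A. partial_deriv v (f a))"
    for v :: "nat \<times> nat" and f :: "nat \<Rightarrow> (nat \<times> nat) mpoly" and A
  proof -
    interpret Vector_Spaces.linear cscale cscale "partial_deriv v" by (rule linear_partial_deriv)
    show ?thesis by (rule sum)
  qed
  have main: "poly_act n i j (poly_act n k l p) = (if j = k then poly_act n i l p else 0) +
      (\<Sum>a<n. \<Sum>b<n. Var (i, a) * (Var (k, b) * partial_deriv (j, a) (partial_deriv (l, b) p)))"
    for i j k l
  proof -
    have "poly_act n i j (poly_act n k l p) = (\<Sum>a<n. \<Sum>b<n. Var (i, a) *
       ((if (j, a) = (k, b) then partial_deriv (l, b) p else 0) +
        Var (k, b) * partial_deriv (j, a) (partial_deriv (l, b) p)))"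
      unfolding poly_act_def pd sum_distrib_left partial_deriv_Var_mult ..
    also have "\<dots> = (\<Sum>a<n. \<Sum>b<n. if b = a then (if j = k then Var (i, a) * partial_deriv (l, b) p else 0) else 0) +
      (\<Sum>a<n. \<Sum>b<n. Var (i, a) * (Var (k, b) * partial_deriv (j, a) (partial_deriv (l, b) p)))"
      unfolding sum.distrib[symmetric] by (intro sum.cong refl) (auto simp: distrib_left)
    also have "(\<Sum>a<n. \<Sum>b<n. if b = a then (if j = k then Var (i, a) * partial_deriv (l, b) p else 0) else 0) =
       (if j = k then poly_act n i l p else 0)"
      by (simp add: poly_act_def)
    finally show ?thesis .
  qed
  have "(\<Sum>a<n. \<Sum>b<n. Var (i, a) * (Var (k, b) * partial_deriv (j, a) (partial_deriv (l, b) p))) =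
    (\<Sum>a<n. \<Sum>b<n. Var (k, a) * (Var (i, b) * partial_deriv (l, a) (partial_deriv (j, b) p)))"
    by (subst sum.swap) (simp add: mult.left_commute partial_deriv_commute)
  thus ?thesis unfolding main by simp
qed

lemma poly_act_single:
  "poly_act n i j (Poly_Mapping.single m c) = (\<Sum>k<n. Poly_Mapping.single
     (m - Poly_Mapping.single (j, k) 1 + Poly_Mapping.single (i, k) 1) (c * of_nat (Poly_Mapping.lookup m (j, k))))"
  by (simp add: poly_act_def partial_deriv_single Var_mult_single add.commute)

lemma is_gl_module_poly: "is_gl_module n (poly_module n)"
proof -
  have lin: "poly_act n i j (x + y) = poly_act n i j x + poly_act n i j y"
    "poly_act n i j (cscale c x) = cscale c (poly_act n i j x)" for i j x y c
    using linear_poly_act by (auto simp: Vector_Spaces.linear_iff)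
  have sc: "mscale (poly_module n) = cscale" by (simp add: poly_module_def)
  have sp: "mspace (poly_module n) = {p. Poly_Mapping.keys p \<subseteq> {m. Poly_Mapping.keys m \<subseteq> {..<n} \<times> {..<n}}}"
    by (auto simp: poly_module_def)
  have sub: "cs.subspace (mspace (poly_module n))"
    unfolding sp poly_span_singles[symmetric] by simp
  have closed: "poly_act n i j p \<in> mspace (poly_module n)"
    if "i < n" "j < n" "p \<in> mspace (poly_module n)" for i j p
  proof -
    have "poly_act n i j p = (\<Sum>m\<in>Poly_Mapping.keys p. cscale (Poly_Mapping.lookup p m)
        (poly_act n i j (Poly_Mapping.single m 1)))"
    proof -
      interpret Vector_Spaces.linear cscale cscale "poly_act n i j" by (rule linear_poly_act)
      show ?thesis
        by (subst poly_mapping_expand[of "Poly_Mapping.keys p" p]) (auto simp: sum scale simp del: cscale_single)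
    qed
    also have "\<dots> \<in> mspace (poly_module n)"
    proof (intro cs.subspace_sum[OF sub] cs.subspace_scale[OF sub])
      fix m assume m: "m \<in> Poly_Mapping.keys p"
      show "poly_act n i j (Poly_Mapping.single m 1) \<in> mspace (poly_module n)"
        unfolding poly_act_single
      proof (intro cs.subspace_sum[OF sub])
        fix k assume "k \<in> {..<n}"
        moreover have "Poly_Mapping.keys m \<subseteq> {..<n} \<times> {..<n}" using m that(3) by (auto simp: sp)
        ultimately have "j < n \<Longrightarrow> Poly_Mapping.keys (m - Poly_Mapping.single (j, k) 1 + Poly_Mapping.single (i, k) 1)
            \<subseteq> {..<n} \<times> {..<n}"
          using that(1) by (auto simp: in_keys_iff lookup_add lookup_minus lookup_single when_def subset_iff
            split: if_splits)
        with that(2) show "Poly_Mapping.single (m - Poly_Mapping.single (j, k) 1 + Poly_Mapping.single (i, k) 1)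
          (1 * of_nat (Poly_Mapping.lookup m (j, k))) \<in> mspace (poly_module n)" by (auto simp: sp)
      qed
    qed
    finally show ?thesis .
  qed
  show ?thesis unfolding is_gl_module_def sc
    by (intro conjI allI impI ballI cs.vector_space_axioms sub closed lin poly_act_commute)
qed

interpretation pm: gl_rep n "poly_module n" for n
  by unfold_locales (rule is_gl_module_poly)

section \<open>The Fischer inner product\<close>

text \<open>The squared Fischer norm of the monomial \<open>m\<close>. For a matrix of exponents it
  is also the numerator of the factor in \<open>D_poly\<close>.\<close>

definition mfact :: "('v \<Rightarrow>\<^sub>0 nat) \<Rightarrow> nat" where
  "mfact m = (\<Prod>v\<in>Poly_Mapping.keys m. fact (Poly_Mapping.lookup m v))"

lemma mfact_eq: "finite A \<Longrightarrow> Poly_Mapping.keys m \<subseteq> A \<Longrightarrow> mfact m = (\<Prod>v\<in>A. fact (Poly_Mapping.lookup m v))"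
  unfolding mfact_def by (intro prod.mono_neutral_left) (auto simp: in_keys_iff)

lemma mfact_pos: "mfact m > 0"
  unfolding mfact_def by (intro prod_pos) auto

lemma mfact_Suc: "mfact (Poly_Mapping.single v 1 + m) = Suc (Poly_Mapping.lookup m v) * mfact m"
proof -
  let ?A = "insert v (Poly_Mapping.keys m)"
  have A: "?A = insert v (?A - {v})" by auto
  have "mfact (Poly_Mapping.single v 1 + m) = (\<Prod>w\<in>?A. fact (Poly_Mapping.lookup (Poly_Mapping.single v 1 + m) w))"
    by (rule mfact_eq) (auto simp: in_keys_iff lookup_add lookup_single when_def split: if_splits)
  also have "\<dots> = fact (Suc (Poly_Mapping.lookup m v)) * (\<Prod>w\<in>?A - {v}. fact (Poly_Mapping.lookup m w))"
  proof -
    have "(\<Prod>w\<in>?A - {v}. fact (Poly_Mapping.lookup (Poly_Mapping.single v 1 + m) w)) =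
        (\<Prod>w\<in>?A - {v}. fact (Poly_Mapping.lookup m w) :: nat)"
      by (intro prod.cong refl) (auto simp: lookup_add lookup_single)
    thus ?thesis by (subst A, subst prod.insert) (auto simp: lookup_add lookup_single)
  qed
  also have "mfact m = (\<Prod>w\<in>?A. fact (Poly_Mapping.lookup m w))" by (rule mfact_eq) auto
  hence "mfact m = fact (Poly_Mapping.lookup m v) * (\<Prod>w\<in>?A - {v}. fact (Poly_Mapping.lookup m w))"
    by (subst (asm) A, subst (asm) prod.insert) auto
  ultimately show ?thesis by (simp add: algebra_simps)
qed

text \<open>
  Multiplication by a variable is adjoint to the corresponding partial
  derivative, so \<open>E j i\<close> is adjoint to \<open>E i j\<close> and orthogonal complements of submodules are submodules.
\<close>

definition fip :: "'v mpoly \<Rightarrow> 'v mpoly \<Rightarrow> complex" where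
  "fip p q = (\<Sum>m\<in>Poly_Mapping.keys p. of_nat (mfact m) * Poly_Mapping.lookup p m * cnj (Poly_Mapping.lookup q m))"

lemma fip_eq:
  assumes "finite A" "Poly_Mapping.keys p \<subseteq> A"
  shows "fip p q = (\<Sum>m\<in>A. of_nat (mfact m) * Poly_Mapping.lookup p m * cnj (Poly_Mapping.lookup q m))"
  unfolding fip_def using assms by (intro sum.mono_neutral_left) (auto simp: in_keys_iff)

lemma fip_commute: "fip q p = cnj (fip p q)"
  using fip_eq[of "Poly_Mapping.keys p \<union> Poly_Mapping.keys q" p q]
    fip_eq[of "Poly_Mapping.keys p \<union> Poly_Mapping.keys q" q p]
  by (simp add: mult_ac)

lemma fip_add_left: "fip (p + q) r = fip p r + fip q r"
proof -
  let ?A = "Poly_Mapping.keys p \<union> Poly_Mapping.keys q"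
  have "fip x r = (\<Sum>m\<in>?A. of_nat (mfact m) * Poly_Mapping.lookup x m * cnj (Poly_Mapping.lookup r m))"
    if "x \<in> {p, q, p + q}" for x
    using that keys_add[of p q] by (intro fip_eq) auto
  thus ?thesis by (simp add: lookup_add algebra_simps sum.distrib)
qed

lemma fip_scale_left: "fip (cscale c p) r = c * fip p r"
  by (subst fip_eq[of "Poly_Mapping.keys p"])
    (auto simp: keys_cscale fip_def sum_distrib_left mult_ac)

lemma fip_add_right: "fip r (p + q) = fip r p + fip r q"
  by (subst (1 2 3) fip_commute) (simp add: fip_add_left)

lemma fip_scale_right: "fip r (cscale c p) = cnj c * fip r p"
  by (subst (1 2) fip_commute) (simp add: fip_scale_left)

lemma fip_zero [simp]: "fip 0 p = 0" "fip p 0 = 0"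
  by (simp_all add: fip_def)

lemma fip_diff_left: "fip (p - q) r = fip p r - fip q r"
  using fip_add_left[of "p - q" q r] by simp

lemma fip_diff_right: "fip r (p - q) = fip r p - fip r q"
  using fip_add_right[of r "p - q" q] by simp

lemma fip_sum_left: "fip (\<Sum>i\<in>A. f i) r = (\<Sum>i\<in>A. fip (f i) r)"
  by (induction A rule: infinite_finite_induct) (auto simp: fip_add_left)

lemma fip_sum_right: "fip r (\<Sum>i\<in>A. f i) = (\<Sum>i\<in>A. fip r (f i))"
  by (induction A rule: infinite_finite_induct) (auto simp: fip_add_right)

lemma fip_self: "fip p p = of_real (\<Sum>m\<in>Poly_Mapping.keys p. real (mfact m) * (cmod (Poly_Mapping.lookup p m))\<^sup>2)"
  unfolding fip_def of_real_sum
  by (intro sum.cong refl) (simp add: mult.assoc complex_norm_square[symmetric])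

lemma fip_self_nonneg: "Re (fip p p) \<ge> 0"
  unfolding fip_self by (simp add: sum_nonneg)

lemma fip_self_pos:
  assumes "p \<noteq> 0"
  shows "Re (fip p p) > 0"
proof -
  have "Poly_Mapping.keys p \<noteq> {}" using assms by simp
  hence "(\<Sum>m\<in>Poly_Mapping.keys p. real (mfact m) * (cmod (Poly_Mapping.lookup p m))\<^sup>2) > 0"
    by (intro sum_pos mult_pos_pos) (auto simp: in_keys_iff mfact_pos)
  thus ?thesis unfolding fip_self by simp
qed

lemma fip_self_eq_0_iff: "fip p p = 0 \<longleftrightarrow> p = 0"
  using fip_self_pos[of p] by (cases "p = 0") auto

lemma subspace_fip_right: "cs.subspace {x. fip y x = 0}"
  by (intro cs.subspaceI) (simp_all add: fip_add_right fip_scale_right)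

lemma fip_span_right:
  assumes "\<And>y. y \<in> B \<Longrightarrow> fip x y = 0" "y \<in> cs.span B"
  shows "fip x y = 0"
  using cs.span_minimal[OF _ subspace_fip_right, of B x] assms by auto

text \<open>Gram-Schmidt: the new generator is replaced by its component \<open>b'\<close>
  orthogonal to the span of \<open>B\<close>, and the projection of \<open>x\<close> gains the
  multiple of \<open>b'\<close> with coefficient \<open>fip x b' / fip b' b'\<close>. If
  \<open>b'\<close> is 0, the span does not grow.\<close>

lemma orthogonal_projection_span:
  fixes B :: "'v mpoly set"
  assumes "finite B"
  shows "\<exists>u\<in>cs.span B. \<forall>y\<in>cs.span B. fip (x - u) y = 0"
  using assms
proof (induction B arbitrary: x rule: finite_induct)
  case (insert b B)
  obtain ub where ub: "ub \<in> cs.span B" "\<And>y. y \<in> cs.span B \<Longrightarrow> fip (b - ub) y = 0"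
    using insert.IH by blast
  obtain ux where ux: "ux \<in> cs.span B" "\<And>y. y \<in> cs.span B \<Longrightarrow> fip (x - ux) y = 0"
    using insert.IH by blast
  show ?case
  proof (cases "b = ub")
    case True
    hence "cs.span (insert b B) = cs.span B" using ub(1) by (simp add: cs.span_redundant)
    thus ?thesis using ux by auto
  next
    case False
    define b' where "b' = b - ub"
    have b'0: "fip b' b' \<noteq> 0" using False by (simp add: b'_def fip_self_eq_0_iff)
    have b'y: "fip b' y = 0" "fip y b' = 0" if "y \<in> cs.span B" for y
      using ub(2)[OF that] fip_commute[of y b'] by (auto simp: b'_def)
    have sub: "y \<in> cs.span (insert b B)" if "y \<in> cs.span B" for y
      using that cs.span_mono[of B "insert b B"] by auto
    define u where "u = ux + cscale (fip x b' / fip b' b') b'"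
    have "u \<in> cs.span (insert b B)"
      unfolding u_def b'_def
      by (rule cs.span_add[OF sub[OF ux(1)] cs.span_scale[OF cs.span_diff[OF cs.span_base sub[OF ub(1)]]]]) simp
    moreover have "fip (x - u) y = 0" if "y \<in> cs.span (insert b B)" for y
    proof (rule fip_span_right[OF _ that])
      fix z assume "z \<in> insert b B"
      moreover have *: "fip (x - u) z = 0" if "z \<in> cs.span B" for z
        using ux(2)[OF that] b'y[OF that] by (simp add: u_def fip_diff_left fip_add_left fip_scale_left)
      moreover have "fip (x - u) b' = 0"
        using b'0 b'y[OF ux(1)] by (simp add: u_def fip_diff_left fip_add_left fip_scale_left)
      hence "fip (x - u) b = 0" using *[OF ub(1)] by (simp add: b'_def fip_diff_right)
      ultimately show "fip (x - u) z = 0" by (metis insertE cs.span_base)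
    qed
    ultimately show ?thesis by blast
  qed
qed auto

lemma orthogonal_basis_exists:
  fixes B :: "'v mpoly set"
  assumes "finite B"
  shows "\<exists>C. finite C \<and> 0 \<notin> C \<and> cs.span C = cs.span B \<and> (\<forall>x\<in>C. \<forall>y\<in>C. x \<noteq> y \<longrightarrow> fip x y = 0)"
  using assms
proof (induction B rule: finite_induct)
  case (insert b B)
  then obtain C where C: "finite C" "0 \<notin> C" "cs.span C = cs.span B"
    "\<And>x y. x \<in> C \<Longrightarrow> y \<in> C \<Longrightarrow> x \<noteq> y \<Longrightarrow> fip x y = 0" by blast
  obtain u where u: "u \<in> cs.span C" "\<And>y. y \<in> cs.span C \<Longrightarrow> fip (b - u) y = 0"
    using orthogonal_projection_span[OF C(1)] by blast
  have spI: "cs.span (insert b B) = cs.span (insert b C)"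
    unfolding cs.span_insert C(3) ..
  show ?case
  proof (cases "b = u")
    case True
    hence "cs.span (insert b C) = cs.span C" using u by (simp add: cs.span_redundant)
    thus ?thesis using C spI by (intro exI[of _ C]) auto
  next
    case False
    have "cs.span (insert (b - u) C) = cs.span (insert b C)"
      by (rule cs.eq_span_insert_eq) (use u(1) cs.span_neg in force)
    moreover have "fip y (b - u) = 0" "fip (b - u) y = 0" if "y \<in> C" for y
      using u(2)[OF cs.span_base[OF that]] fip_commute[of y "b - u"] by auto
    ultimately show ?thesis
      using C False spI by (intro exI[of _ "insert (b - u) C"]) auto
  qed
qed auto

lemma orthogonal_independent:
  assumes "0 \<notin> C" "\<And>x y. x \<in> C \<Longrightarrow> y \<in> C \<Longrightarrow> x \<noteq> y \<Longrightarrow> fip x y = 0"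
  shows "cs.independent C"
  unfolding cs.independent_explicit_module
proof (intro allI impI)
  fix t u v
  assume t: "finite t" "t \<subseteq> C" "(\<Sum>v\<in>t. cscale (u v) v) = 0" "v \<in> t"
  have "0 = fip (\<Sum>v\<in>t. cscale (u v) v) v" using t by simp
  also have "\<dots> = (\<Sum>w\<in>t. if w = v then u v * fip v v else 0)"
    unfolding fip_sum_left using assms(2) t by (intro sum.cong refl) (auto simp: fip_scale_left subset_iff)
  also have "\<dots> = u v * fip v v" using t by simp
  finally show "u v = 0" using assms(1) t by (auto simp: fip_self_eq_0_iff)
qed

lemma subspace_finite_basis:
  assumes "cs.subspace S" "finite A" "S \<subseteq> {p. Poly_Mapping.keys p \<subseteq> A}"
  obtains B where "finite B" "cs.independent B" "cs.span B = S"
proof -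
  obtain B where B: "B \<subseteq> S" "cs.independent B" "S \<subseteq> cs.span B"
    by (rule cs.basis_exists[of S])
  have "B \<subseteq> cs.span ((\<lambda>k. Poly_Mapping.single k 1) ` A)"
    using B(1) assms(3) unfolding poly_span_singles by blast
  hence "finite B" using cs.independent_span_bound[OF finite_imageI[OF assms(2)] B(2)] by simp
  moreover have "cs.span B = S" using cs.span_minimal[OF B(1) assms(1)] B(3) by auto
  ultimately show thesis using that B by blast
qed

lemma orthogonal_projection:
  fixes S :: "'v mpoly set"
  assumes "cs.subspace S" "finite A" "S \<subseteq> {p. Poly_Mapping.keys p \<subseteq> A}"
  shows "\<exists>u\<in>S. \<forall>y\<in>S. fip (x - u) y = 0"
proof -
  obtain B where "finite B" "cs.span B = S" by (rule subspace_finite_basis[OF assms])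
  thus ?thesis using orthogonal_projection_span[of B x] by simp
qed

lemma linear_fip_agree:
  assumes "Vector_Spaces.linear cscale cscale f" "Vector_Spaces.linear cscale cscale g"
    "\<And>m m'. fip (f (Poly_Mapping.single m 1)) (Poly_Mapping.single m' 1) =
      fip (Poly_Mapping.single m 1) (g (Poly_Mapping.single m' 1))"
  shows "fip (f p) q = fip p (g q)"
proof -
  interpret f: Vector_Spaces.linear cscale cscale f by fact
  interpret g: Vector_Spaces.linear cscale cscale g by fact
  have p: "p = (\<Sum>k\<in>Poly_Mapping.keys p. cscale (Poly_Mapping.lookup p k) (Poly_Mapping.single k 1))"
    (is "_ = ?p") by (rule poly_mapping_expand) auto
  have q: "q = (\<Sum>k\<in>Poly_Mapping.keys q. cscale (Poly_Mapping.lookup q k) (Poly_Mapping.single k 1))"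
    (is "_ = ?q") by (rule poly_mapping_expand) auto
  have "fip (f ?p) ?q = fip ?p (g ?q)"
    by (simp add: f.sum f.scale g.sum g.scale fip_sum_left fip_sum_right fip_scale_left
      fip_scale_right assms(3) del: cscale_single)
  thus ?thesis using p q by simp
qed

lemma fip_single: "fip (Poly_Mapping.single m c) q = of_nat (mfact m) * c * cnj (Poly_Mapping.lookup q m)"
  by (subst fip_eq[of "{m}"]) auto

text \<open>The weights are made for this: multiplying \<open>m\<close> by \<open>v\<close>
  multiplies its factorial weight by the new exponent of \<open>v\<close>, and this is the exponent
  that differentiation brings down on the other side. If \<open>v\<close> does not occur in
  \<open>m'\<close>, both sides are 0.\<close>

lemma fip_Var_mult: "fip (Var v * p) q = fip p (partial_deriv v q)"
proof (rule linear_fip_agree[OF linear_Var_mult linear_partial_deriv])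
  fix m m' :: "'a \<Rightarrow>\<^sub>0 nat"
  have eq: "Poly_Mapping.single v 1 + m = m' \<longleftrightarrow> m = m' - Poly_Mapping.single v 1"
    if "Poly_Mapping.lookup m' v \<noteq> 0" for m
  proof -
    have "Poly_Mapping.single v 1 + (m' - Poly_Mapping.single v 1) = m'"
      using that by (intro poly_mapping_eqI) (auto simp: lookup_add lookup_minus lookup_single when_def)
    thus ?thesis by (metis add_diff_cancel_left')
  qed
  have mf: "mfact m' = Poly_Mapping.lookup m' v * mfact (m' - Poly_Mapping.single v 1)"
    if "Poly_Mapping.lookup m' v \<noteq> 0"
    using mfact_Suc[of v "m' - Poly_Mapping.single v 1"] that
      eq[of "m' - Poly_Mapping.single v 1"] by (simp del: One_nat_def add: lookup_minus)
  have ne: "Poly_Mapping.single v 1 + m \<noteq> m'" if "Poly_Mapping.lookup m' v = 0"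
    using that by (auto simp: lookup_add)
  show "fip (Var v * Poly_Mapping.single m 1) (Poly_Mapping.single m' 1) =
    fip (Poly_Mapping.single m 1) (partial_deriv v (Poly_Mapping.single m' 1))"
    by (cases "Poly_Mapping.lookup m' v = 0"; cases "Poly_Mapping.single v 1 + m = m'")
      (use eq[of m] ne mf in \<open>auto simp: Var_mult_single partial_deriv_single fip_single lookup_single when_def\<close>)
qed

lemma fip_partial_deriv: "fip (partial_deriv v p) q = fip p (Var v * q)"
  by (subst (1 2) fip_commute) (simp add: fip_Var_mult)

lemma fip_poly_act: "fip (poly_act n i j p) q = fip p (poly_act n j i q)"
  by (simp add: poly_act_def fip_sum_left fip_sum_right fip_Var_mult fip_partial_deriv)

lemma pm_subspace: "is_submodule n (poly_module n) S \<Longrightarrow> cs.subspace S"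
  by (simp add: is_submodule_def poly_module_def)

lemma mscale_poly [simp]: "mscale (poly_module n) = cscale"
  by (simp add: poly_module_def)

lemma orthogonal_complement_submodule:
  assumes "is_submodule n (poly_module n) S" "is_submodule n (poly_module n) U"
  shows "is_submodule n (poly_module n) {x \<in> U. \<forall>y\<in>S. fip x y = 0}"
  unfolding is_submodule_def mscale_poly
proof (intro conjI allI impI ballI)
  note U = pm_subspace[OF assms(2)]
  show "cs.subspace {x \<in> U. \<forall>y\<in>S. fip x y = 0}"
    by (rule cs.subspaceI) (auto simp: cs.subspace_0[OF U] cs.subspace_add[OF U]
      cs.subspace_scale[OF U] fip_add_left fip_scale_left)
  show "poly_act n i j x \<in> {x \<in> U. \<forall>y\<in>S. fip x y = 0}"
    if "i < n" "j < n" "x \<in> {x \<in> U. \<forall>y\<in>S. fip x y = 0}" for i j x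
    using that pm.is_submoduleD(3)[OF assms(1)] pm.is_submoduleD(3)[OF assms(2)]
    by (auto simp: fip_poly_act)
qed (use pm.is_submoduleD(1)[OF assms(2)] in auto)

text \<open>In \<open>fip w (E a b z)\<close> the lowering operator moves over as the raising
  operator \<open>E b a\<close>, which kills \<open>w\<close>; only the empty word remains, where
  \<open>fip w w' = 0\<close> applies. So \<open>w\<close> is orthogonal to the module generated by
  \<open>w'\<close>. The orthogonal complement of that module is a submodule and hence contains all
  that \<open>w\<close> generates.\<close>

lemma hw_vector_orthogonal_cyclic:
  assumes w: "w \<in> hw_vectors n (poly_module n) \<mu>" and w': "w' \<in> hw_vectors n (poly_module n) \<nu>"
    and orth: "fip w w' = 0"
    and x: "x \<in> mspace (cyclic_submodule n (poly_module n) w)"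
    and y: "y \<in> mspace (cyclic_submodule n (poly_module n) w')"
  shows "fip x y = 0"
proof -
  have "fip w z = 0" if "pm.lowering_word n w' z d" for z d
    using that
  proof cases
    case (lower x d b a)
    thus ?thesis using pm.hw_vectorsD(2)[OF w, of b a] fip_poly_act[of n b a w x] by simp
  qed (use orth in simp)
  hence "fip w z = 0" if "z \<in> mspace (cyclic_submodule n (poly_module n) w')" for z
    using that unfolding pm.cyclic_submodule_hw[OF w'] pm.lowered_def mscale_poly
    by (elim fip_span_right[rotated]) blast
  hence "mspace (cyclic_submodule n (poly_module n) w) \<subseteq> {x \<in> mspace (poly_module n).
      \<forall>y\<in>mspace (cyclic_submodule n (poly_module n) w'). fip x y = 0}"
    using pm.hw_vectorsD(1)[OF w] pm.hw_vectorsD(1)[OF w']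
    by (intro pm.cyclic_submodule_least orthogonal_complement_submodule
      pm.cyclic_submodule_is_submodule pm.mspace_submodule) auto
  thus ?thesis using x y by auto
qed

text \<open>\<open>E i i\<close> is self-adjoint, and the two vectors are eigenvectors of it for
  different real eigenvalues.\<close>

lemma hw_vectors_orthogonal:
  assumes w: "w \<in> hw_vectors n (poly_module n) \<mu>" and w': "w' \<in> hw_vectors n (poly_module n) \<nu>"
    and "i < n" "part \<mu> i \<noteq> part \<nu> i"
  shows "fip w w' = 0"
proof -
  have "of_nat (part \<mu> i) * fip w w' = fip (poly_act n i i w) w'"
    unfolding pm.hw_vectorsD(3)[OF w assms(3)] by (simp add: fip_scale_left)
  also have "\<dots> = fip w (poly_act n i i w')" by (rule fip_poly_act)
  also have "\<dots> = of_nat (part \<nu> i) * fip w w'"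
    unfolding pm.hw_vectorsD(3)[OF w' assms(3)] by (simp add: fip_scale_right)
  finally show ?thesis using assms(4) by simp
qed

text \<open>A submodule \<open>S\<close> splits \<open>w\<close> into \<open>s\<close> in
  \<open>S\<close> and \<open>w - s\<close> orthogonal to \<open>S\<close>. The projection
  \<open>s\<close> satisfies the same highest weight equations, so \<open>s = c w\<close>. If
  \<open>c\<close> is nonzero, \<open>S\<close> contains \<open>w\<close> and is everything; if
  \<open>c = 0\<close>, then \<open>w\<close>, and with it all of \<open>C\<close>, is orthogonal to
  \<open>S\<close>, so \<open>S\<close> is 0. The finite set \<open>A\<close> of monomials
  guarantees that the projection exists.\<close>

lemma cyclic_hw_irreducible:
  assumes w: "w \<in> hw_vectors n (poly_module n) \<mu>" "w \<noteq> 0"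
    and fin: "finite A" "mspace (cyclic_submodule n (poly_module n) w) \<subseteq> {p. Poly_Mapping.keys p \<subseteq> A}"
  shows "irreducible_hw_module n (cyclic_submodule n (poly_module n) w) \<mu>"
proof -
  let ?P = "poly_module n"
  define C where "C = mspace (cyclic_submodule n ?P w)"
  have Cdef: "cyclic_submodule n ?P w = ?P\<lparr>mspace := C\<rparr>"
    by (simp add: C_def cyclic_submodule_def)
  have C: "is_submodule n ?P C"
    unfolding C_def by (rule pm.cyclic_submodule_is_submodule[OF pm.hw_vectorsD(1)[OF w(1)]])
  have wC: "w \<in> C" unfolding C_def by (rule pm.cyclic_submodule_contains)
  have "S = {0} \<or> S = C" if S: "is_submodule n (?P\<lparr>mspace := C\<rparr>) S" for S
  proof -
    have SC: "S \<subseteq> C" and S: "is_submodule n ?P S"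
      using S C by (auto simp: is_submodule_def)
    have comp: "is_submodule n ?P {x \<in> C. \<forall>y\<in>S. fip x y = 0}" (is "is_submodule _ _ ?T")
      by (rule orthogonal_complement_submodule[OF S C])
    obtain s where s: "s \<in> S" "\<And>y. y \<in> S \<Longrightarrow> fip (w - s) y = 0"
      using orthogonal_projection[OF pm_subspace[OF S] fin(1) order_trans[OF SC fin(2)[folded C_def]]] by blast
    have t: "w - s \<in> ?T" using s wC SC cs.subspace_diff[OF pm_subspace[OF C]] by auto
    \<comment> \<open>\<open>S\<close> meets its complement in 0. The sign is there because an
      operator that kills \<open>w\<close> sends \<open>w - s\<close> to the negative of the image
      of \<open>s\<close>.\<close>
    have zero: "x = 0" if "x \<in> S" "- x \<in> ?T" for x
      using that fip_diff_left[of 0 x x] by (simp add: fip_self_eq_0_iff)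
    have act_s: "poly_act n i j s \<in> S" "poly_act n i j (w - s) \<in> ?T" if "i < n" "j < n" for i j
      using pm.is_submoduleD(3)[OF S that s(1)] pm.is_submoduleD(3)[OF comp that t] by auto
    have "s \<in> hw_vectors n ?P \<mu>"
      unfolding hw_vectors_def
    proof (intro CollectI conjI allI impI)
      note sP = subsetD[OF pm.is_submoduleD(1)[OF S] s(1)]
      show "s \<in> mspace ?P" by fact
      show "poly_act n i j s = 0" if "i < j \<and> j < n" for i j
        using that act_s[of i j] pm.act_diff[of i n j w s] pm.hw_vectorsD[OF w(1)] sP
        by (intro zero) auto
      show "poly_act n i i s = mscale ?P (of_nat (part \<mu> i)) s" if i: "i < n" for i
      proof -
        let ?c = "of_nat (part \<mu> i)"
        have "poly_act n i i (w - s) - cscale ?c (w - s) \<in> ?T"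
          by (intro cs.subspace_diff[OF pm_subspace[OF comp]] cs.subspace_scale[OF pm_subspace[OF comp]]
              act_s i t)
        also have "poly_act n i i (w - s) - cscale ?c (w - s) = - (poly_act n i i s - cscale ?c s)"
          using pm.act_diff[of i n i w s] pm.hw_vectorsD[OF w(1)] sP i
          by (simp add: cs.scale_right_diff_distrib)
        finally have "poly_act n i i s - cscale ?c s = 0"
          by (intro zero cs.subspace_diff[OF pm_subspace[OF S]] cs.subspace_scale[OF pm_subspace[OF S]]
              act_s i s)
        thus ?thesis by simp
      qed
    qed
    hence "\<exists>c. s = cscale c w"
      using pm.hw_vectors_cyclic_submodule[OF w(1), of s] s(1) SC by (auto simp: C_def)
    then obtain c where c: "s = cscale c w" by auto
    show ?thesis
    proof (cases "c = 0")
      case True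
      hence "w \<in> ?T" using t c by simp
      hence "C \<subseteq> ?T" unfolding C_def[symmetric] using pm.cyclic_submodule_least[OF comp] C_def by blast
      hence "fip x x = 0" if "x \<in> S" for x using that SC by auto
      thus ?thesis using cs.subspace_0[OF pm_subspace[OF S]] by (auto simp: fip_self_eq_0_iff)
    next
      case False
      hence "w = cscale (1 / c) s" using c by simp
      hence "w \<in> S" using s(1) cs.subspace_scale[OF pm_subspace[OF S]] by metis
      hence "C \<subseteq> S" unfolding C_def by (rule pm.cyclic_submodule_least[OF S])
      thus ?thesis using SC by auto
    qed
  qed
  hence "irreducible_module n (?P\<lparr>mspace := C\<rparr>)"
    using wC w(2) by (auto simp: irreducible_module_def)
  moreover have "cyclic_submodule n (?P\<lparr>mspace := C\<rparr>) w = cyclic_submodule n ?P w"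
    by (simp add: cyclic_submodule_def)
  hence "highest_weight_module n (?P\<lparr>mspace := C\<rparr>) \<mu>"
    using w wC by (auto simp: highest_weight_module_def hw_vectors_def Cdef intro!: bexI[of _ w])
  ultimately show ?thesis
    unfolding irreducible_hw_module_def Cdef using pm.is_submodule_rep[OF C] by simp
qed

section \<open>Highest weight vectors in submodules\<close>

definition col_monomials :: "nat \<Rightarrow> nat \<Rightarrow> (nat \<times> nat \<Rightarrow>\<^sub>0 nat) set" where
  "col_monomials n l = {m. Poly_Mapping.keys m \<subseteq> {..<n} \<times> {..<n} \<and>
     (\<forall>j<n. (\<Sum>i<n. Poly_Mapping.lookup m (i, j)) = l)}"

definition col_space :: "nat \<Rightarrow> nat \<Rightarrow> (nat \<times> nat) mpoly set" where
  "col_space n l = {p. Poly_Mapping.keys p \<subseteq> col_monomials n l}"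

text \<open>One term of \<open>E i j\<close> on a monomial: a factor in row \<open>j\<close> of
  column \<open>k\<close> is replaced by the one in row \<open>i\<close>. The subtraction truncates,
  so this reading requires the factor to occur; when it does not, the term has coefficient
  0.\<close>

definition move :: "nat \<Rightarrow> nat \<Rightarrow> nat \<Rightarrow> (nat \<times> nat \<Rightarrow>\<^sub>0 nat) \<Rightarrow> (nat \<times> nat \<Rightarrow>\<^sub>0 nat)" where
  "move i j k m = m - Poly_Mapping.single (j, k) 1 + Poly_Mapping.single (i, k) 1"

lemma lookup_move: "Poly_Mapping.lookup (move i j k m) v =
    Poly_Mapping.lookup m v - (if v = (j, k) then 1 else 0) + (if v = (i, k) then 1 else 0)"
  by (simp add: move_def lookup_add lookup_minus lookup_single when_def)

lemma finite_col_monomials: "finite (col_monomials n l)"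
proof (rule finite_subset)
  let ?A = "{..<n} \<times> {..<n}"
  let ?f = "\<lambda>f. \<Sum>v\<in>?A. Poly_Mapping.single v (f v)"
  show "finite (?f ` (?A \<rightarrow>\<^sub>E {..l}))" by (intro finite_imageI finite_PiE) auto
  show "col_monomials n l \<subseteq> ?f ` (?A \<rightarrow>\<^sub>E {..l})"
  proof
    fix m assume m: "m \<in> col_monomials n l"
    have le: "Poly_Mapping.lookup m (i, j) \<le> l" if "i < n" "j < n" for i j
      using m that member_le_sum[of i "{..<n}" "\<lambda>i. Poly_Mapping.lookup m (i, j)"]
      by (auto simp: col_monomials_def)
    have "m = ?f (restrict (Poly_Mapping.lookup m) ?A)"
      using m by (intro poly_mapping_eqI)
        (auto simp: lookup_sum lookup_single when_def col_monomials_def in_keys_iff subset_iff)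
    moreover have "restrict (Poly_Mapping.lookup m) ?A \<in> ?A \<rightarrow>\<^sub>E {..l}" using le by auto
    ultimately show "m \<in> ?f ` (?A \<rightarrow>\<^sub>E {..l})" by blast
  qed
qed

lemma move_col_monomials:
  assumes "m \<in> col_monomials n l" "i < n" "Poly_Mapping.lookup m (j, k) \<noteq> 0"
  shows "move i j k m \<in> col_monomials n l"
proof -
  have jk: "j < n" "k < n" using assms(1,3) by (auto simp: col_monomials_def in_keys_iff subset_iff)
  have "(\<Sum>a<n. Poly_Mapping.lookup (move i j k m) (a, b)) = l" if b: "b < n" for b
  proof -
    \<comment> \<open>Indicators are added on both sides because the subtraction hidden in
      \<open>move\<close> is truncated.\<close>
    have "(\<Sum>a<n. Poly_Mapping.lookup (move i j k m) (a, b)) + (if b = k then 1 else 0) =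
       (\<Sum>a<n. Poly_Mapping.lookup (move i j k m) (a, b) + (if b = k \<and> a = j then 1 else 0))"
      using jk by (simp add: sum.distrib)
    also have "\<dots> = (\<Sum>a<n. Poly_Mapping.lookup m (a, b) + (if b = k \<and> a = i then 1 else 0))"
      using assms(3) by (intro sum.cong refl) (auto simp: lookup_move)
    also have "\<dots> = l + (if b = k then 1 else 0)"
      using assms(1,2) b by (simp add: sum.distrib col_monomials_def)
    finally show ?thesis by simp
  qed
  moreover have "Poly_Mapping.keys (move i j k m) \<subseteq> {..<n} \<times> {..<n}"
    using assms jk by (auto simp: col_monomials_def in_keys_iff lookup_move subset_iff split: if_splits)
  ultimately show ?thesis by (auto simp: col_monomials_def)
qed

lemma subspace_col_space: "cs.subspace (col_space n l)"
  unfolding col_space_def poly_span_singles[symmetric] by simp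

lemma poly_act_mono: "poly_act n i j (Poly_Mapping.single m 1) =
    (\<Sum>k<n. cscale (of_nat (Poly_Mapping.lookup m (j, k))) (Poly_Mapping.single (move i j k m) 1))"
  by (simp add: poly_act_single move_def)

lemma poly_act_lin_ext: "poly_act n i j p = lin_ext (\<lambda>m. poly_act n i j (Poly_Mapping.single m 1)) p"
  by (rule linear_agree[OF linear_poly_act linear_lin_ext]) simp

lemma col_space_submodule: "is_submodule n (poly_module n) (col_space n l)"
  unfolding is_submodule_def mscale_poly
proof (intro conjI allI impI ballI)
  show "col_space n l \<subseteq> mspace (poly_module n)"
    by (auto simp: col_space_def col_monomials_def poly_module_def)
  note sub = subspace_col_space[of n l]
  show "poly_act n i j p \<in> col_space n l" if ij: "i < n" "j < n" and p: "p \<in> col_space n l" for i j p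
    unfolding poly_act_lin_ext[of n i j p] lin_ext_def poly_act_mono
  proof (rule cs.subspace_sum[OF sub], rule cs.subspace_scale[OF sub], rule cs.subspace_sum[OF sub])
    fix m k assume m: "m \<in> Poly_Mapping.keys p"
    show "cscale (of_nat (Poly_Mapping.lookup m (j, k))) (Poly_Mapping.single (move i j k m) 1) \<in> col_space n l"
      using move_col_monomials[of m n l i j k] ij p m
      by (cases "Poly_Mapping.lookup m (j, k) = 0") (auto simp: col_space_def)
  qed
qed (rule subspace_col_space)

section \<open>Weights of monomials and of vectors\<close>

definition row_weight :: "nat \<Rightarrow> (nat \<times> nat \<Rightarrow>\<^sub>0 nat) \<Rightarrow> nat \<Rightarrow> nat" where
  "row_weight n m i = (\<Sum>k<n. Poly_Mapping.lookup m (i, k))"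

lemma lookup_poly_act_diag:
  "Poly_Mapping.lookup (poly_act n i i p) m = of_nat (row_weight n m i) * Poly_Mapping.lookup p m"
proof -
  have "move i i k m = m" if "Poly_Mapping.lookup m (i, k) \<noteq> 0" for k m
    using that by (intro poly_mapping_eqI) (auto simp: lookup_move)
  hence "cscale (of_nat (Poly_Mapping.lookup m (i, k))) (Poly_Mapping.single (move i i k m) 1) =
      cscale (of_nat (Poly_Mapping.lookup m (i, k))) (Poly_Mapping.single m 1)" for m k
    by (cases "Poly_Mapping.lookup m (i, k) = 0") auto
  hence "poly_act n i i (Poly_Mapping.single m 1) = Poly_Mapping.single m (of_nat (row_weight n m i))" for m
    unfolding poly_act_mono row_weight_def
    by (intro poly_mapping_eqI) (simp add: lookup_sum lookup_single when_def)
  hence "poly_act n i i p = (\<Sum>m\<in>Poly_Mapping.keys p.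
      Poly_Mapping.single m (Poly_Mapping.lookup p m * of_nat (row_weight n m i)))"
    unfolding poly_act_lin_ext[of n i i p] lin_ext_def by simp
  thus ?thesis by (auto simp: lookup_sum lookup_single when_def in_keys_iff)
qed

definition weight_vector :: "nat \<Rightarrow> (nat \<times> nat) mpoly \<Rightarrow> (nat \<Rightarrow> nat) \<Rightarrow> bool" where
  "weight_vector n p wt \<longleftrightarrow> p \<noteq> 0 \<and> (\<forall>i<n. poly_act n i i p = cscale (of_nat (wt i)) p)"

lemma weight_vector_iff:
  "weight_vector n p wt \<longleftrightarrow> p \<noteq> 0 \<and> (\<forall>m\<in>Poly_Mapping.keys p. \<forall>i<n. row_weight n m i = wt i)"
  unfolding weight_vector_def
  by (auto simp: poly_mapping_eq_iff fun_eq_iff lookup_poly_act_diag in_keys_iff)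

lemma sum_row_weight:
  assumes "m \<in> col_monomials n l"
  shows "(\<Sum>i<n. row_weight n m i) = n * l"
  unfolding row_weight_def by (subst sum.swap) (use assms in \<open>simp add: col_monomials_def\<close>)

lemma sum_weight:
  assumes "weight_vector n p wt" "p \<in> col_space n l"
  shows "(\<Sum>i<n. wt i) = n * l"
proof -
  obtain m where "m \<in> Poly_Mapping.keys p" using assms(1) by (fastforce simp: weight_vector_def)
  hence "m \<in> col_monomials n l" "(\<Sum>i<n. row_weight n m i) = (\<Sum>i<n. wt i)"
    using assms by (auto simp: weight_vector_iff col_space_def)
  thus ?thesis using sum_row_weight by metis
qed

text \<open>A nonzero element of minimal support is a weight vector.\<close>

lemma weight_vector_exists:
  assumes "is_submodule n (poly_module n) S" "S \<noteq> {0}"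
  shows "\<exists>p\<in>S. \<exists>wt. weight_vector n p wt"
proof -
  note sub = pm_subspace[OF assms(1)]
  have "\<exists>p. p \<in> S \<and> p \<noteq> 0" using assms(2) cs.subspace_0[OF sub] by blast
  then obtain p where p: "p \<in> S" "p \<noteq> 0"
    "\<And>q. q \<in> S \<Longrightarrow> q \<noteq> 0 \<Longrightarrow> card (Poly_Mapping.keys p) \<le> card (Poly_Mapping.keys q)"
    using ex_has_least_nat[of "\<lambda>p. p \<in> S \<and> p \<noteq> 0" _ "\<lambda>p. card (Poly_Mapping.keys p)"] by blast
  obtain m0 where m0: "m0 \<in> Poly_Mapping.keys p" using p(2) by fastforce
  have "row_weight n m i = row_weight n m0 i" if "m \<in> Poly_Mapping.keys p" "i < n" for m i
  proof (rule ccontr)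
    assume ne: "row_weight n m i \<noteq> row_weight n m0 i"
    \<comment> \<open>This combination loses the monomial \<open>m0\<close> and keeps
      \<open>m\<close>, so its support is smaller than that of \<open>p\<close> but not
      empty.\<close>
    define q where "q = poly_act n i i p - cscale (of_nat (row_weight n m0 i)) p"
    have lq: "Poly_Mapping.lookup q k =
        (of_nat (row_weight n k i) - of_nat (row_weight n m0 i)) * Poly_Mapping.lookup p k" for k
      by (simp add: q_def lookup_minus lookup_poly_act_diag algebra_simps)
    have "q \<in> S" unfolding q_def
      using pm.is_submoduleD(3)[OF assms(1)] that p(1)
      by (intro cs.subspace_diff[OF sub] cs.subspace_scale[OF sub]) auto
    moreover have "Poly_Mapping.lookup q m \<noteq> 0" using ne that by (simp add: lq in_keys_iff)
    hence "q \<noteq> 0" by auto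
    moreover have "Poly_Mapping.keys q \<subset> Poly_Mapping.keys p"
      using m0 lq[of m0] by (auto simp: lq in_keys_iff)
    hence "card (Poly_Mapping.keys q) < card (Poly_Mapping.keys p)" by (intro psubset_card_mono) auto
    ultimately show False using p(3)[of q] by simp
  qed
  thus ?thesis using p by (auto simp: weight_vector_iff)
qed

lemma poly_act_add: "poly_act n i j (p + q) = poly_act n i j p + poly_act n i j q"
  and poly_act_scale: "poly_act n i j (cscale c p) = cscale c (poly_act n i j p)"
proof -
  interpret Vector_Spaces.linear cscale cscale "poly_act n i j" by (rule linear_poly_act)
  show "poly_act n i j (p + q) = poly_act n i j p + poly_act n i j q"
    "poly_act n i j (cscale c p) = cscale c (poly_act n i j p)" by (simp_all add: add scale)
qed

text \<open>The weights are compared as integers because \<open>wt j - 1\<close> would truncate on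
  the naturals. The new weight is realised as the row weight of a monomial of the image, which shows
  that it is again a tuple of naturals.\<close>

lemma raise_weight_vector:
  assumes p: "weight_vector n p wt" and ij: "i < j" "j < n" and q: "poly_act n i j p \<noteq> 0"
  obtains wt' where "weight_vector n (poly_act n i j p) wt'"
    "\<And>k. k < n \<Longrightarrow> int (wt' k) = int (wt k) + (if k = i then 1 else 0) - (if k = j then 1 else 0)"
proof -
  define q where "q = poly_act n i j p"
  obtain m0 where m0: "m0 \<in> Poly_Mapping.keys q" using assms(4) by (fastforce simp: q_def)
  have "int (row_weight n m k) = int (wt k) + (if k = i then 1 else 0) - (if k = j then 1 else 0)"
    if m: "m \<in> Poly_Mapping.keys q" and k: "k < n" for m k
  proof -
    have "poly_act n k k q = poly_act n i j (poly_act n k k p) +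
        ((if k = i then poly_act n k j p else 0) - (if j = k then poly_act n i k p else 0))"
      unfolding q_def using poly_act_commute[of k n k i j p] k ij by (simp add: algebra_simps)
    also have "\<dots> = cscale (of_int (int (wt k) + (if k = i then 1 else 0) - (if k = j then 1 else 0))) q"
      using p k by (auto simp: weight_vector_def poly_act_scale q_def cs.scale_left_distrib cs.scale_left_diff_distrib)
    finally have "Poly_Mapping.lookup (poly_act n k k q) m = Poly_Mapping.lookup \<dots> m" by simp
    hence "complex_of_int (int (row_weight n m k)) =
        complex_of_int (int (wt k) + (if k = i then 1 else 0) - (if k = j then 1 else 0))"
      using m by (simp add: lookup_poly_act_diag in_keys_iff del: of_int_add of_int_diff)
    thus ?thesis by (simp only: of_int_eq_iff)
  qed
  note w = this
  have "row_weight n m k = row_weight n m0 k" if "m \<in> Poly_Mapping.keys q" "k < n" for m k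
    using w[OF that] w[OF m0 that(2)] by simp
  hence "weight_vector n q (row_weight n m0)" using assms(4) by (auto simp: weight_vector_iff q_def)
  thus ?thesis using that[of "row_weight n m0"] w[OF m0] by (auto simp: q_def)
qed

text \<open>In a decreasing list the zeros stand at the end, so dropping them shifts no other entry,
  and \<open>part\<close> supplies them again.\<close>

lemma part_filter:
  assumes "sorted_wrt (\<ge>) xs"
  shows "part (filter (\<lambda>x. x \<noteq> 0) xs) i = (if i < length xs then xs ! i else 0)"
  using assms
proof (induction xs arbitrary: i)
  case (Cons x xs)
  show ?case
  proof (cases "x = 0")
    case True
    hence z: "\<forall>y\<in>set xs. y = 0" using Cons by auto
    hence "filter (\<lambda>x. x \<noteq> 0) xs = []" by (simp add: filter_empty_conv)
    moreover have "(x # xs) ! i = 0" if "i < length (x # xs)"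
      using z True nth_mem[OF that] by auto
    ultimately show ?thesis using True by (auto simp: part_def)
  next
    case False
    have "sorted_wrt (\<ge>) xs" using Cons.prems by simp
    from Cons.IH[OF this, of "i - 1"] show ?thesis using False by (cases i) (auto simp: part_def split: if_splits)
  qed
qed (simp add: part_def)

lemma part_inj:
  assumes "0 \<notin> set \<mu>" "0 \<notin> set \<nu>" "length \<mu> \<le> n" "length \<nu> \<le> n"
    "\<And>i. i < n \<Longrightarrow> part \<mu> i = part \<nu> i"
  shows "\<mu> = \<nu>"
proof -
  have "\<not> length \<mu> < length \<nu>" if "0 \<notin> set \<nu>" "length \<nu> \<le> n" "\<And>i. i < n \<Longrightarrow> part \<mu> i = part \<nu> i" for \<mu> \<nu>
  proof
    assume less: "length \<mu> < length \<nu>"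
    hence "\<nu> ! length \<mu> = 0" using that(3)[of "length \<mu>"] that(2) by (simp add: part_def)
    thus False using nth_mem[OF less] that(1) by simp
  qed
  hence "length \<mu> = length \<nu>" using assms by (metis linorder_neqE_nat)
  thus ?thesis using assms by (intro nth_equalityI) (auto simp: part_def, metis less_le_trans)
qed

text \<open>For a vector killed by \<open>E i j\<close> the commutator gives
  \<open>fip (E j i p) (E j i p) = (wt i - wt j) * fip p p\<close>. Positivity of the form makes the
  factor nonnegative; thus the weight of a highest weight vector is a partition.\<close>

lemma weight_decreasing:
  assumes p: "weight_vector n p wt" and ij: "i < j" "j < n" and killed: "poly_act n i j p = 0"
  shows "wt j \<le> wt i"
proof -
  have n: "i < n" using ij by simp
  have "poly_act n i j (poly_act n j i p) = poly_act n j i (poly_act n i j p) + (poly_act n i i p - poly_act n j j p)"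
    using poly_act_commute[of i n j j i p] ij n by (simp add: algebra_simps)
  also have "\<dots> = cscale (of_real (real (wt i) - real (wt j))) p"
    using p ij n killed pm.act_zero[of j n i]
    by (simp add: weight_vector_def cs.scale_left_diff_distrib)
  finally have "fip p (poly_act n i j (poly_act n j i p)) = of_real (real (wt i) - real (wt j)) * fip p p"
    by (simp add: fip_scale_right)
  hence "fip (poly_act n j i p) (poly_act n j i p) = of_real (real (wt i) - real (wt j)) * fip p p"
    by (simp add: fip_poly_act)
  hence "(real (wt i) - real (wt j)) * Re (fip p p) \<ge> 0"
    using fip_self_nonneg[of "poly_act n j i p"] by (simp del: of_real_diff)
  moreover have "Re (fip p p) > 0" using p fip_self_pos by (auto simp: weight_vector_def)
  ultimately show ?thesis by (simp add: zero_le_mult_iff)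
qed

text \<open>Among the weight vectors of \<open>S\<close>, one of maximal height, the sum of the
  \<open>(n - i) * wt i\<close>, is killed by every raising operator, since \<open>E i j\<close>
  with \<open>i < j\<close> raises the height by \<open>j - i\<close>. The maximum exists because
  the entries of each weight add up to \<open>n * l\<close>.\<close>

lemma hw_vector_exists:
  assumes S: "is_submodule n (poly_module n) S" and "S \<noteq> {0}" "S \<subseteq> col_space n l"
  obtains \<mu> w where "is_partition \<mu> (n * l)" "length \<mu> \<le> n"
    "w \<in> hw_vectors n (poly_module n) \<mu>" "w \<in> S" "w \<noteq> 0"
proof -
  let ?P = "\<lambda>x. fst x \<in> S \<and> weight_vector n (fst x) (snd x)"
  let ?h = "\<lambda>x. \<Sum>i<n. (n - i) * snd x i"
  obtain x0 where x0: "?P x0" using weight_vector_exists[OF assms(1,2)] by force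
  have bound: "?h x < Suc (n * (n * l))" if "?P x" for x
  proof -
    have "?h x \<le> (\<Sum>i<n. n * snd x i)" by (intro sum_mono) auto
    also have "\<dots> = n * (n * l)"
      using that sum_weight[of n "fst x" "snd x" l] assms(3) by (auto simp: sum_distrib_left[symmetric])
    finally show ?thesis by simp
  qed
  obtain x where "?P x" and max: "\<And>y. ?P y \<Longrightarrow> ?h y \<le> ?h x"
    using ex_has_greatest_nat[of ?P x0 ?h "Suc (n * (n * l))"] x0 bound by blast
  then obtain p wt where x: "x = (p, wt)" and p: "p \<in> S" "weight_vector n p wt" by (cases x) auto
  have killed: "poly_act n i j p = 0" if ij: "i < j" "j < n" for i j
  proof (rule ccontr)
    assume "poly_act n i j p \<noteq> 0"
    then obtain wt' where wt': "weight_vector n (poly_act n i j p) wt'"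
      "\<And>k. k < n \<Longrightarrow> int (wt' k) = int (wt k) + (if k = i then 1 else 0) - (if k = j then 1 else 0)"
      using raise_weight_vector[OF p(2) ij] by blast
    have "int (?h (poly_act n i j p, wt')) = (\<Sum>k<n. int (n - k) * int (wt' k))" by simp
    also have "\<dots> = (\<Sum>k<n. int (n - k) * int (wt k) + (if k = i then int (n - k) else 0) -
        (if k = j then int (n - k) else 0))"
      by (intro sum.cong refl) (auto simp: wt'(2) algebra_simps)
    also have "\<dots> = int (?h x) + int (n - i) - int (n - j)"
      using ij x by (simp add: sum.distrib sum_subtractf)
    finally have "?h x < ?h (poly_act n i j p, wt')" using ij by linarith
    moreover have "poly_act n i j p \<in> S" using pm.is_submoduleD(3)[OF S] ij p(1) by auto
    ultimately show False using max[of "(poly_act n i j p, wt')"] wt'(1) by simp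
  qed
  define xs where "xs = map wt [0..<n]"
  define \<mu> where "\<mu> = filter (\<lambda>x. x \<noteq> 0) xs"
  have sorted: "sorted_wrt (\<ge>) xs"
    unfolding xs_def sorted_wrt_iff_nth_less using weight_decreasing[OF p(2)] killed by auto
  have part: "part \<mu> i = wt i" if "i < n" for i
    using part_filter[OF sorted, of i] that by (simp add: \<mu>_def xs_def)
  have "sum_list \<mu> = sum_list xs" unfolding \<mu>_def by (induction xs) auto
  also have "\<dots> = n * l" using sum_weight[OF p(2)] p(1) assms(3)
    by (auto simp: xs_def sum_list_sum_nth atLeast0LessThan)
  finally have "is_partition \<mu> (n * l)"
    using sorted by (auto simp: is_partition_def \<mu>_def intro: sorted_wrt_filter)
  moreover have "length \<mu> \<le> n" unfolding \<mu>_def xs_def by (rule order_trans[OF length_filter_le]) simp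
  moreover have "p \<in> hw_vectors n (poly_module n) \<mu>"
    using p pm.is_submoduleD(1)[OF S] killed part by (auto simp: hw_vectors_def weight_vector_def)
  ultimately show thesis using that[of \<mu> p] p by (auto simp: weight_vector_def)
qed

section \<open>The intertwining property\<close>

lemma poly_act_mult: "poly_act n i j (p * q) = poly_act n i j p * q + p * poly_act n i j q"
  by (simp add: poly_act_def partial_deriv_mult distrib_left sum.distrib sum_distrib_left
    sum_distrib_right mult_ac)

lemma poly_act_one: "poly_act n i j 1 = 0"
  using poly_act_mult[of n i j 1 1] by simp

lemma poly_act_prod:
  assumes "finite A"
  shows "poly_act n i j (\<Prod>x\<in>A. h x) = (\<Sum>x\<in>A. poly_act n i j (h x) * (\<Prod>y\<in>A - {x}. h y))"
  using assms
proof (induction A rule: finite_induct)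
  case (insert a A)
  have "(\<Sum>x\<in>A. poly_act n i j (h x) * (\<Prod>y\<in>insert a A - {x}. h y)) =
      (\<Sum>x\<in>A. h a * (poly_act n i j (h x) * (\<Prod>y\<in>A - {x}. h y)))"
  proof (intro sum.cong refl)
    fix x assume x: "x \<in> A"
    hence "insert a A - {x} = insert a (A - {x})" using insert by auto
    thus "poly_act n i j (h x) * (\<Prod>y\<in>insert a A - {x}. h y) =
        h a * (poly_act n i j (h x) * (\<Prod>y\<in>A - {x}. h y))"
      using insert by (simp add: mult_ac)
  qed
  moreover have "insert a A - {a} = A" using insert by auto
  ultimately show ?case using insert by (simp add: poly_act_mult sum_distrib_left)
qed (simp add: poly_act_one)

lemma poly_act_sum: "poly_act n i j (\<Sum>x\<in>A. f x) = (\<Sum>x\<in>A. poly_act n i j (f x))"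
proof -
  interpret Vector_Spaces.linear cscale cscale "poly_act n i j" by (rule linear_poly_act)
  show ?thesis by (rule sum)
qed

lemma poly_act_Var:
  assumes "c < n"
  shows "poly_act n a b (Var (k, c)) = (if k = b then Var (a, c) else 0)"
proof -
  have "poly_act n a b (Var (k, c)) = (\<Sum>d<n. if d = c then if k = b then Var (a, d) else 0 else 0)"
    unfolding poly_act_def by (intro sum.cong) (auto simp: partial_deriv_Var)
  thus ?thesis using assms by simp
qed

text \<open>
  \<open>row_det n \<alpha> k\<close> is the alpha-determinant of the matrix with rows number \<open>k 0, ..., k (n - 1)\<close> of \<open>X\<close>.
\<close>

definition row_det :: "nat \<Rightarrow> complex \<Rightarrow> (nat \<Rightarrow> nat) \<Rightarrow> (nat \<times> nat) mpoly" where
  "row_det n \<alpha> k = (\<Sum>\<sigma> | \<sigma> permutes {..<n}. cscale (\<alpha> ^ perm_nu n \<sigma>) (\<Prod>j<n. Var (k (\<sigma> j), j)))"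

lemma row_det_cong: "(\<And>j. j < n \<Longrightarrow> k j = k' j) \<Longrightarrow> row_det n \<alpha> k = row_det n \<alpha> k'"
  unfolding row_det_def
  by (intro sum.cong refl arg_cong2[of _ _ _ _ cscale] prod.cong)
    (metis lessThan_iff mem_Collect_eq permutes_in_image)

text \<open>\<open>E a b\<close> acts as a derivation and turns one row \<open>b\<close> into row
  \<open>a\<close>. In the term of \<sigma> the derivation runs over the columns; reindexing by
  \<sigma> turns this into a sum over the rows of the matrix, a range independent of \<sigma>, so
  the powers of \<alpha> regroup into alpha-determinants.\<close>

lemma poly_act_row_det:
  "poly_act n a b (row_det n \<alpha> k) = (\<Sum>c<n. if k c = b then row_det n \<alpha> (k(c := a)) else 0)"
proof -
  have mono: "poly_act n a b (\<Prod>j<n. Var (k (\<sigma> j), j)) =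
      (\<Sum>c<n. if k c = b then \<Prod>j<n. Var ((k(c := a)) (\<sigma> j), j) else 0)" if \<sigma>: "\<sigma> permutes {..<n}" for \<sigma>
  proof -
    have "poly_act n a b (\<Prod>j<n. Var (k (\<sigma> j), j)) =
        (\<Sum>i<n. if k (\<sigma> i) = b then \<Prod>j<n. Var ((k(\<sigma> i := a)) (\<sigma> j), j) else 0)"
    proof (subst poly_act_prod, simp, intro sum.cong refl)
      fix i assume i: "i \<in> {..<n}"
      have "(\<Prod>j<n. Var ((k(\<sigma> i := a)) (\<sigma> j), j)) = Var (a, i) * (\<Prod>j\<in>{..<n} - {i}. Var ((k(\<sigma> i := a)) (\<sigma> j), j))"
        using i by (subst prod.remove[of _ i]) auto
      also have "(\<Prod>j\<in>{..<n} - {i}. Var ((k(\<sigma> i := a)) (\<sigma> j), j)) = (\<Prod>j\<in>{..<n} - {i}. Var (k (\<sigma> j), j))"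
        using permutes_inj[OF \<sigma>] by (intro prod.cong refl) (auto simp: inj_eq)
      finally show "poly_act n a b (Var (k (\<sigma> i), i)) * (\<Prod>j\<in>{..<n} - {i}. Var (k (\<sigma> j), j)) =
          (if k (\<sigma> i) = b then \<Prod>j<n. Var ((k(\<sigma> i := a)) (\<sigma> j), j) else 0)"
        using i by (simp add: poly_act_Var)
    qed
    also have "\<dots> = (\<Sum>c<n. if k c = b then \<Prod>j<n. Var ((k(c := a)) (\<sigma> j), j) else 0)"
      using sum.permute[OF \<sigma>, of "\<lambda>c. if k c = b then \<Prod>j<n. Var ((k(c := a)) (\<sigma> j), j) else 0"]
      by (simp add: o_def)
    finally show ?thesis .
  qed
  have "poly_act n a b (row_det n \<alpha> k) = (\<Sum>\<sigma> | \<sigma> permutes {..<n}. \<Sum>c<n.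
      if k c = b then cscale (\<alpha> ^ perm_nu n \<sigma>) (\<Prod>j<n. Var ((k(c := a)) (\<sigma> j), j)) else 0)"
    unfolding row_det_def poly_act_sum
    by (intro sum.cong refl) (auto simp: poly_act_scale mono cs.scale_sum_right intro!: sum.cong)
  also have "\<dots> = (\<Sum>c<n. \<Sum>\<sigma> | \<sigma> permutes {..<n}.
      if k c = b then cscale (\<alpha> ^ perm_nu n \<sigma>) (\<Prod>j<n. Var ((k(c := a)) (\<sigma> j), j)) else 0)"
    by (rule sum.swap)
  also have "\<dots> = (\<Sum>c<n. if k c = b then row_det n \<alpha> (k(c := a)) else 0)"
    unfolding row_det_def by (intro sum.cong refl) auto
  finally show ?thesis .
qed

text \<open>
  A sequence of \<open>l\<close> matrices with columns that are unit vectors is encoded as the function which sends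
  \<open>(p, j)\<close> to the position of the entry 1 in column \<open>j\<close> of the \<open>p\<close>-th matrix.
\<close>

definition families :: "nat \<Rightarrow> nat \<Rightarrow> (nat \<times> nat \<Rightarrow>\<^sub>0 nat) \<Rightarrow> (nat \<times> nat \<Rightarrow> nat) set" where
  "families n l m = {f \<in> ({..<l} \<times> {..<n}) \<rightarrow>\<^sub>E {..<n}. \<forall>i<n. \<forall>j<n.
     (\<Sum>p<l. if f (p, j) = i then 1 else 0) = Poly_Mapping.lookup m (i, j)}"

definition row_dets :: "nat \<Rightarrow> nat \<Rightarrow> complex \<Rightarrow> (nat \<times> nat \<Rightarrow> nat) \<Rightarrow> (nat \<times> nat) mpoly" where
  "row_dets n l \<alpha> f = (\<Prod>p<l. row_det n \<alpha> (\<lambda>j. f (p, j)))"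

definition mat_of :: "nat \<Rightarrow> (nat \<times> nat \<Rightarrow>\<^sub>0 nat) \<Rightarrow> nat mat" where
  "mat_of n m = mat n n (\<lambda>(i, j). Poly_Mapping.lookup m (i, j))"

lemma finite_families: "finite (families n l m)"
  by (rule finite_subset[of _ "({..<l} \<times> {..<n}) \<rightarrow>\<^sub>E {..<n}"]) (auto simp: families_def intro!: finite_PiE)

lemma col_position:
  assumes "N \<in> col_sum_matrices n 1" "j < n"
  shows "col_position n N j < n" "i < n \<Longrightarrow> N $$ (i, j) = (if col_position n N j = i then 1 else 0)"
proof -
  have "(\<Sum>i<n. N $$ (i, j)) = 1" using assms by (auto simp: col_sum_matrices_def)
  hence "\<exists>a\<in>{..<n}. N $$ (a, j) = 1 \<and> (\<forall>b\<in>{..<n}. a \<noteq> b \<longrightarrow> N $$ (b, j) = 0)"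
    by (subst sum_eq_1_iff[symmetric]) auto
  then obtain a where a: "a < n" "N $$ (a, j) = 1" "\<And>b. b < n \<Longrightarrow> b \<noteq> a \<Longrightarrow> N $$ (b, j) = 0"
    by (metis lessThan_iff)
  have "col_position n N j = a"
    unfolding col_position_def using a by (intro the_equality conjI) (fastforce+)
  thus "col_position n N j < n" "i < n \<Longrightarrow> N $$ (i, j) = (if col_position n N j = i then 1 else 0)"
    using a by auto
qed

lemma D_unit_eq: "D_unit n \<alpha> N = row_det n \<alpha> (col_position n N)"
proof -
  let ?Y = "mat n n (\<lambda>(i, j). Var (col_position n N i, j))"
  have "(\<Prod>j<n. ?Y $$ (\<sigma> j, j)) = (\<Prod>j<n. Var (col_position n N (\<sigma> j), j))"
    if "\<sigma> permutes {..<n}" for \<sigma>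
  proof (intro prod.cong refl)
    fix j assume "j \<in> {..<n}"
    moreover from this have "\<sigma> j \<in> {..<n}" using permutes_in_image[OF that] by simp
    ultimately show "?Y $$ (\<sigma> j, j) = Var (col_position n N (\<sigma> j), j)" by simp
  qed
  thus ?thesis unfolding D_unit_def alpha_det_def row_det_def by simp
qed

text \<open>Sequences of unit-column matrices and position functions correspond by
  \<open>?enc\<close> and \<open>?dec\<close>; the restriction in \<open>?enc\<close> supplies the
  default value outside the index set on which membership in \<open>families\<close>
  insists.\<close>

lemma D_poly_eq:
  assumes "Poly_Mapping.keys m \<subseteq> {..<n} \<times> {..<n}"
  shows "D_poly n l \<alpha> (mat_of n m) =
    cscale (of_nat (mfact m) / of_nat (fact l ^ n)) (\<Sum>f\<in>families n l m. row_dets n l \<alpha> f)"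
proof -
  have mf: "(\<Prod>i<n. \<Prod>j<n. fact (mat_of n m $$ (i, j))) = mfact m"
    unfolding mfact_eq[OF finite_cartesian_product[OF finite_lessThan finite_lessThan] assms] prod.cartesian_product
    by (intro prod.cong) (auto simp: mat_of_def)
  let ?Seq = "{Ms. length Ms = l \<and> set Ms \<subseteq> col_sum_matrices n 1 \<and>
    (\<forall>i<n. \<forall>j<n. (\<Sum>p<l. (Ms ! p) $$ (i, j)) = mat_of n m $$ (i, j))}"
  let ?A = "{..<l} \<times> {..<n}"
  let ?enc = "\<lambda>Ms. restrict (\<lambda>(p, j). col_position n (Ms ! p) j) ?A"
  let ?dec = "\<lambda>f. map (\<lambda>p. mat n n (\<lambda>(i, j). if f (p, j) = i then 1 else 0 :: nat)) [0..<l]"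
  have "(\<Sum>Ms\<in>?Seq. \<Prod>p<l. D_unit n \<alpha> (Ms ! p)) = (\<Sum>f\<in>families n l m. row_dets n l \<alpha> f)"
  proof (rule sum.reindex_bij_witness[of _ ?dec ?enc])
    fix Ms assume Ms: "Ms \<in> ?Seq"
    hence N: "Ms ! p \<in> col_sum_matrices n 1" if "p < l" for p using that by (auto simp: subset_iff)
    note cp = col_position[OF N]
    show "?dec (?enc Ms) = Ms"
    proof (rule nth_equalityI)
      fix p assume "p < length (?dec (?enc Ms))"
      hence p: "p < l" by simp
      show "?dec (?enc Ms) ! p = Ms ! p"
        using p N[OF p] cp[OF p] by (intro eq_matI) (auto simp: col_sum_matrices_def)
    qed (use Ms in simp)
    show "?enc Ms \<in> families n l m"
      unfolding families_def
    proof (intro CollectI conjI allI impI)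
      show "?enc Ms \<in> ?A \<rightarrow>\<^sub>E {..<n}" using cp(1) by auto
      fix i j assume ij: "i < n" "j < n"
      have "(\<Sum>p<l. if ?enc Ms (p, j) = i then 1 else 0) = (\<Sum>p<l. (Ms ! p) $$ (i, j))"
        using ij cp(2) by (intro sum.cong refl) auto
      also have "\<dots> = Poly_Mapping.lookup m (i, j)" using Ms ij by (simp add: mat_of_def)
      finally show "(\<Sum>p<l. if ?enc Ms (p, j) = i then 1 else 0) = Poly_Mapping.lookup m (i, j)" .
    qed
    show "row_dets n l \<alpha> (?enc Ms) = (\<Prod>p<l. D_unit n \<alpha> (Ms ! p))"
      unfolding row_dets_def D_unit_eq by (intro prod.cong refl row_det_cong) auto
  next
    fix f assume f: "f \<in> families n l m"
    have f_lt: "f (p, j) < n" if "p < l" "j < n" for p j using f that by (auto simp: families_def PiE_iff)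
    have N: "mat n n (\<lambda>(i, j). if f (p, j) = i then 1 else 0 :: nat) \<in> col_sum_matrices n 1" (is "?N p \<in> _") if "p < l" for p
      using f_lt[OF that] by (auto simp: col_sum_matrices_def)
    show "?enc (?dec f) = f"
    proof
      fix x :: "nat \<times> nat"
      obtain p j where x: "x = (p, j)" by (cases x)
      show "?enc (?dec f) x = f x"
      proof (cases "p < l \<and> j < n")
        case True
        hence "?N p $$ (f (p, j), j) = 1" using f_lt by simp
        hence "col_position n (?N p) j = f (p, j)"
          using col_position(2)[OF N, of p j "f (p, j)"] True f_lt by (auto split: if_splits)
        thus ?thesis using True x by simp
      next
        case False
        thus ?thesis using f x by (auto simp: families_def PiE_iff extensional_def)
      qed
    qed
    show "?dec f \<in> ?Seq"
      using f N by (auto simp: families_def mat_of_def)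
  qed
  thus ?thesis unfolding D_poly_def mf by simp
qed

lemma poly_act_row_dets:
  "poly_act n a b (row_dets n l \<alpha> f) =
    (\<Sum>c<n. \<Sum>p<l. if f (p, c) = b then row_dets n l \<alpha> (f((p, c) := a)) else 0)"
proof -
  have "poly_act n a b (row_dets n l \<alpha> f) =
      (\<Sum>p<l. \<Sum>c<n. if f (p, c) = b then row_dets n l \<alpha> (f((p, c) := a)) else 0)"
    unfolding row_dets_def
  proof (subst poly_act_prod, simp, intro sum.cong refl)
    fix p assume p: "p \<in> {..<l}"
    have upd: "(\<lambda>j. (f((p, c) := a)) (p, j)) = (\<lambda>j. f (p, j))(c := a)" for c by auto
    have "row_det n \<alpha> ((\<lambda>j. f (p, j))(c := a)) * (\<Prod>q\<in>{..<l} - {p}. row_det n \<alpha> (\<lambda>j. f (q, j))) =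
        (\<Prod>q<l. row_det n \<alpha> (\<lambda>j. (f((p, c) := a)) (q, j)))" for c
      unfolding upd[symmetric] using p by (subst (2) prod.remove[of _ p]) (auto intro!: arg_cong2[of _ _ _ _ "(*)"] prod.cong)
    thus "poly_act n a b (row_det n \<alpha> (\<lambda>j. f (p, j))) * (\<Prod>q\<in>{..<l} - {p}. row_det n \<alpha> (\<lambda>j. f (q, j))) =
        (\<Sum>c<n. if f (p, c) = b then \<Prod>q<l. row_det n \<alpha> (\<lambda>j. (f((p, c) := a)) (q, j)) else 0)"
      unfolding poly_act_row_det sum_distrib_right by (intro sum.cong refl) auto
  qed
  also have "\<dots> = (\<Sum>c<n. \<Sum>p<l. if f (p, c) = b then row_dets n l \<alpha> (f((p, c) := a)) else 0)"
    by (rule sum.swap)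
  finally show ?thesis .
qed

lemma families_move:
  assumes f: "f \<in> families n l m" "f (p, c) = b" and "p < l" "c < n" "a < n" "b < n"
  shows "f((p, c) := a) \<in> families n l (move a b c m)"
  unfolding families_def
proof (intro CollectI conjI allI impI)
  show "f((p, c) := a) \<in> ({..<l} \<times> {..<n}) \<rightarrow>\<^sub>E {..<n}"
    using assms by (auto simp: families_def PiE_iff extensional_def)
  fix i j assume ij: "i < n" "j < n"
  let ?cnt = "\<lambda>f :: nat \<times> nat \<Rightarrow> nat. \<Sum>q<l. if f (q, j) = i then 1 else 0 :: nat"
  have "?cnt (f((p, c) := a)) + (if j = c \<and> i = b then 1 else 0) =
      (\<Sum>q<l. (if (f((p, c) := a)) (q, j) = i then 1 else 0) + (if q = p then if j = c \<and> i = b then 1 else 0 else 0))"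
    using \<open>p < l\<close> by (simp add: sum.distrib)
  also have "\<dots> = (\<Sum>q<l. (if f (q, j) = i then 1 else 0) + (if q = p then if j = c \<and> i = a then 1 else 0 else 0))"
    using f(2) by (intro sum.cong refl) auto
  also have "\<dots> = ?cnt f + (if j = c \<and> i = a then 1 else 0)"
    using \<open>p < l\<close> by (simp add: sum.distrib)
  also have "?cnt f = Poly_Mapping.lookup m (i, j)" using f(1) ij by (simp add: families_def)
  finally have eq: "?cnt (f((p, c) := a)) + (if j = c \<and> i = b then 1 else 0) =
      Poly_Mapping.lookup m (i, j) + (if j = c \<and> i = a then 1 else 0)" .
  \<comment> \<open>The entry at \<open>(p, c)\<close> itself is counted, so the truncated
    subtraction in \<open>move\<close> loses nothing.\<close>
  have "?cnt f \<ge> (if f (p, j) = i then 1 else 0)" using \<open>p < l\<close> by (intro member_le_sum) auto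
  hence "Poly_Mapping.lookup m (i, j) \<ge> (if j = c \<and> i = b then 1 else 0)"
    using f ij by (auto simp: families_def)
  thus "?cnt (f((p, c) := a)) = Poly_Mapping.lookup (move a b c m) (i, j)"
    using eq by (auto simp: lookup_move split: if_splits)
qed

lemma move_move:
  assumes "Poly_Mapping.lookup m (b, c) \<noteq> 0"
  shows "move b a c (move a b c m) = m"
  using assms by (intro poly_mapping_eqI) (auto simp: lookup_move)

text \<open>Let \<open>k\<close> be the part common to the two monomials. Both sides equal
  \<open>mfact k\<close> times the two exponents, of \<open>(b, c)\<close> and of
  \<open>(a, c)\<close> in \<open>k\<close>, each increased by 1. This identity is what the
  factorials in \<open>D_poly\<close> are for.\<close>

lemma mfact_move:
  assumes "Poly_Mapping.lookup m (b, c) \<noteq> 0"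
  shows "mfact m * Poly_Mapping.lookup (move a b c m) (a, c) =
    Poly_Mapping.lookup m (b, c) * mfact (move a b c m)"
proof -
  define k where "k = m - Poly_Mapping.single (b, c) 1"
  have m: "m = Poly_Mapping.single (b, c) 1 + k"
    using assms by (intro poly_mapping_eqI) (auto simp: k_def lookup_add lookup_minus lookup_single when_def)
  have mv: "move a b c m = Poly_Mapping.single (a, c) 1 + k"
    by (simp add: move_def k_def add.commute)
  show ?thesis unfolding mv unfolding m mfact_Suc by (simp add: lookup_add algebra_simps)
qed

text \<open>Double counting in each column \<open>c\<close>. Pairs of a sequence for
  \<open>m\<close> and a place \<open>p\<close> with entry \<open>b\<close> correspond to pairs of a
  sequence for \<open>move a b c m\<close> and a place with entry \<open>a\<close>, by changing that
  entry. A sequence of the second kind has as many such places as the exponent of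
  \<open>(a, c)\<close> in \<open>move a b c m\<close>, and \<open>mfact_move\<close> trades this
  number for the exponent of \<open>(b, c)\<close> in \<open>m\<close> while exchanging the
  factorials in front.\<close>

lemma poly_act_D_poly:
  assumes m: "m \<in> col_monomials n l" and ab: "a < n" "b < n"
  shows "poly_act n a b (D_poly n l \<alpha> (mat_of n m)) =
    (\<Sum>c<n. cscale (of_nat (Poly_Mapping.lookup m (b, c))) (D_poly n l \<alpha> (mat_of n (move a b c m))))"
proof -
  let ?G = "row_dets n l \<alpha>"
  have shift: "cscale (of_nat (mfact m) / of_nat (fact l ^ n))
      (\<Sum>f\<in>families n l m. \<Sum>p<l. if f (p, c) = b then ?G (f((p, c) := a)) else 0) =
     cscale (of_nat (Poly_Mapping.lookup m (b, c))) (D_poly n l \<alpha> (mat_of n (move a b c m)))"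
    if c: "c < n" for c
  proof (cases "Poly_Mapping.lookup m (b, c) = 0")
    \<comment> \<open>Here no sequence has entry \<open>b\<close> in column \<open>c\<close>, and
      the term with \<open>move\<close> has coefficient 0.\<close>
    case True
    have "f (p, c) \<noteq> b" if f: "f \<in> families n l m" and p: "p < l" for f p
    proof
      assume "f (p, c) = b"
      hence "(\<Sum>p<l. if f (p, c) = b then 1 else 0 :: nat) \<ge> 1"
        using member_le_sum[of p "{..<l}" "\<lambda>p. if f (p, c) = b then 1 else 0 :: nat"] p by auto
      thus False using f True c ab by (auto simp: families_def)
    qed
    hence "(\<Sum>f\<in>families n l m. \<Sum>p<l. if f (p, c) = b then ?G (f((p, c) := a)) else 0) = 0"
      by (intro sum.neutral) auto
    thus ?thesis using True by simp
  next
    case False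
    let ?m = "move a b c m"
    have m': "?m \<in> col_monomials n l" by (rule move_col_monomials[OF m ab(1) False])
    have "(\<Sum>f\<in>families n l m. \<Sum>p<l. if f (p, c) = b then ?G (f((p, c) := a)) else 0) =
        (\<Sum>p<l. \<Sum>f\<in>{f \<in> families n l m. f (p, c) = b}. ?G (f((p, c) := a)))"
      by (subst sum.swap) (simp add: sum.inter_filter[OF finite_families])
    also have "\<dots> = (\<Sum>p<l. \<Sum>g\<in>{g \<in> families n l ?m. g (p, c) = a}. ?G g)"
    proof (rule sum.cong[OF refl])
      fix p assume "p \<in> {..<l}"
      hence p: "p < l" by simp
      show "(\<Sum>f\<in>{f \<in> families n l m. f (p, c) = b}. ?G (f((p, c) := a))) =
          (\<Sum>g\<in>{g \<in> families n l ?m. g (p, c) = a}. ?G g)"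
        by (rule sum.reindex_bij_witness[of _ "\<lambda>g. g((p, c) := b)" "\<lambda>f. f((p, c) := a)"])
          (use families_move[OF _ _ p c] ab move_move[OF False, of a] in \<open>fastforce+\<close>)
    qed
    also have "\<dots> = (\<Sum>g\<in>families n l ?m. \<Sum>p<l. if g (p, c) = a then ?G g else 0)"
      by (subst sum.swap) (simp add: sum.inter_filter[OF finite_families])
    also have "\<dots> = (\<Sum>g\<in>families n l ?m. cscale (of_nat (Poly_Mapping.lookup ?m (a, c))) (?G g))"
    proof (intro sum.cong refl)
      fix g assume g: "g \<in> families n l ?m"
      have "(\<Sum>p<l. if g (p, c) = a then ?G g else 0) =
          cscale (of_nat (\<Sum>p<l. if g (p, c) = a then 1 else 0)) (?G g)"
        unfolding of_nat_sum cs.scale_sum_left by (intro sum.cong refl) auto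
      moreover have "(\<Sum>p<l. if g (p, c) = a then 1 else 0) = Poly_Mapping.lookup ?m (a, c)"
        using g c ab by (simp add: families_def)
      ultimately show "(\<Sum>p<l. if g (p, c) = a then ?G g else 0) = cscale (of_nat (Poly_Mapping.lookup ?m (a, c))) (?G g)"
        by simp
    qed
    also have "\<dots> = cscale (of_nat (Poly_Mapping.lookup ?m (a, c))) (\<Sum>g\<in>families n l ?m. ?G g)"
      by (simp add: cs.scale_sum_right)
    finally show ?thesis
      using m' by (subst D_poly_eq) (auto simp: col_monomials_def times_divide_eq_left
        of_nat_mult[symmetric] mfact_move[OF False, of a] simp del: of_nat_mult)
  qed
  have "poly_act n a b (D_poly n l \<alpha> (mat_of n m)) = cscale (of_nat (mfact m) / of_nat (fact l ^ n))
      (\<Sum>f\<in>families n l m. \<Sum>c<n. \<Sum>p<l. if f (p, c) = b then ?G (f((p, c) := a)) else 0)"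
    using m by (subst D_poly_eq) (auto simp: col_monomials_def poly_act_scale poly_act_sum poly_act_row_dets)
  also have "\<dots> = (\<Sum>c<n. cscale (of_nat (mfact m) / of_nat (fact l ^ n))
      (\<Sum>f\<in>families n l m. \<Sum>p<l. if f (p, c) = b then ?G (f((p, c) := a)) else 0))"
    by (subst sum.swap) (simp add: cs.scale_sum_right)
  also have "\<dots> = (\<Sum>c<n. cscale (of_nat (Poly_Mapping.lookup m (b, c))) (D_poly n l \<alpha> (mat_of n (move a b c m))))"
    by (intro sum.cong refl shift) simp
  finally show ?thesis .
qed

text \<open>
  The intertwiner \<open>Phi\<close> read on polynomials: the basis tensor of the matrix \<open>M\<close> is identified with the
  monomial with exponent matrix \<open>M\<close>.
\<close>

definition T_map :: "nat \<Rightarrow> nat \<Rightarrow> complex \<Rightarrow> (nat \<times> nat) mpoly \<Rightarrow> (nat \<times> nat) mpoly" where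
  "T_map n l \<alpha> = lin_ext (\<lambda>m. D_poly n l \<alpha> (mat_of n m))"

lemma linear_T_map: "Vector_Spaces.linear cscale cscale (T_map n l \<alpha>)"
  unfolding T_map_def by (rule linear_lin_ext)

lemma T_map_add: "T_map n l \<alpha> (p + q) = T_map n l \<alpha> p + T_map n l \<alpha> q"
  and T_map_diff: "T_map n l \<alpha> (p - q) = T_map n l \<alpha> p - T_map n l \<alpha> q"
  and T_map_scale: "T_map n l \<alpha> (cscale c p) = cscale c (T_map n l \<alpha> p)"
  and T_map_sum: "T_map n l \<alpha> (\<Sum>x\<in>A. f x) = (\<Sum>x\<in>A. T_map n l \<alpha> (f x))"
  and T_map_zero: "T_map n l \<alpha> 0 = 0"
proof -
  interpret Vector_Spaces.linear cscale cscale "T_map n l \<alpha>" by (rule linear_T_map)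
  show "T_map n l \<alpha> (p + q) = T_map n l \<alpha> p + T_map n l \<alpha> q"
    "T_map n l \<alpha> (p - q) = T_map n l \<alpha> p - T_map n l \<alpha> q"
    "T_map n l \<alpha> (cscale c p) = cscale c (T_map n l \<alpha> p)"
    "T_map n l \<alpha> (\<Sum>x\<in>A. f x) = (\<Sum>x\<in>A. T_map n l \<alpha> (f x))" "T_map n l \<alpha> 0 = 0"
    by (simp_all add: add diff scale sum zero)
qed

lemma T_map_single: "T_map n l \<alpha> (Poly_Mapping.single m 1) = D_poly n l \<alpha> (mat_of n m)"
  by (simp add: T_map_def)

lemma T_map_act:
  assumes "p \<in> col_space n l" "i < n" "j < n"
  shows "T_map n l \<alpha> (poly_act n i j p) = poly_act n i j (T_map n l \<alpha> p)"
proof (rule linear_agree[where p = p])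
  show "Vector_Spaces.linear cscale cscale (\<lambda>p. T_map n l \<alpha> (poly_act n i j p))"
    "Vector_Spaces.linear cscale cscale (\<lambda>p. poly_act n i j (T_map n l \<alpha> p))"
    by (rule linear_cscale_compose[OF linear_T_map linear_poly_act]
      linear_cscale_compose[OF linear_poly_act linear_T_map])+
  fix m assume "m \<in> Poly_Mapping.keys p"
  hence m: "m \<in> col_monomials n l" using assms(1) by (auto simp: col_space_def)
  show "T_map n l \<alpha> (poly_act n i j (Poly_Mapping.single m 1)) = poly_act n i j (T_map n l \<alpha> (Poly_Mapping.single m 1))"
    unfolding poly_act_mono T_map_single poly_act_D_poly[OF m assms(2,3)]
    by (simp add: T_map_sum T_map_scale T_map_single del: cscale_single)
qed

lemma col_space_mult:
  assumes "p \<in> col_space n a" "q \<in> col_space n b"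
  shows "p * q \<in> col_space n (a + b)"
proof -
  have "m + m' \<in> col_monomials n (a + b)" if "m \<in> col_monomials n a" "m' \<in> col_monomials n b" for m m'
    using that keys_add[of m m'] by (auto simp: col_monomials_def lookup_add sum.distrib)
  thus ?thesis using assms keys_mult[of p q] by (fastforce simp: col_space_def)
qed

lemma one_in_col_space: "1 \<in> col_space n 0"
  by (auto simp: col_space_def col_monomials_def)

lemma prod_Var: "(\<Prod>x\<in>A. Var (h x)) = Poly_Mapping.single (\<Sum>x\<in>A. Poly_Mapping.single (h x) 1) 1"
  by (induction A rule: infinite_finite_induct) (auto simp: Var_def mult_single)

lemma row_det_col_space:
  assumes "\<And>j. j < n \<Longrightarrow> k j < n"
  shows "row_det n \<alpha> k \<in> col_space n 1"
  unfolding row_det_def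
proof (intro cs.subspace_sum[OF subspace_col_space] cs.subspace_scale[OF subspace_col_space])
  fix \<sigma> assume "\<sigma> \<in> {\<sigma>. \<sigma> permutes {..<n}}"
  hence \<sigma>: "\<sigma> j < n" if "j < n" for j using permutes_in_image[of \<sigma> "{..<n}" j] that by auto
  have "(\<Sum>j<n. Poly_Mapping.single (k (\<sigma> j), j) 1) \<in> col_monomials n 1"
    unfolding col_monomials_def
  proof (intro CollectI conjI allI impI)
    show "Poly_Mapping.keys (\<Sum>j<n. Poly_Mapping.single (k (\<sigma> j), j) 1) \<subseteq> {..<n} \<times> {..<n}"
      using assms \<sigma> by (intro order_trans[OF keys_sum]) auto
    fix j assume j: "j < n"
    have "(\<Sum>i<n. Poly_Mapping.lookup (\<Sum>j<n. Poly_Mapping.single (k (\<sigma> j), j) 1) (i, j)) =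
        (\<Sum>i<n. \<Sum>j'<n. if j' = j then if i = k (\<sigma> j) then 1 else 0 else 0)"
      unfolding lookup_sum lookup_single by (intro sum.cong refl) (auto simp: when_def)
    also have "\<dots> = 1" using j assms \<sigma> by simp
    finally show "(\<Sum>i<n. Poly_Mapping.lookup (\<Sum>j<n. Poly_Mapping.single (k (\<sigma> j), j) 1) (i, j)) = 1" .
  qed
  thus "(\<Prod>j<n. Var (k (\<sigma> j), j)) \<in> col_space n 1" by (simp add: prod_Var col_space_def)
qed

lemma row_dets_col_space:
  assumes "\<And>p j. p < l \<Longrightarrow> j < n \<Longrightarrow> f (p, j) < n"
  shows "row_dets n l \<alpha> f \<in> col_space n l"
  using assms
proof (induction l)
  case (Suc l)
  thus ?case using col_space_mult[of _ n l _ 1] row_det_col_space[of n "\<lambda>j. f (l, j)"]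
    by (simp add: row_dets_def)
qed (simp add: row_dets_def one_in_col_space)

lemma T_map_col_space:
  assumes "p \<in> col_space n l"
  shows "T_map n l \<alpha> p \<in> col_space n l"
  unfolding T_map_def lin_ext_def
proof (intro cs.subspace_sum[OF subspace_col_space] cs.subspace_scale[OF subspace_col_space])
  fix m assume "m \<in> Poly_Mapping.keys p"
  hence m: "Poly_Mapping.keys m \<subseteq> {..<n} \<times> {..<n}" using assms by (auto simp: col_space_def col_monomials_def)
  show "D_poly n l \<alpha> (mat_of n m) \<in> col_space n l"
    unfolding D_poly_eq[OF m]
    by (intro cs.subspace_sum[OF subspace_col_space] cs.subspace_scale[OF subspace_col_space] row_dets_col_space)
      (auto simp: families_def PiE_iff)
qed

definition diag_monomial :: "nat \<Rightarrow> nat \<Rightarrow> (nat \<times> nat \<Rightarrow>\<^sub>0 nat)" where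
  "diag_monomial n l = (\<Sum>i<n. Poly_Mapping.single (i, i) l)"

lemma lookup_diag_monomial:
  "Poly_Mapping.lookup (diag_monomial n l) (i, j) = (if i = j \<and> i < n then l else 0)"
proof -
  have "Poly_Mapping.lookup (diag_monomial n l) (i, j) = (\<Sum>k<n. if k = i then if i = j then l else 0 else 0)"
    unfolding diag_monomial_def lookup_sum lookup_single by (intro sum.cong) (auto simp: when_def)
  thus ?thesis by simp
qed

lemma diag_monomial_in: "diag_monomial n l \<in> col_monomials n l"
  by (auto simp: col_monomials_def in_keys_iff lookup_diag_monomial split: if_splits)

lemma alpha_det_X_mat: "alpha_det \<alpha> (X_mat n) = row_det n \<alpha> (\<lambda>j. j)"
proof -
  have "(\<Prod>j<n. X_mat n $$ (\<sigma> j, j)) = (\<Prod>j<n. Var (\<sigma> j, j))" if "\<sigma> permutes {..<n}" for \<sigma>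
  proof (intro prod.cong refl)
    fix j assume "j \<in> {..<n}"
    moreover from this have "\<sigma> j \<in> {..<n}" using permutes_in_image[OF that] by simp
    ultimately show "X_mat n $$ (\<sigma> j, j) = Var (\<sigma> j, j)" by (simp add: X_mat_def)
  qed
  moreover have "dim_row (X_mat n) = n" by (simp add: X_mat_def)
  ultimately show ?thesis by (simp add: row_det_def alpha_det_def)
qed

text \<open>The only way to write \<open>l\<close> times the identity as a sum of \<open>l\<close>
  unit-column matrices is to take \<open>l\<close> identities, since each of the \<open>l\<close>
  entries in column \<open>j\<close> must lie in row \<open>j\<close>. The normalising factor is
  then \<open>fact l ^ n / fact l ^ n\<close>.\<close>

lemma T_map_diag_monomial:
  "T_map n l \<alpha> (Poly_Mapping.single (diag_monomial n l) 1) = alpha_det \<alpha> (X_mat n) ^ l"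
proof -
  let ?m = "diag_monomial n l"
  let ?f = "restrict snd ({..<l} \<times> {..<n})"
  have keys: "Poly_Mapping.keys ?m \<subseteq> {..<n} \<times> {..<n}" using diag_monomial_in by (auto simp: col_monomials_def)
  have "families n l ?m = {?f}"
  proof (intro equalityI subsetI)
    fix f assume f: "f \<in> families n l ?m"
    have diag: "f (p, j) = j" if p: "p < l" and j: "j < n" for p j
    proof (rule ccontr)
      assume ne: "f (p, j) \<noteq> j"
      have "(\<Sum>p<l. if f (p, j) = j then 1 else 0) < (\<Sum>p<l. 1 :: nat)"
        using p ne by (intro sum_strict_mono_ex1) auto
      thus False using f j by (simp add: families_def lookup_diag_monomial)
    qed
    have "f = ?f"
    proof
      fix x :: "nat \<times> nat"
      show "f x = ?f x"
        using f diag[of "fst x" "snd x"] by (cases x) (auto simp: families_def PiE_iff extensional_def)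
    qed
    thus "f \<in> {?f}" by simp
  next
    fix f assume "f \<in> {?f}"
    thus "f \<in> families n l ?m" by (auto simp: families_def lookup_diag_monomial)
  qed
  moreover have "mfact ?m = fact l ^ n"
  proof -
    have "mfact ?m = (\<Prod>i<n. \<Prod>j<n. fact (Poly_Mapping.lookup ?m (i, j)))"
      unfolding mfact_eq[OF finite_cartesian_product[OF finite_lessThan finite_lessThan] keys] prod.cartesian_product
      by (intro prod.cong) auto
    also have "\<dots> = (\<Prod>i<n. \<Prod>j<n. if j = i then fact l else 1)"
      by (intro prod.cong refl) (auto simp: lookup_diag_monomial)
    finally show ?thesis by simp
  qed
  moreover have "row_dets n l \<alpha> ?f = row_det n \<alpha> (\<lambda>j. j) ^ l"
  proof -
    have "row_det n \<alpha> (\<lambda>j. ?f (p, j)) = row_det n \<alpha> (\<lambda>j. j)" if "p < l" for p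
      using that by (intro row_det_cong) auto
    thus ?thesis by (simp add: row_dets_def)
  qed
  ultimately show ?thesis unfolding T_map_single D_poly_eq[OF keys] by (simp add: alpha_det_X_mat)
qed

section \<open>Generation by the diagonal monomial and the image of the intertwiner\<close>

definition off_diag :: "nat \<Rightarrow> (nat \<times> nat \<Rightarrow>\<^sub>0 nat) \<Rightarrow> nat" where
  "off_diag n m = (\<Sum>x\<in>{..<n} \<times> {..<n}. if fst x = snd x then 0 else Poly_Mapping.lookup m x)"

lemma off_diag_move:
  assumes "Poly_Mapping.lookup m (b, c) \<noteq> 0" "a < n" "b < n" "c < n"
  shows "off_diag n (move a b c m) + (if b = c then 0 else 1) = off_diag n m + (if a = c then 0 else 1)"
proof -
  let ?A = "{..<n} \<times> {..<n}"
  have "off_diag n (move a b c m) + (if b = c then 0 else 1) = (\<Sum>x\<in>?A.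
      (if fst x = snd x then 0 else Poly_Mapping.lookup (move a b c m) x) + (if x = (b, c) then if b = c then 0 else 1 else 0))"
    using assms by (simp add: off_diag_def sum.distrib)
  also have "\<dots> = (\<Sum>x\<in>?A.
      (if fst x = snd x then 0 else Poly_Mapping.lookup m x) + (if x = (a, c) then if a = c then 0 else 1 else 0))"
    using assms(1) by (intro sum.cong refl) (auto simp: lookup_move)
  also have "\<dots> = off_diag n m + (if a = c then 0 else 1)"
    using assms by (simp add: off_diag_def sum.distrib)
  finally show ?thesis .
qed

text \<open>
  Induction on the off-diagonal degree: if \<open>x_ab\<close> occurs in a monomial \<open>m\<close>, \<open>a \<noteq> b\<close>, let \<open>m'\<close> arise from \<open>m\<close>
  by replacing one \<open>x_ab\<close> by \<open>x_bb\<close>.  Then \<open>E a b\<close> maps \<open>m'\<close> to a nonzero multiple of \<open>m\<close> plus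
  monomials of smaller off-diagonal degree.
\<close>

lemma diag_monomial_generates:
  assumes S: "is_submodule n (poly_module n) S" and diag: "Poly_Mapping.single (diag_monomial n l) 1 \<in> S"
  shows "col_space n l \<subseteq> S"
proof -
  note sub = pm_subspace[OF S]
  have mono: "Poly_Mapping.single m 1 \<in> S" if "m \<in> col_monomials n l" for m
    using that
  proof (induction "off_diag n m" arbitrary: m rule: less_induct)
    case less
    show ?case
    proof (cases "\<exists>a<n. \<exists>b<n. a \<noteq> b \<and> Poly_Mapping.lookup m (a, b) \<noteq> 0")
      case False
      have "m = diag_monomial n l"
      proof (rule poly_mapping_eqI)
        fix x :: "nat \<times> nat"
        obtain i j where x: "x = (i, j)" by (cases x)
        show "Poly_Mapping.lookup m x = Poly_Mapping.lookup (diag_monomial n l) x"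
        proof (cases "i < n \<and> j < n")
          case True
          have "l = (\<Sum>a<n. Poly_Mapping.lookup m (a, j))" using less.prems True by (simp add: col_monomials_def)
          also have "\<dots> = (\<Sum>a<n. if a = j then Poly_Mapping.lookup m (j, j) else 0)"
            using False True by (intro sum.cong refl) auto
          also have "\<dots> = Poly_Mapping.lookup m (j, j)" using True by simp
          finally show ?thesis using False True x by (auto simp: lookup_diag_monomial)
        next
          case False
          hence "x \<notin> Poly_Mapping.keys m" using less.prems x by (auto simp: col_monomials_def)
          thus ?thesis using False x by (auto simp: lookup_diag_monomial in_keys_iff)
        qed
      qed
      thus ?thesis using diag by simp
    next
      case True
      then obtain a b where ab: "a < n" "b < n" "a \<noteq> b" "Poly_Mapping.lookup m (a, b) \<noteq> 0" by blast
      define m' where "m' = move b a b m"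
      have m': "m' \<in> col_monomials n l" unfolding m'_def using less.prems ab by (intro move_col_monomials)
      have off: "off_diag n m' < off_diag n m" using off_diag_move[OF ab(4,2,1,2)] ab(3) by (simp add: m'_def)
      have m'bb: "Poly_Mapping.lookup m' (b, b) \<noteq> 0" by (simp add: m'_def lookup_move)
      have undo: "move a b b m' = m" unfolding m'_def by (rule move_move[OF ab(4)])
      let ?t = "\<lambda>k. cscale (of_nat (Poly_Mapping.lookup m' (b, k))) (Poly_Mapping.single (move a b k m') 1)"
      have "poly_act n a b (Poly_Mapping.single m' 1) \<in> S"
        using pm.is_submoduleD(3)[OF S ab(1,2)] less.hyps[OF off m'] by blast
      moreover have "(\<Sum>k\<in>{..<n} - {b}. ?t k) \<in> S"
      proof (rule cs.subspace_sum[OF sub])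
        fix k assume k: "k \<in> {..<n} - {b}"
        show "?t k \<in> S"
        proof (cases "Poly_Mapping.lookup m' (b, k) = 0")
          case True
          thus ?thesis using cs.subspace_0[OF sub] by simp
        next
          case False
          \<comment> \<open>For \<open>k\<close> different from \<open>b\<close> the factor removed
            was already off the diagonal, so its replacement cannot increase the off-diagonal
            degree.\<close>
          have "off_diag n (move a b k m') \<le> off_diag n m'"
            using off_diag_move[OF False ab(1,2)] k by (auto split: if_splits)
          hence "Poly_Mapping.single (move a b k m') 1 \<in> S"
            using off move_col_monomials[OF m' ab(1) False] by (intro less.hyps) auto
          thus ?thesis by (rule cs.subspace_scale[OF sub])
        qed
      qed
      ultimately have "poly_act n a b (Poly_Mapping.single m' 1) - (\<Sum>k\<in>{..<n} - {b}. ?t k) \<in> S"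
        by (rule cs.subspace_diff[OF sub])
      also have "poly_act n a b (Poly_Mapping.single m' 1) - (\<Sum>k\<in>{..<n} - {b}. ?t k) = ?t b"
        unfolding poly_act_mono using ab(2) by (subst sum.remove[of _ b]) auto
      finally have "cscale (1 / of_nat (Poly_Mapping.lookup m' (b, b))) (?t b) \<in> S"
        by (rule cs.subspace_scale[OF sub])
      thus ?thesis using m'bb unfolding undo by simp
    qed
  qed
  have "(\<lambda>m. Poly_Mapping.single m 1) ` col_monomials n l \<subseteq> S" using mono by auto
  from cs.span_minimal[OF this sub] show ?thesis by (simp add: poly_span_singles col_space_def)
qed

lemma cyclic_alpha_det:
  "mspace (cyclic_submodule n (poly_module n) (alpha_det \<alpha> (X_mat n) ^ l)) = T_map n l \<alpha> ` col_space n l"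
proof
  let ?d = "Poly_Mapping.single (diag_monomial n l) 1"
  have d: "?d \<in> col_space n l" using diag_monomial_in by (simp add: col_space_def)
  note colP = pm.is_submoduleD(1)[OF col_space_submodule[of n l]]
  have img: "is_submodule n (poly_module n) (T_map n l \<alpha> ` col_space n l)"
    unfolding is_submodule_def mscale_poly
  proof (intro conjI allI impI ballI)
    show "T_map n l \<alpha> ` col_space n l \<subseteq> mspace (poly_module n)" using T_map_col_space colP by blast
    interpret Vector_Spaces.linear cscale cscale "T_map n l \<alpha>" by (rule linear_T_map)
    show "cs.subspace (T_map n l \<alpha> ` col_space n l)" by (rule subspace_image[OF subspace_col_space])
    fix i j x assume ij: "i < n" "j < n" and "x \<in> T_map n l \<alpha> ` col_space n l"
    then obtain p where p: "p \<in> col_space n l" "x = T_map n l \<alpha> p" by blast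
    show "poly_act n i j x \<in> T_map n l \<alpha> ` col_space n l"
      unfolding p(2) T_map_act[OF p(1) ij, symmetric]
      by (rule imageI) (rule pm.is_submoduleD(3)[OF col_space_submodule ij p(1)])
  qed
  show "mspace (cyclic_submodule n (poly_module n) (alpha_det \<alpha> (X_mat n) ^ l)) \<subseteq> T_map n l \<alpha> ` col_space n l"
    by (rule pm.cyclic_submodule_least[OF img imageI[OF d, of "T_map n l \<alpha>", unfolded T_map_diag_monomial]])
  let ?C = "mspace (cyclic_submodule n (poly_module n) (alpha_det \<alpha> (X_mat n) ^ l))"
  have "alpha_det \<alpha> (X_mat n) ^ l \<in> mspace (poly_module n)"
    using T_map_col_space[OF d] colP unfolding T_map_diag_monomial by blast
  hence C: "is_submodule n (poly_module n) ?C" by (rule pm.cyclic_submodule_is_submodule)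
  note subC = pm_subspace[OF C]
  \<comment> \<open>The polynomials mapped into the cyclic module form a submodule; it contains the
    diagonal monomial and is therefore everything.\<close>
  have "is_submodule n (poly_module n) {p \<in> col_space n l. T_map n l \<alpha> p \<in> ?C}"
    unfolding is_submodule_def mscale_poly
  proof (intro conjI allI impI ballI)
    show "cs.subspace {p \<in> col_space n l. T_map n l \<alpha> p \<in> ?C}"
      by (rule cs.subspaceI) (auto simp: T_map_add T_map_scale T_map_zero cs.subspace_0[OF subC]
        cs.subspace_add[OF subC] cs.subspace_scale[OF subC] cs.subspace_0[OF subspace_col_space]
        cs.subspace_add[OF subspace_col_space] cs.subspace_scale[OF subspace_col_space])
    show "poly_act n i j x \<in> {p \<in> col_space n l. T_map n l \<alpha> p \<in> ?C}"
      if "i < n" "j < n" "x \<in> {p \<in> col_space n l. T_map n l \<alpha> p \<in> ?C}" for i j x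
      using that pm.is_submoduleD(3)[OF col_space_submodule] pm.is_submoduleD(3)[OF C] by (auto simp: T_map_act)
  qed (use colP in auto)
  moreover have "?d \<in> {p \<in> col_space n l. T_map n l \<alpha> p \<in> ?C}"
    using d by (simp add: T_map_diag_monomial pm.cyclic_submodule_contains)
  ultimately have "col_space n l \<subseteq> {p \<in> col_space n l. T_map n l \<alpha> p \<in> ?C}"
    by (rule diag_monomial_generates)
  thus "T_map n l \<alpha> ` col_space n l \<subseteq> ?C" by blast
qed

text \<open>With \<open>n\<close> cycles on \<open>n\<close> points, different points have different
  orbits, whereas \<open>\<sigma> i\<close> and \<open>i\<close> always share one.\<close>

lemma perm_nu_eq_0_iff:
  assumes "\<sigma> permutes {..<n}"
  shows "perm_nu n \<sigma> = 0 \<longleftrightarrow> \<sigma> = id"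
proof
  assume "perm_nu n \<sigma> = 0"
  hence "n \<le> card (orbit \<sigma> ` {..<n})" by (simp add: perm_nu_def)
  hence inj: "inj_on (orbit \<sigma>) {..<n}"
    using card_image_le[of "{..<n}" "orbit \<sigma>"] by (intro eq_card_imp_inj_on) auto
  have perm: "permutation \<sigma>" using assms by (auto simp: permutation_permutes)
  have "\<sigma> i = i" if "i < n" for i
  proof -
    have "orbit \<sigma> (\<sigma> i) = orbit \<sigma> i"
      by (rule permutation_orbit_step[OF perm])
    moreover have "\<sigma> i < n" using permutes_in_image[OF assms] that by simp
    ultimately show ?thesis using inj that by (auto simp: inj_on_def)
  qed
  thus "\<sigma> = id" using assms by (auto simp: permutes_def fun_eq_iff)
next
  assume \<sigma>: "\<sigma> = id"
  have "orbit id i = {i}" for i :: nat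
  proof -
    have "x = i" if "x \<in> orbit id i" for x using that by induction auto
    thus ?thesis using orbit.base[of id i] by auto
  qed
  thus "perm_nu n \<sigma> = 0" unfolding \<sigma> perm_nu_def by (simp add: card_image inj_on_def)
qed

text \<open>Only the identity permutation survives, thanks to \<open>0 ^ 0 = 1\<close>.\<close>

lemma row_det_0: "row_det n 0 k = (\<Prod>j<n. Var (k j, j))"
proof -
  have "row_det n 0 k = (\<Sum>\<sigma> | \<sigma> permutes {..<n}. if \<sigma> = id then \<Prod>j<n. Var (k (\<sigma> j), j) else 0)"
    unfolding row_det_def using perm_nu_eq_0_iff by (intro sum.cong refl) (auto simp: power_0_left)
  thus ?thesis by (simp add: permutes_id finite_permutations)
qed

text \<open>At parameter 0 every sequence with sum \<open>m\<close> contributes one and the same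
  monomial, \<open>m\<close> itself. The resulting factor contains the number of these sequences; it
  is kept abstract, and \<open>T_map_0_bij\<close> obtains its nonvanishing from
  surjectivity.\<close>

lemma T_map_0_diagonal:
  obtains c :: "(nat \<times> nat \<Rightarrow>\<^sub>0 nat) \<Rightarrow> complex" where
    "\<And>p m. p \<in> col_space n l \<Longrightarrow> Poly_Mapping.lookup (T_map n l 0 p) m = c m * Poly_Mapping.lookup p m"
proof -
  let ?c = "\<lambda>m. of_nat (mfact m) / of_nat (fact l ^ n) * of_nat (card (families n l m))"
  have mono: "T_map n l 0 (Poly_Mapping.single m 1) = cscale (?c m) (Poly_Mapping.single m 1)"
    if m: "m \<in> col_monomials n l" for m
  proof -
    have "row_dets n l 0 f = Poly_Mapping.single m 1" if f: "f \<in> families n l m" for f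
    proof -
      have "row_dets n l 0 f = (\<Prod>x\<in>{..<l} \<times> {..<n}. Var (f x, snd x))"
        unfolding row_dets_def row_det_0 prod.cartesian_product by (intro prod.cong) auto
      also have "\<dots> = Poly_Mapping.single (\<Sum>x\<in>{..<l} \<times> {..<n}. Poly_Mapping.single (f x, snd x) 1) 1"
        by (rule prod_Var)
      also have "(\<Sum>x\<in>{..<l} \<times> {..<n}. Poly_Mapping.single (f x, snd x) 1) = m"
      proof (rule poly_mapping_eqI)
        fix y :: "nat \<times> nat"
        obtain i j where y: "y = (i, j)" by (cases y)
        have fl: "f (p, j) < n" if "p < l" "j < n" for p j using f that by (auto simp: families_def PiE_iff)
        have "Poly_Mapping.lookup (\<Sum>x\<in>{..<l} \<times> {..<n}. Poly_Mapping.single (f x, snd x) 1) (i, j) =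
            (\<Sum>p<l. \<Sum>j'<n. if j' = j then if f (p, j) = i then 1 else 0 else 0)"
          unfolding lookup_sum lookup_single sum.cartesian_product by (intro sum.cong) (auto simp: when_def)
        also have "\<dots> = (if j < n then \<Sum>p<l. if f (p, j) = i then 1 else 0 else 0)" by simp
        also have "\<dots> = Poly_Mapping.lookup m (i, j)"
        proof (cases "i < n \<and> j < n")
          case True
          thus ?thesis using f by (simp add: families_def)
        next
          case False
          hence "(i, j) \<notin> Poly_Mapping.keys m" using m by (auto simp: col_monomials_def)
          moreover have "f (p, j) \<noteq> i" if "p < l" "j < n" for p using fl[OF that] False that by auto
          ultimately show ?thesis by (auto simp: in_keys_iff)
        qed
        finally show "Poly_Mapping.lookup (\<Sum>x\<in>{..<l} \<times> {..<n}. Poly_Mapping.single (f x, snd x) 1) y =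
          Poly_Mapping.lookup m y" using y by simp
      qed
      finally show ?thesis .
    qed
    hence "(\<Sum>f\<in>families n l m. row_dets n l 0 f) = cscale (of_nat (card (families n l m))) (Poly_Mapping.single m 1)"
      using cs.sum_constant_scale[of "Poly_Mapping.single m 1" "families n l m"] by simp
    thus ?thesis using m by (simp add: T_map_single D_poly_eq col_monomials_def)
  qed
  show thesis
  proof (rule that)
    fix p m assume p: "p \<in> col_space n l"
    have "T_map n l 0 p = lin_ext (\<lambda>m. cscale (?c m) (Poly_Mapping.single m 1)) p"
      by (rule linear_agree[OF linear_T_map linear_lin_ext])
        (use p mono in \<open>auto simp: col_space_def simp del: cscale_single\<close>)
    also have "Poly_Mapping.lookup \<dots> m = ?c m * Poly_Mapping.lookup p m"
      by (auto simp: lin_ext_def lookup_sum lookup_single when_def in_keys_iff)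
    finally show "Poly_Mapping.lookup (T_map n l 0 p) m = ?c m * Poly_Mapping.lookup p m" .
  qed
qed

text \<open>
  For \<open>\<alpha> = 0\<close> the map is diagonal on monomials, and its image contains the generator
  \<open>x_11^l \<cdots> x_nn^l\<close> of the whole module, so no diagonal entry vanishes.
\<close>

lemma T_map_0_bij: "bij_betw (T_map n l 0) (col_space n l) (col_space n l)"
proof -
  obtain c where c: "\<And>p m. p \<in> col_space n l \<Longrightarrow> Poly_Mapping.lookup (T_map n l 0 p) m = c m * Poly_Mapping.lookup p m"
    using T_map_0_diagonal[of n l] by blast
  have d: "Poly_Mapping.single (diag_monomial n l) 1 \<in> col_space n l"
    using diag_monomial_in by (simp add: col_space_def)
  have "alpha_det 0 (X_mat n) ^ l = Poly_Mapping.single (diag_monomial n l) 1"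
  proof -
    have "alpha_det 0 (X_mat n) = Poly_Mapping.single (diag_monomial n 1) 1"
      by (simp add: alpha_det_X_mat row_det_0 prod_Var diag_monomial_def)
    moreover have "Poly_Mapping.single m (1::complex) ^ l = Poly_Mapping.single (\<Sum>_<l. m) 1"
      for m :: "nat \<times> nat \<Rightarrow>\<^sub>0 nat" and l
      by (induction l) (auto simp: mult_single add.commute simp del: sum_constant)
    moreover have "(\<Sum>_<l. diag_monomial n 1) = diag_monomial n l"
    proof (rule poly_mapping_eqI)
      fix x
      show "Poly_Mapping.lookup (\<Sum>_<l. diag_monomial n 1) x = Poly_Mapping.lookup (diag_monomial n l) x"
        unfolding lookup_sum by (cases x) (simp add: lookup_diag_monomial)
    qed
    ultimately show ?thesis by (simp del: sum_constant)
  qed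
  hence "col_space n l \<subseteq> mspace (cyclic_submodule n (poly_module n) (alpha_det 0 (X_mat n) ^ l))"
    using pm.is_submoduleD(1)[OF col_space_submodule[of n l]] d
    by (intro diag_monomial_generates pm.cyclic_submodule_is_submodule)
      (auto intro: pm.cyclic_submodule_contains simp: subset_iff)
  hence surj: "T_map n l 0 ` col_space n l = col_space n l"
    unfolding cyclic_alpha_det using T_map_col_space by blast
  have c0: "c m \<noteq> 0" if "m \<in> col_monomials n l" for m
  proof
    assume "c m = 0"
    have "Poly_Mapping.single m 1 \<in> T_map n l 0 ` col_space n l"
      unfolding surj using that by (simp add: col_space_def)
    then obtain p where "p \<in> col_space n l" "Poly_Mapping.single m 1 = T_map n l 0 p" by blast
    from c[OF this(1), of m] this(2)[symmetric] \<open>c m = 0\<close> show False by simp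
  qed
  have "inj_on (T_map n l 0) (col_space n l)"
  proof (rule inj_onI)
    fix p q assume pq: "p \<in> col_space n l" "q \<in> col_space n l" "T_map n l 0 p = T_map n l 0 q"
    show "p = q"
    proof (rule poly_mapping_eqI)
      fix m
      show "Poly_Mapping.lookup p m = Poly_Mapping.lookup q m"
      proof (cases "m \<in> col_monomials n l")
        case True
        thus ?thesis using c[OF pq(1), of m] c[OF pq(2), of m] pq(3) c0 by simp
      next
        case False
        hence "m \<notin> Poly_Mapping.keys p" "m \<notin> Poly_Mapping.keys q" using pq by (auto simp: col_space_def)
        thus ?thesis by (simp add: in_keys_iff)
      qed
    qed
  qed
  thus ?thesis using surj by (simp add: bij_betw_def)
qed

section \<open>Complete reducibility\<close>

text \<open>A preimage of a highest weight vector \<open>y\<close> need not be one, but its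
  component \<open>q\<close> orthogonal to the kernel \<open>Z\<close> is. If \<open>E\<close> kills
  \<open>y\<close>, then the image of \<open>E q\<close> is \<open>E y = 0\<close>, so
  \<open>E q\<close> lies in \<open>Z\<close>; being also orthogonal to the submodule
  \<open>Z\<close>, it vanishes. The weight equations follow in the same way.\<close>

lemma hw_vectors_T_map:
  "hw_vectors n (poly_module n) \<mu> \<inter> T_map n l \<alpha> ` col_space n l =
   T_map n l \<alpha> ` (hw_vectors n (poly_module n) \<mu> \<inter> col_space n l)"
proof
  note colP = pm.is_submoduleD(1)[OF col_space_submodule[of n l]]
  show "T_map n l \<alpha> ` (hw_vectors n (poly_module n) \<mu> \<inter> col_space n l) \<subseteq>
      hw_vectors n (poly_module n) \<mu> \<inter> T_map n l \<alpha> ` col_space n l"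
  proof
    fix y assume "y \<in> T_map n l \<alpha> ` (hw_vectors n (poly_module n) \<mu> \<inter> col_space n l)"
    then obtain p where p: "p \<in> hw_vectors n (poly_module n) \<mu>" "p \<in> col_space n l" "y = T_map n l \<alpha> p" by blast
    have act: "poly_act n i j y = T_map n l \<alpha> (poly_act n i j p)" if "i < n" "j < n" for i j
      using T_map_act[OF p(2) that] p(3) by simp
    have "y \<in> hw_vectors n (poly_module n) \<mu>"
      unfolding hw_vectors_def
    proof (intro CollectI conjI allI impI)
      show "y \<in> mspace (poly_module n)" using T_map_col_space[OF p(2)] p(3) colP by blast
      show "poly_act n i j y = 0" if "i < j \<and> j < n" for i j
        using that act[of i j] pm.hw_vectorsD(2)[OF p(1), of i j] by (simp add: T_map_zero)
      show "poly_act n i i y = mscale (poly_module n) (of_nat (part \<mu> i)) y" if "i < n" for i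
        using that act[of i i] pm.hw_vectorsD(3)[OF p(1), of i] p(3) by (simp add: T_map_scale)
    qed
    thus "y \<in> hw_vectors n (poly_module n) \<mu> \<inter> T_map n l \<alpha> ` col_space n l" using p by blast
  qed
  show "hw_vectors n (poly_module n) \<mu> \<inter> T_map n l \<alpha> ` col_space n l \<subseteq>
      T_map n l \<alpha> ` (hw_vectors n (poly_module n) \<mu> \<inter> col_space n l)"
  proof
    fix y assume "y \<in> hw_vectors n (poly_module n) \<mu> \<inter> T_map n l \<alpha> ` col_space n l"
    then obtain p where y: "y \<in> hw_vectors n (poly_module n) \<mu>" and p: "p \<in> col_space n l" "y = T_map n l \<alpha> p"
      by blast
    \<comment> \<open>the component of \<open>p\<close> orthogonal to the kernel is again a highest weight vector\<close>
    define Z where "Z = {p \<in> col_space n l. T_map n l \<alpha> p = 0}"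
    have Z: "is_submodule n (poly_module n) Z"
      unfolding is_submodule_def mscale_poly
    proof (intro conjI allI impI ballI)
      show "cs.subspace Z" unfolding Z_def
        by (rule cs.subspaceI) (auto simp: T_map_add T_map_scale T_map_zero cs.subspace_0[OF subspace_col_space]
          cs.subspace_add[OF subspace_col_space] cs.subspace_scale[OF subspace_col_space])
      show "poly_act n i j x \<in> Z" if "i < n" "j < n" "x \<in> Z" for i j x
        using that pm.is_submoduleD(3)[OF col_space_submodule] pm.act_zero[of i n j] by (auto simp: Z_def T_map_act)
    qed (use colP in \<open>auto simp: Z_def\<close>)
    have Zc: "Z \<subseteq> {p. Poly_Mapping.keys p \<subseteq> col_monomials n l}" by (auto simp: Z_def col_space_def)
    obtain z where z: "z \<in> Z" "\<And>y. y \<in> Z \<Longrightarrow> fip (p - z) y = 0"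
      using orthogonal_projection[OF pm_subspace[OF Z] finite_col_monomials Zc] by blast
    define q where "q = p - z"
    have qc: "q \<in> col_space n l" unfolding q_def
      using p z cs.subspace_diff[OF subspace_col_space] by (auto simp: Z_def)
    have qy: "T_map n l \<alpha> q = y" using p z by (simp add: q_def T_map_diff Z_def)
    have zero: "x = 0" if "x \<in> Z" "\<And>y. y \<in> Z \<Longrightarrow> fip x y = 0" for x
      using that by (simp add: fip_self_eq_0_iff[symmetric])
    have qZ: "fip q y = 0" "fip (poly_act n i j q) y = 0" if "y \<in> Z" "i < n" "j < n" for y i j
      using that z pm.is_submoduleD(3)[OF Z that(3,2,1)] by (auto simp: q_def fip_poly_act)
    have "q \<in> hw_vectors n (poly_module n) \<mu>"
      unfolding hw_vectors_def
    proof (intro CollectI conjI allI impI)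
      show "q \<in> mspace (poly_module n)" using qc colP by blast
      show "poly_act n i j q = 0" if ij: "i < j \<and> j < n" for i j
      proof (rule zero)
        show "poly_act n i j q \<in> Z"
          using ij qc qy pm.is_submoduleD(3)[OF col_space_submodule, of i n j q] pm.hw_vectorsD(2)[OF y, of i j]
          by (auto simp: Z_def T_map_act)
      qed (use qZ ij in auto)
      show "poly_act n i i q = mscale (poly_module n) (of_nat (part \<mu> i)) q" if i: "i < n" for i
      proof -
        have "poly_act n i i q - cscale (of_nat (part \<mu> i)) q = 0"
        proof (rule zero)
          show "poly_act n i i q - cscale (of_nat (part \<mu> i)) q \<in> Z"
            using i qc qy pm.is_submoduleD(3)[OF col_space_submodule, of i n i q] pm.hw_vectorsD(3)[OF y i]
            by (auto simp: Z_def T_map_act T_map_diff T_map_scale cs.subspace_diff[OF subspace_col_space]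
              cs.subspace_scale[OF subspace_col_space])
        qed (use qZ i in \<open>auto simp: fip_diff_left fip_scale_left\<close>)
        thus ?thesis by simp
      qed
    qed
    thus "y \<in> T_map n l \<alpha> ` (hw_vectors n (poly_module n) \<mu> \<inter> col_space n l)" using qc qy by blast
  qed
qed

lemma subspace_hw_vectors: "cs.subspace (hw_vectors n (poly_module n) \<mu>)"
proof -
  note sub = pm.subspace_mspace[of n, unfolded mscale_poly]
  show ?thesis
    by (rule cs.subspaceI) (auto simp: hw_vectors_def cs.subspace_0[OF sub] cs.subspace_add[OF sub]
      cs.subspace_scale[OF sub] poly_act_add poly_act_scale pm.act_zero cs.scale_right_distrib mult.commute)
qed

section \<open>Direct sums and the decomposition into irreducible modules\<close>

lemma gl_isomorphic_sym:
  assumes "gl_isomorphic n V W"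
    and "\<And>v w. v \<in> mspace V \<Longrightarrow> w \<in> mspace V \<Longrightarrow> v + w \<in> mspace V"
    and "\<And>c v. v \<in> mspace V \<Longrightarrow> mscale V c v \<in> mspace V"
    and "\<And>i j v. i < n \<Longrightarrow> j < n \<Longrightarrow> v \<in> mspace V \<Longrightarrow> mact V i j v \<in> mspace V"
  shows "gl_isomorphic n W V"
proof -
  obtain \<phi> where \<phi>: "bij_betw \<phi> (mspace V) (mspace W)"
    "\<And>v w. v \<in> mspace V \<Longrightarrow> w \<in> mspace V \<Longrightarrow> \<phi> (v + w) = \<phi> v + \<phi> w"
    "\<And>c v. v \<in> mspace V \<Longrightarrow> \<phi> (mscale V c v) = mscale W c (\<phi> v)"
    "\<And>i j v. i < n \<Longrightarrow> j < n \<Longrightarrow> v \<in> mspace V \<Longrightarrow> \<phi> (mact V i j v) = mact W i j (\<phi> v)"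
    using assms(1) unfolding gl_isomorphic_def by blast
  define \<psi> where "\<psi> = the_inv_into (mspace V) \<phi>"
  have inj: "inj_on \<phi> (mspace V)" and surj: "\<phi> ` mspace V = mspace W" using \<phi>(1) by (auto simp: bij_betw_def)
  have \<psi>: "\<psi> (\<phi> v) = v" if "v \<in> mspace V" for v unfolding \<psi>_def by (rule the_inv_into_f_f[OF inj that])
  have ex: "\<exists>v\<in>mspace V. w = \<phi> v" if "w \<in> mspace W" for w using that surj by blast
  show ?thesis unfolding gl_isomorphic_def
  proof (intro exI[of _ \<psi>] conjI allI ballI impI)
    show "bij_betw \<psi> (mspace W) (mspace V)" unfolding \<psi>_def by (rule bij_betw_the_inv_into[OF \<phi>(1)])
    show "\<psi> (v + w) = \<psi> v + \<psi> w" if "v \<in> mspace W" "w \<in> mspace W" for v w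
      using ex[OF that(1)] ex[OF that(2)] assms(2) by (auto simp: \<psi> \<phi>(2)[symmetric])
    show "\<psi> (mscale W c v) = mscale V c (\<psi> v)" if "v \<in> mspace W" for c v
      using ex[OF that] assms(3) by (auto simp: \<psi> \<phi>(3)[symmetric])
    show "\<psi> (mact W i j v) = mact V i j (\<psi> v)" if "i < n" "j < n" "v \<in> mspace W" for i j v
      using ex[OF that(3)] that(1,2) assms(4) by (auto simp: \<psi> \<phi>(4)[symmetric])
  qed
qed

lemma gl_isomorphic_direct_sum:
  fixes V :: "'i \<Rightarrow> 'a::ab_group_add gl_module"
  assumes mods: "\<And>x. x \<in> I \<Longrightarrow> is_gl_module n (V x)"
    and iso: "\<And>x. x \<in> I \<Longrightarrow> gl_isomorphic n (V x) ((poly_module n)\<lparr>mspace := C x\<rparr>)"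
    and orth: "\<And>x y p q. x \<in> I \<Longrightarrow> y \<in> I \<Longrightarrow> x \<noteq> y \<Longrightarrow> p \<in> C x \<Longrightarrow> q \<in> C y \<Longrightarrow> fip p q = 0"
    and subC: "\<And>x. x \<in> I \<Longrightarrow> cs.subspace (C x)"
    and S: "cs.span (\<Union>x\<in>I. C x) = S"
  shows "gl_isomorphic n ((poly_module n)\<lparr>mspace := S\<rparr>) (direct_sum I V)"
\<comment> \<open>The explicit map leads out of the direct sum: it adds up the images of the
  components. Surjectivity is the spanning hypothesis, injectivity comes from orthogonality.\<close>
proof (rule gl_isomorphic_sym)
  let ?D = "direct_sum I V"
  have "\<exists>\<phi>. \<forall>x\<in>I. bij_betw (\<phi> x) (mspace (V x)) (C x) \<and>
     (\<forall>v\<in>mspace (V x). \<forall>w\<in>mspace (V x). \<phi> x (v + w) = \<phi> x v + \<phi> x w) \<and>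
     (\<forall>c. \<forall>v\<in>mspace (V x). \<phi> x (mscale (V x) c v) = cscale c (\<phi> x v)) \<and>
     (\<forall>i<n. \<forall>j<n. \<forall>v\<in>mspace (V x). \<phi> x (mact (V x) i j v) = poly_act n i j (\<phi> x v))"
    using iso unfolding gl_isomorphic_def by (intro bchoice) simp
  then obtain \<phi> where bij: "\<And>x. x \<in> I \<Longrightarrow> bij_betw (\<phi> x) (mspace (V x)) (C x)"
    and add: "\<And>x v w. x \<in> I \<Longrightarrow> v \<in> mspace (V x) \<Longrightarrow> w \<in> mspace (V x) \<Longrightarrow> \<phi> x (v + w) = \<phi> x v + \<phi> x w"
    and scale: "\<And>x c v. x \<in> I \<Longrightarrow> v \<in> mspace (V x) \<Longrightarrow> \<phi> x (mscale (V x) c v) = cscale c (\<phi> x v)"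
    and act: "\<And>x i j v. x \<in> I \<Longrightarrow> i < n \<Longrightarrow> j < n \<Longrightarrow> v \<in> mspace (V x) \<Longrightarrow>
      \<phi> x (mact (V x) i j v) = poly_act n i j (\<phi> x v)" by blast
  have rep: "gl_rep n (V x)" if "x \<in> I" for x using mods[OF that] by unfold_locales
  have \<phi>0: "\<phi> x 0 = 0" if "x \<in> I" for x
    using add[OF that gl_rep.mspace_zero[OF rep[OF that]] gl_rep.mspace_zero[OF rep[OF that]]] by simp
  have D: "f \<in> mspace ?D \<longleftrightarrow> Poly_Mapping.keys f \<subseteq> I \<and> (\<forall>x\<in>I. Poly_Mapping.lookup f x \<in> mspace (V x))" for f
    by (simp add: direct_sum_def)
  have scale0: "mscale (V x) c 0 = 0" if "x \<in> I" for x c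
  proof -
    interpret gl_rep n "V x" by (rule rep[OF that])
    show ?thesis by simp
  qed
  \<comment> \<open>\<open>mapp\<close> applies its function only at keys and leaves 0 elsewhere,
    which agrees with scaling everywhere because scaling fixes 0; \<open>Dact\<close> is the same
    for the action.\<close>
  have Dscale: "Poly_Mapping.lookup (mscale ?D c f) x = mscale (V x) c (Poly_Mapping.lookup f x)"
    if "x \<in> I" for f c x
    using scale0[OF that] by (auto simp: direct_sum_def mapp.rep_eq when_def in_keys_iff)
  have Dact: "Poly_Mapping.lookup (mact ?D i j f) x = mact (V x) i j (Poly_Mapping.lookup f x)"
    if "x \<in> I" "i < n" "j < n" for f i j x
    using gl_rep.act_zero[OF rep[OF that(1)] that(2,3)]
    by (auto simp: direct_sum_def mapp.rep_eq when_def in_keys_iff)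
  have keys_sub: "Poly_Mapping.keys (mscale ?D c f) \<subseteq> Poly_Mapping.keys f"
    "Poly_Mapping.keys (mact ?D i j f) \<subseteq> Poly_Mapping.keys f" for c f i j
    by (auto simp: direct_sum_def mapp.rep_eq when_def in_keys_iff split: if_splits)
  show D_add: "f + g \<in> mspace ?D" if "f \<in> mspace ?D" "g \<in> mspace ?D" for f g
    using that keys_add[of f g] gl_rep.mspace_add[OF rep] by (auto simp: D lookup_add)
  show D_scale: "mscale ?D c f \<in> mspace ?D" if "f \<in> mspace ?D" for c f
    using that keys_sub(1)[of c f] gl_rep.mspace_scale[OF rep] by (auto simp: D Dscale)
  show D_act: "mact ?D i j f \<in> mspace ?D" if "i < n" "j < n" "f \<in> mspace ?D" for i j f
    using that keys_sub(2)[of i j f] gl_rep.act_closed[OF rep] by (auto simp: D Dact)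
  define \<psi> where "\<psi> f = (\<Sum>x\<in>Poly_Mapping.keys f. \<phi> x (Poly_Mapping.lookup f x))" for f
  have \<psi>: "\<psi> f = (\<Sum>x\<in>A. \<phi> x (Poly_Mapping.lookup f x))"
    if "finite A" "Poly_Mapping.keys f \<subseteq> A" "A \<subseteq> I" for f A
    unfolding \<psi>_def using that \<phi>0 by (intro sum.mono_neutral_left) (auto simp: in_keys_iff subset_iff)
  have \<phi>C: "\<phi> x v \<in> C x" if "x \<in> I" "v \<in> mspace (V x)" for x v
    using bij[OF that(1)] that(2) by (auto simp: bij_betw_def)
  have \<psi>_add: "\<psi> (f + g) = \<psi> f + \<psi> g" if "f \<in> mspace ?D" "g \<in> mspace ?D" for f g
  proof -
    let ?A = "Poly_Mapping.keys f \<union> Poly_Mapping.keys g"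
    have A: "finite ?A" "?A \<subseteq> I" using that by (auto simp: D)
    have "\<psi> (f + g) = (\<Sum>x\<in>?A. \<phi> x (Poly_Mapping.lookup (f + g) x))"
      using A keys_add[of f g] by (intro \<psi>)
    also have "\<dots> = (\<Sum>x\<in>?A. \<phi> x (Poly_Mapping.lookup f x)) + (\<Sum>x\<in>?A. \<phi> x (Poly_Mapping.lookup g x))"
      unfolding sum.distrib[symmetric] using that A by (intro sum.cong refl) (auto simp: lookup_add D intro!: add)
    also have "\<dots> = \<psi> f + \<psi> g" using A \<psi>[of ?A f] \<psi>[of ?A g] by simp
    finally show ?thesis .
  qed
  have \<psi>_scale: "\<psi> (mscale ?D c f) = cscale c (\<psi> f)" if "f \<in> mspace ?D" for c f
  proof -
    have "\<psi> (mscale ?D c f) = (\<Sum>x\<in>Poly_Mapping.keys f. \<phi> x (Poly_Mapping.lookup (mscale ?D c f) x))"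
      using that keys_sub by (intro \<psi>) (auto simp: D)
    also have "\<dots> = cscale c (\<psi> f)"
      unfolding \<psi>_def cs.scale_sum_right using that
      by (intro sum.cong refl) (auto simp: D Dscale scale subset_iff)
    finally show ?thesis .
  qed
  have \<psi>_act: "\<psi> (mact ?D i j f) = poly_act n i j (\<psi> f)" if "i < n" "j < n" "f \<in> mspace ?D" for i j f
  proof -
    have "\<psi> (mact ?D i j f) = (\<Sum>x\<in>Poly_Mapping.keys f. \<phi> x (Poly_Mapping.lookup (mact ?D i j f) x))"
      using that keys_sub by (intro \<psi>) (auto simp: D)
    also have "\<dots> = poly_act n i j (\<psi> f)"
      unfolding \<psi>_def poly_act_sum using that
      by (intro sum.cong refl) (auto simp: D Dact act subset_iff)
    finally show ?thesis .
  qed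
  have \<psi>_single: "\<psi> (Poly_Mapping.single x v) = \<phi> x v \<and> Poly_Mapping.single x v \<in> mspace ?D"
    if "x \<in> I" "v \<in> mspace (V x)" for x v
  proof
    show "\<psi> (Poly_Mapping.single x v) = \<phi> x v"
      using that by (subst \<psi>[of "{x}"]) auto
    show "Poly_Mapping.single x v \<in> mspace ?D"
      using that gl_rep.mspace_zero[OF rep] by (auto simp: D lookup_single when_def split: if_splits)
  qed
  have "inj_on \<psi> (mspace ?D)"
  proof (rule inj_onI)
    fix f g assume fg: "f \<in> mspace ?D" "g \<in> mspace ?D" "\<psi> f = \<psi> g"
    let ?A = "Poly_Mapping.keys f \<union> Poly_Mapping.keys g"
    let ?d = "\<lambda>x. \<phi> x (Poly_Mapping.lookup f x) - \<phi> x (Poly_Mapping.lookup g x)"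
    have A: "finite ?A" "?A \<subseteq> I" using fg by (auto simp: D)
    have "\<psi> f - \<psi> g = (\<Sum>x\<in>?A. ?d x)" using A \<psi>[of ?A f] \<psi>[of ?A g] by (simp add: sum_subtractf)
    hence sum0: "(\<Sum>x\<in>?A. ?d x) = 0" using fg(3) by simp
    have dC: "?d x \<in> C x" if "x \<in> I" for x
      using that fg by (intro cs.subspace_diff[OF subC] \<phi>C) (auto simp: D)
    \<comment> \<open>Pairing the vanishing sum with its own summand at \<open>y\<close> leaves the
      squared norm of that summand.\<close>
    have d0: "?d y = 0" if y: "y \<in> ?A" for y
    proof -
      have "0 = fip (\<Sum>x\<in>?A. ?d x) (?d y)" using sum0 by simp
      also have "\<dots> = (\<Sum>x\<in>?A. if x = y then fip (?d y) (?d y) else 0)"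
        unfolding fip_sum_left
      proof (intro sum.cong refl)
        fix x assume x: "x \<in> ?A"
        show "fip (?d x) (?d y) = (if x = y then fip (?d y) (?d y) else 0)"
          using orth[of x y "?d x" "?d y"] dC x y A(2) by auto
      qed
      also have "\<dots> = fip (?d y) (?d y)" using A y by simp
      finally show ?thesis by (simp add: fip_self_eq_0_iff)
    qed
    show "f = g"
    proof (rule poly_mapping_eqI)
      fix y
      show "Poly_Mapping.lookup f y = Poly_Mapping.lookup g y"
      proof (cases "y \<in> ?A")
        case True
        hence "\<phi> y (Poly_Mapping.lookup f y) = \<phi> y (Poly_Mapping.lookup g y)" using d0[OF True] by simp
        moreover have "inj_on (\<phi> y) (mspace (V y))" using bij True A(2) by (auto simp: bij_betw_def)
        ultimately show ?thesis using fg True A(2) by (auto simp: D inj_on_def)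
      qed (simp add: in_keys_iff)
    qed
  qed
  moreover have "\<psi> ` mspace ?D = S"
  proof
    have "\<psi> f \<in> S" if f: "f \<in> mspace ?D" for f
      unfolding \<psi>_def S[symmetric]
    proof (intro cs.span_sum cs.span_base UN_I)
      fix x assume "x \<in> Poly_Mapping.keys f"
      thus "x \<in> I" using f by (auto simp: D)
      thus "\<phi> x (Poly_Mapping.lookup f x) \<in> C x" using f by (intro \<phi>C) (auto simp: D)
    qed
    thus "\<psi> ` mspace ?D \<subseteq> S" by blast
    show "S \<subseteq> \<psi> ` mspace ?D" unfolding S[symmetric]
    proof (rule cs.span_minimal)
      show "cs.subspace (\<psi> ` mspace ?D)"
      proof (rule cs.subspaceI)
        have "(0 :: 'i \<Rightarrow>\<^sub>0 'a) \<in> mspace ?D" using gl_rep.mspace_zero[OF rep] by (auto simp: D)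
        moreover have "\<psi> 0 = 0" by (simp add: \<psi>_def)
        ultimately show "0 \<in> \<psi> ` mspace ?D" by (metis image_eqI)
        show "x + y \<in> \<psi> ` mspace ?D" if xy: "x \<in> \<psi> ` mspace ?D" "y \<in> \<psi> ` mspace ?D" for x y
        proof -
          obtain f g where "f \<in> mspace ?D" "x = \<psi> f" "g \<in> mspace ?D" "y = \<psi> g" using xy by blast
          thus ?thesis using \<psi>_add D_add by (metis image_eqI)
        qed
        show "cscale c x \<in> \<psi> ` mspace ?D" if x: "x \<in> \<psi> ` mspace ?D" for c x
        proof -
          obtain f where "f \<in> mspace ?D" "x = \<psi> f" using x by blast
          thus ?thesis using \<psi>_scale D_scale by (metis image_eqI)
        qed
      qed
      show "(\<Union>x\<in>I. C x) \<subseteq> \<psi> ` mspace ?D"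
      proof
        fix p assume "p \<in> (\<Union>x\<in>I. C x)"
        then obtain x where x: "x \<in> I" "p \<in> C x" by blast
        then obtain v where "v \<in> mspace (V x)" "p = \<phi> x v" using bij[OF x(1)] by (auto simp: bij_betw_def)
        thus "p \<in> \<psi> ` mspace ?D" using \<psi>_single[OF x(1)] by (metis image_eqI)
      qed
    qed
  qed
  ultimately have "bij_betw \<psi> (mspace ?D) (mspace ((poly_module n)\<lparr>mspace := S\<rparr>))" by (simp add: bij_betw_def)
  thus "gl_isomorphic n ?D ((poly_module n)\<lparr>mspace := S\<rparr>)"
    unfolding gl_isomorphic_def by (intro exI[of _ \<psi>]) (auto simp: \<psi>_add \<psi>_scale \<psi>_act)
qed

text \<open>Numbering the basis by \<open>k < cs.dim H\<close> provides the index of the copies of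
  one irreducible module in the direct sum.\<close>

lemma orthogonal_basis_family:
  assumes "cs.subspace H" "finite A" "H \<subseteq> {p. Poly_Mapping.keys p \<subseteq> A}"
  shows "\<exists>w :: nat \<Rightarrow> 'v mpoly. cs.span (w ` {..<cs.dim H}) = H \<and> (\<forall>k<cs.dim H. w k \<noteq> 0) \<and>
    (\<forall>k<cs.dim H. \<forall>k'<cs.dim H. k \<noteq> k' \<longrightarrow> fip (w k) (w k') = 0)"
proof -
  obtain B where B: "finite B" "cs.span B = H" by (rule subspace_finite_basis[OF assms])
  obtain C where C: "finite C" "0 \<notin> C" "cs.span C = H" "\<And>x y. x \<in> C \<Longrightarrow> y \<in> C \<Longrightarrow> x \<noteq> y \<Longrightarrow> fip x y = 0"
    using orthogonal_basis_exists[OF B(1)] B(2) by metis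
  have "cs.dim H = card C"
    using cs.dim_span_eq_card_independent[OF orthogonal_independent[OF C(2,4)]] C(3) by simp
  moreover obtain w where "bij_betw w {..<card C} C"
    using ex_bij_betw_nat_finite[OF C(1)] by (auto simp: atLeast0LessThan)
  moreover from this have "w k \<in> C" if "k < card C" for k using that by (auto simp: bij_betw_def)
  moreover have "w k \<noteq> w k'" if "bij_betw w {..<card C} C" "k < card C" "k' < card C" "k \<noteq> k'" for k k'
    using that by (auto simp: bij_betw_def inj_on_def)
  ultimately show ?thesis
    using C by (intro exI[of _ w]) (auto simp: bij_betw_def)
qed

text \<open>If the modules generated by the chosen vectors did not exhaust \<open>S\<close>, the
  complement of their span \<open>U\<close> in \<open>S\<close> would contain a highest weight
  vector of some weight \<mu>. That vector lies in the span of the basis \<open>w \<mu>\<close>,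
  hence in \<open>U\<close>, and would be orthogonal to itself.\<close>

lemma complete_reducibility:
  fixes \<M> :: "nat list \<Rightarrow> 'b::ab_group_add gl_module"
  assumes S: "is_submodule n (poly_module n) S" and Sc: "S \<subseteq> col_space n l"
    and irreps: "\<And>\<mu>. is_partition \<mu> (n * l) \<Longrightarrow> length \<mu> \<le> n \<Longrightarrow> irreducible_hw_module n (\<M> \<mu>) \<mu>"
    and r: "\<And>\<mu>. is_partition \<mu> (n * l) \<Longrightarrow> length \<mu> \<le> n \<Longrightarrow>
      r \<mu> = cs.dim (hw_vectors n (poly_module n) \<mu> \<inter> S)"
  shows "gl_isomorphic n ((poly_module n)\<lparr>mspace := S\<rparr>)
    (direct_sum {(\<mu>, k). is_partition \<mu> (n * l) \<and> length \<mu> \<le> n \<and> k < r \<mu>} (\<lambda>(\<mu>, k). \<M> \<mu>))"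
proof -
  let ?P = "poly_module n"
  let ?I = "{(\<mu>, k). is_partition \<mu> (n * l) \<and> length \<mu> \<le> n \<and> k < r \<mu>}"
  define H where "H \<mu> = hw_vectors n ?P \<mu> \<inter> S" for \<mu>
  have Sk: "S \<subseteq> {p. Poly_Mapping.keys p \<subseteq> col_monomials n l}" using Sc by (simp add: col_space_def)
  have "\<exists>w. cs.span (w ` {..<cs.dim (H \<mu>)}) = H \<mu> \<and> (\<forall>k<cs.dim (H \<mu>). w k \<noteq> 0) \<and>
    (\<forall>k<cs.dim (H \<mu>). \<forall>k'<cs.dim (H \<mu>). k \<noteq> k' \<longrightarrow> fip (w k) (w k') = 0)" for \<mu>
    using Sk by (intro orthogonal_basis_family[OF _ finite_col_monomials[of n l]])
      (auto simp: H_def cs.subspace_inter subspace_hw_vectors pm_subspace[OF S])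
  then obtain w where w: "\<And>\<mu>. cs.span (w \<mu> ` {..<cs.dim (H \<mu>)}) = H \<mu>"
    "\<And>\<mu> k. k < cs.dim (H \<mu>) \<Longrightarrow> w \<mu> k \<noteq> 0"
    "\<And>\<mu> k k'. k < cs.dim (H \<mu>) \<Longrightarrow> k' < cs.dim (H \<mu>) \<Longrightarrow> k \<noteq> k' \<Longrightarrow> fip (w \<mu> k) (w \<mu> k') = 0"
    by metis
  define C where "C = (\<lambda>(\<mu>, k). mspace (cyclic_submodule n ?P (w \<mu> k)))"
  have wH: "w \<mu> k \<in> hw_vectors n ?P \<mu>" "w \<mu> k \<in> S" "w \<mu> k \<noteq> 0" if "(\<mu>, k) \<in> ?I" for \<mu> k
  proof -
    have k: "k < cs.dim (H \<mu>)" using that r by (auto simp: H_def)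
    hence "w \<mu> k \<in> H \<mu>" using w(1)[of \<mu>] cs.span_base[of "w \<mu> k" "w \<mu> ` {..<cs.dim (H \<mu>)}"] by auto
    thus "w \<mu> k \<in> hw_vectors n ?P \<mu>" "w \<mu> k \<in> S" by (auto simp: H_def)
    show "w \<mu> k \<noteq> 0" by (rule w(2)[OF k])
  qed
  have Csub: "is_submodule n ?P (C x)" if x: "x \<in> ?I" for x
  proof -
    obtain \<mu> k where xk: "x = (\<mu>, k)" by (cases x)
    show ?thesis unfolding C_def xk prod.case
      using wH(1)[OF x[unfolded xk]] by (intro pm.cyclic_submodule_is_submodule pm.hw_vectorsD(1))
  qed
  have CS: "C x \<subseteq> S" if x: "x \<in> ?I" for x
  proof -
    obtain \<mu> k where xk: "x = (\<mu>, k)" by (cases x)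
    show ?thesis unfolding C_def xk prod.case
      by (rule pm.cyclic_submodule_least[OF S wH(2)[OF x[unfolded xk]]])
  qed
  have C_iso: "gl_isomorphic n (case x of (\<mu>, k) \<Rightarrow> \<M> \<mu>) (?P\<lparr>mspace := C x\<rparr>)" if x: "x \<in> ?I" for x
  proof -
    obtain \<mu> k where xk: "x = (\<mu>, k)" by (cases x)
    note x' = x[unfolded xk]
    have eq: "?P\<lparr>mspace := C x\<rparr> = cyclic_submodule n ?P (w \<mu> k)"
      unfolding C_def xk prod.case by (simp add: cyclic_submodule_def)
    have "irreducible_hw_module n (cyclic_submodule n ?P (w \<mu> k)) \<mu>"
      using CS[OF x] Sk wH[OF x'] xk
      by (intro cyclic_hw_irreducible[OF _ _ finite_col_monomials[of n l]]) (auto simp: C_def)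
    moreover have "irreducible_hw_module n (\<M> \<mu>) \<mu>" using irreps x' by auto
    ultimately show ?thesis unfolding eq unfolding xk by (auto intro: irreducible_hw_modules_isomorphic)
  qed
  have C_orth: "fip p q = 0"
    if xy: "x \<in> ?I" "y \<in> ?I" "x \<noteq> y" and pq: "p \<in> C x" "q \<in> C y" for x y p q
  proof -
    obtain \<mu> k \<nu> k' where xk: "x = (\<mu>, k)" "y = (\<nu>, k')" by (cases x, cases y)
    note x' = xy(1)[unfolded xk] and y' = xy(2)[unfolded xk]
    have "fip (w \<mu> k) (w \<nu> k') = 0"
    proof (cases "\<mu> = \<nu>")
      case True
      thus ?thesis using xy(3) xk x' y' r w(3)[of k \<mu> k'] by (auto simp: H_def)
    next
      case False
      \<comment> \<open>A weight sees the first \<open>n\<close> entries only; they tell the two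
        partitions apart because neither has more than \<open>n\<close> parts.\<close>
      have "\<exists>i<n. part \<mu> i \<noteq> part \<nu> i"
        using False part_inj[of \<mu> \<nu> n] x' y' by (auto simp: is_partition_def)
      thus ?thesis using hw_vectors_orthogonal[OF wH(1)[OF x'] wH(1)[OF y']] by blast
    qed
    thus ?thesis
      using hw_vector_orthogonal_cyclic[OF wH(1)[OF x'] wH(1)[OF y']] pq by (auto simp: C_def xk)
  qed
  define U where "U = cs.span (\<Union>x\<in>?I. C x)"
  have US: "U \<subseteq> S" unfolding U_def using CS by (intro cs.span_minimal pm_subspace[OF S]) blast
  have U: "is_submodule n ?P U"
    unfolding is_submodule_def mscale_poly
  proof (intro conjI allI impI ballI)
    show "U \<subseteq> mspace ?P" using US pm.is_submoduleD(1)[OF S] by blast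
    show "cs.subspace U" by (simp add: U_def)
    show "poly_act n i j x \<in> U" if ij: "i < n" "j < n" and x: "x \<in> U" for i j x
      unfolding U_def
    proof (rule pm.act_span_closed[unfolded mscale_poly])
      show "(\<Union>x\<in>?I. C x) \<subseteq> mspace ?P" using CS pm.is_submoduleD(1)[OF S] by blast
      show "poly_act n i j y \<in> cs.span (\<Union>x\<in>?I. C x)" if "y \<in> (\<Union>x\<in>?I. C x)" for y
        using that pm.is_submoduleD(3)[OF Csub ij] by (intro cs.span_base) blast
    qed (use ij x in \<open>simp_all add: U_def\<close>)
  qed
  have "S \<subseteq> U"
  proof
    fix s assume s: "s \<in> S"
    obtain u where u: "u \<in> U" "\<And>y. y \<in> U \<Longrightarrow> fip (s - u) y = 0"
      using orthogonal_projection[OF pm_subspace[OF U] finite_col_monomials[of n l] order_trans[OF US Sk]] by blast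
    let ?K = "{x \<in> S. \<forall>y\<in>U. fip x y = 0}"
    have K: "is_submodule n ?P ?K" by (rule orthogonal_complement_submodule[OF U S])
    have "?K = {0}"
    proof (rule ccontr)
      assume "?K \<noteq> {0}"
      then obtain \<mu> v where \<mu>: "is_partition \<mu> (n * l)" "length \<mu> \<le> n"
        and v: "v \<in> hw_vectors n ?P \<mu>" "v \<in> ?K" "v \<noteq> 0"
        using hw_vector_exists[OF K, of l] Sc by blast
      have "v \<in> cs.span (w \<mu> ` {..<cs.dim (H \<mu>)})" using v w(1) by (simp add: H_def)
      also have "\<dots> \<subseteq> U"
      proof (rule cs.span_minimal[OF _ pm_subspace[OF U]])
        show "w \<mu> ` {..<cs.dim (H \<mu>)} \<subseteq> U"
        proof
          fix y assume "y \<in> w \<mu> ` {..<cs.dim (H \<mu>)}"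
          then obtain k where k: "y = w \<mu> k" "k < cs.dim (H \<mu>)" by blast
          have "(\<mu>, k) \<in> ?I" using k \<mu> r[OF \<mu>] by (simp add: H_def)
          moreover have "y \<in> C (\<mu>, k)" unfolding C_def k(1) by (simp add: pm.cyclic_submodule_contains)
          ultimately show "y \<in> U" unfolding U_def by (intro cs.span_base) blast
        qed
      qed
      finally have "fip v v = 0" using v(2) by blast
      thus False using v(3) by (simp add: fip_self_eq_0_iff)
    qed
    moreover have "s - u \<in> ?K" using u s US cs.subspace_diff[OF pm_subspace[OF S]] by blast
    ultimately have "s - u = 0" by blast
    thus "s \<in> U" using u(1) by simp
  qed
  hence "cs.span (\<Union>x\<in>?I. C x) = S" using US by (auto simp: U_def)
  thus ?thesis
    using irreps C_iso C_orth pm_subspace[OF Csub]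
    by (intro gl_isomorphic_direct_sum[of _ n _ C]) (auto simp: irreducible_hw_module_def)
qed

section \<open>The rank of the transition matrix\<close>

text \<open>The map \<open>\<kappa>\<close> sends a coordinate vector to the corresponding
  combination of the \<open>y i\<close>. It is linear and injective, so it preserves independence in
  both directions and carries a maximal independent set of columns, whose size is the rank, to a
  basis of the span on the right.\<close>

lemma rank_eq_dim:
  fixes y :: "nat \<Rightarrow> 'k \<Rightarrow>\<^sub>0 complex"
  assumes F: "F \<in> carrier_mat K nc" and inj: "inj_on y {..<K}" and indep: "cs.independent (y ` {..<K})"
  shows "vec_space.rank K F = cs.dim ((\<lambda>j. \<Sum>i<K. cscale (F $$ (i, j)) (y i)) ` {..<nc})"
proof -
  interpret vs: vec_space "TYPE(complex)" K .
  define \<kappa> where "\<kappa> v = (\<Sum>i<K. cscale (v $ i) (y i))" for v :: "complex vec"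
  have \<kappa>0: "v = 0\<^sub>v K" if v: "v \<in> carrier_vec K" and "\<kappa> v = 0" for v
  proof (rule eq_vecI)
    let ?u = "\<lambda>w. v $ the_inv_into {..<K} y w"
    have "(\<Sum>w\<in>y ` {..<K}. cscale (?u w) w) = \<kappa> v"
      unfolding \<kappa>_def sum.reindex[OF inj] by (intro sum.cong refl) (simp add: the_inv_into_f_f[OF inj])
    hence sum0: "(\<Sum>w\<in>y ` {..<K}. cscale (?u w) w) = 0" using \<open>\<kappa> v = 0\<close> by simp
    fix i assume "i < dim_vec (0\<^sub>v K :: complex vec)"
    hence i: "i < K" by simp
    hence "?u (y i) = 0" by (intro cs.independentD[OF indep _ subset_refl sum0]) auto
    thus "v $ i = 0\<^sub>v K $ i" using i by (simp add: the_inv_into_f_f[OF inj])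
  qed (use v in simp)
  have \<kappa>_inj: "inj_on \<kappa> (carrier_vec K)"
  proof (rule inj_onI)
    fix u v assume uv: "u \<in> carrier_vec K" "v \<in> carrier_vec K" "\<kappa> u = \<kappa> v"
    have "\<kappa> (u - v) = \<kappa> u - \<kappa> v"
      unfolding \<kappa>_def sum_subtractf[symmetric] using uv
      by (intro sum.cong refl) (simp add: cs.scale_left_diff_distrib)
    hence d: "u - v = 0\<^sub>v K" using uv by (intro \<kappa>0) auto
    show "u = v"
    proof (rule eq_vecI)
      fix i assume i: "i < dim_vec v"
      hence "(u - v) $ i = u $ i - v $ i" by simp
      moreover have "(u - v) $ i = 0" using d uv i by simp
      ultimately show "u $ i = v $ i" by simp
    qed (use uv in auto)
  qed
  have \<kappa>_lincomb: "\<kappa> (vs.lincomb a X) = (\<Sum>x\<in>X. cscale (a x) (\<kappa> x))" if X: "X \<subseteq> carrier_vec K" for a X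
  proof -
    have "\<kappa> (vs.lincomb a X) = (\<Sum>i<K. \<Sum>x\<in>X. cscale (a x * x $ i) (y i))"
      unfolding \<kappa>_def using X by (intro sum.cong refl) (simp add: vs.lincomb_index cs.scale_sum_left)
    also have "\<dots> = (\<Sum>x\<in>X. cscale (a x) (\<kappa> x))"
      unfolding \<kappa>_def by (subst sum.swap) (simp add: cs.scale_sum_right)
    finally show ?thesis .
  qed
  have lin_indpt_iff: "vs.lin_indpt X \<longleftrightarrow> cs.independent (\<kappa> ` X)" if X: "finite X" "X \<subseteq> carrier_vec K" for X
  proof -
    have injX: "inj_on \<kappa> X" by (rule inj_on_subset[OF \<kappa>_inj X(2)])
    show ?thesis
    proof
      assume ind: "vs.lin_indpt X"
      show "cs.independent (\<kappa> ` X)"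
      proof
        assume "cs.dependent (\<kappa> ` X)"
        then obtain u x where u: "x \<in> X" "u (\<kappa> x) \<noteq> 0" "(\<Sum>w\<in>\<kappa> ` X. cscale (u w) w) = 0"
          using cs.dependent_finite[of "\<kappa> ` X"] X(1) by auto
        have "\<kappa> (vs.lincomb (\<lambda>x. u (\<kappa> x)) X) = 0"
          unfolding \<kappa>_lincomb[OF X(2)] using u(3) by (simp add: sum.reindex[OF injX])
        moreover have "vs.lincomb (\<lambda>x. u (\<kappa> x)) X \<in> carrier_vec K"
          by (rule carrier_vecI[OF vs.lincomb_dim[OF X]])
        ultimately have "vs.lincomb (\<lambda>x. u (\<kappa> x)) X = 0\<^sub>v K" by (intro \<kappa>0)
        hence "vs.lin_dep X" unfolding vs.lin_dep_def
          using X(1) u(1,2) by (intro exI[of _ X] exI[of _ "\<lambda>x. u (\<kappa> x)"] exI[of _ x] conjI)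
            (simp_all add: class_ring_simps module_vec_simps)
        thus False using ind by blast
      qed
    next
      assume ind: "cs.independent (\<kappa> ` X)"
      show "vs.lin_indpt X"
      proof
        assume "vs.lin_dep X"
        then obtain a x where a: "vs.lincomb a X = 0\<^sub>v K" "x \<in> X" "a x \<noteq> 0"
          using vs.finite_lin_dep[OF X(1)] X(2)
          by (simp add: class_ring_simps module_vec_simps) blast
        let ?u = "\<lambda>w. a (the_inv_into X \<kappa> w)"
        have "(\<Sum>w\<in>\<kappa> ` X. cscale (?u w) w) = (\<Sum>x\<in>X. cscale (a x) (\<kappa> x))"
          unfolding sum.reindex[OF injX] by (intro sum.cong refl) (simp add: the_inv_into_f_f[OF injX])
        also have "\<dots> = \<kappa> (0\<^sub>v K)" using \<kappa>_lincomb[OF X(2), of a] a(1) by simp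
        also have "\<dots> = 0" by (simp add: \<kappa>_def)
        finally have "(\<Sum>w\<in>\<kappa> ` X. cscale (?u w) w) = 0" .
        hence "?u (\<kappa> x) = 0" using X(1) a(2) by (intro cs.independentD[OF ind _ subset_refl]) auto
        thus False using a by (simp add: the_inv_into_f_f[OF injX])
      qed
    qed
  qed
  let ?C = "set (cols F)"
  have C: "finite ?C" "?C \<subseteq> carrier_vec K" using cols_dim[of F] F by auto
  obtain B where B: "maximal B (\<lambda>T. T \<subseteq> ?C \<and> vs.lin_indpt T)"
    using maximal_exists_superset[OF C(1), of "\<lambda>T. T \<subseteq> ?C \<and> vs.lin_indpt T" "{}"] lin_indpt_iff[of "{}"] cs.independent_empty by auto
  have BC: "B \<subseteq> ?C" and Bind: "vs.lin_indpt B"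
    and Bmax: "\<And>T. B \<subseteq> T \<Longrightarrow> T \<subseteq> ?C \<Longrightarrow> vs.lin_indpt T \<Longrightarrow> T = B"
    using B by (auto simp: maximal_def)
  have Bfin: "finite B" "B \<subseteq> carrier_vec K" using BC C finite_subset by auto
  have \<kappa>B: "cs.independent (\<kappa> ` B)" using lin_indpt_iff[OF Bfin] Bind by simp
  have "\<kappa> c \<in> cs.span (\<kappa> ` B)" if c: "c \<in> ?C" for c
  proof (rule ccontr)
    assume nin: "\<kappa> c \<notin> cs.span (\<kappa> ` B)"
    hence "cs.independent (\<kappa> ` insert c B)" using cs.independent_insertI[OF nin \<kappa>B] by simp
    hence "vs.lin_indpt (insert c B)" using lin_indpt_iff[of "insert c B"] Bfin c C by auto
    hence "insert c B = B" using BC c by (intro Bmax) auto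
    thus False using nin cs.span_base[of "\<kappa> c" "\<kappa> ` B"] by auto
  qed
  hence "cs.span (\<kappa> ` B) = cs.span (\<kappa> ` ?C)"
    using cs.span_mono[OF image_mono[OF BC], of \<kappa>]
      cs.span_minimal[of "\<kappa> ` ?C" "cs.span (\<kappa> ` B)"] by auto
  hence "cs.dim (\<kappa> ` ?C) = card (\<kappa> ` B)"
    using cs.dim_span_eq_card_independent[OF \<kappa>B] by simp
  also have "\<dots> = card B" by (rule card_image[OF inj_on_subset[OF \<kappa>_inj Bfin(2)]])
  also have "\<dots> = vec_space.rank K F" using vs.rank_card_indpt[OF F B] by simp
  finally have "vec_space.rank K F = cs.dim (\<kappa> ` ?C)" by simp
  also have "\<kappa> ` ?C = (\<lambda>j. \<Sum>i<K. cscale (F $$ (i, j)) (y i)) ` {..<nc}"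
  proof -
    have "\<kappa> (col F j) = (\<Sum>i<K. cscale (F $$ (i, j)) (y i))" if "j < nc" for j
      unfolding \<kappa>_def using F that by (intro sum.cong refl) auto
    moreover have "?C = col F ` {..<nc}" using F by (auto simp: cols_def atLeast0LessThan)
    ultimately show ?thesis by (auto simp: image_iff)
  qed
  finally show ?thesis .
qed

section \<open>The tensor space in terms of polynomials\<close>

definition column_list :: "nat \<Rightarrow> (nat \<times> nat \<Rightarrow>\<^sub>0 nat) \<Rightarrow> (nat \<Rightarrow>\<^sub>0 nat) list" where
  "column_list n m = tensor_exponents n (mat_of n m)"

definition tensor_of :: "nat \<Rightarrow> (nat \<times> nat) mpoly \<Rightarrow> tensor" where
  "tensor_of n = lin_ext (\<lambda>m. Poly_Mapping.single (column_list n m) 1)"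

lemma linear_tensor_of: "Vector_Spaces.linear cscale cscale (tensor_of n)"
  unfolding tensor_of_def by (rule linear_lin_ext)

lemma tensor_of_single: "tensor_of n (Poly_Mapping.single m 1) = Poly_Mapping.single (column_list n m) 1"
  by (simp add: tensor_of_def)

lemma length_column_list: "length (column_list n m) = n"
  by (simp add: column_list_def tensor_exponents_def)

lemma lookup_column_list:
  "k < n \<Longrightarrow> Poly_Mapping.lookup (column_list n m ! k) i = (if i < n then Poly_Mapping.lookup m (i, k) else 0)"
proof -
  assume k: "k < n"
  have "Poly_Mapping.lookup (column_list n m ! k) i = (\<Sum>a<n. if a = i then Poly_Mapping.lookup m (i, k) else 0)"
    using k unfolding column_list_def tensor_exponents_def mat_of_def
    by (simp add: lookup_sum lookup_single when_def cong: if_cong)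
  thus ?thesis by simp
qed

lemma mat_of_col_sum: "m \<in> col_monomials n l \<Longrightarrow> mat_of n m \<in> col_sum_matrices n l"
  by (auto simp: col_monomials_def col_sum_matrices_def mat_of_def)

lemma linear_Phi: "Vector_Spaces.linear cscale cscale (Phi n l \<alpha>)"
  unfolding Phi_def
  by (unfold_locales) (auto simp: lookup_add cs.scale_left_distrib sum.distrib cs.scale_sum_right)

lemma Phi_tensor_of:
  assumes "p \<in> col_space n l"
  shows "Phi n l \<alpha> (tensor_of n p) = T_map n l \<alpha> p"
proof (rule linear_agree[OF linear_cscale_compose[OF linear_Phi linear_tensor_of] linear_T_map])
  fix m assume "m \<in> Poly_Mapping.keys p"
  hence "m \<in> col_monomials n l" using assms by (auto simp: col_space_def)
  thus "Phi n l \<alpha> (tensor_of n (Poly_Mapping.single m 1)) = T_map n l \<alpha> (Poly_Mapping.single m 1)"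
    using Phi_basis_tensor[OF mat_of_col_sum, of m n l \<alpha>]
    by (simp add: tensor_of_single T_map_single column_list_def basis_tensor_eq)
qed

text \<open>Followed by \<open>Phi n l 0\<close> the map becomes \<open>T_map n l 0\<close>, which
  is injective on \<open>col_space n l\<close>.\<close>

lemma tensor_of_inj: "inj_on (tensor_of n) (col_space n l)"
proof (rule inj_onI)
  fix p q assume pq: "p \<in> col_space n l" "q \<in> col_space n l" "tensor_of n p = tensor_of n q"
  hence "T_map n l 0 p = T_map n l 0 q" by (metis Phi_tensor_of)
  thus "p = q" using T_map_0_bij pq by (auto simp: bij_betw_def inj_on_def)
qed

lemma tensor_of_image:
  "tensor_of n ` col_space n l = {t. Poly_Mapping.keys t \<subseteq> column_list n ` col_monomials n l}"
proof -
  interpret Vector_Spaces.linear cscale cscale "tensor_of n" by (rule linear_tensor_of)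
  have "tensor_of n ` col_space n l = cs.span (tensor_of n ` (\<lambda>m. Poly_Mapping.single m 1) ` col_monomials n l)"
    unfolding span_image poly_span_singles col_space_def ..
  also have "\<dots> = cs.span ((\<lambda>k. Poly_Mapping.single k 1) ` column_list n ` col_monomials n l)"
    by (simp add: image_image tensor_of_single)
  finally show ?thesis by (simp add: poly_span_singles)
qed

lemma pure_tensor_singles: "pure_tensor (map (\<lambda>m. Poly_Mapping.single m 1) ms) = Poly_Mapping.single ms 1"
  by (induction ms) simp_all

lemma pure_tensor_update:
  "k < length ms \<Longrightarrow> pure_tensor ((map (\<lambda>m. Poly_Mapping.single m 1) ms)[k := Poly_Mapping.single m c]) =
    Poly_Mapping.single (ms[k := m]) c"
proof (induction ms arbitrary: k)
  case (Cons m' ms)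
  show ?case
  proof (cases k)
    case 0
    thus ?thesis by (cases "c = 0") (simp_all add: pure_tensor_singles)
  next
    case (Suc k')
    thus ?thesis using Cons by (cases "c = 0") simp_all
  qed
qed simp

lemma keys_pure_tensor:
  "ms \<in> Poly_Mapping.keys (pure_tensor fs) \<Longrightarrow> list_all2 (\<lambda>m f. m \<in> Poly_Mapping.keys f) ms fs"
proof (induction fs arbitrary: ms)
  case (Cons f fs)
  have "Poly_Mapping.keys (pure_tensor (f # fs)) \<subseteq>
      (\<Union>m\<in>Poly_Mapping.keys f. \<Union>ms\<in>Poly_Mapping.keys (pure_tensor fs). {m # ms})"
    unfolding pure_tensor.simps
    by (intro order_trans[OF keys_sum] UN_mono order_refl) auto
  thus ?case using Cons by auto
qed (simp split: if_splits)

text \<open>A key of \<open>pure_tensor fs\<close> chooses from each factor a monomial of degree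
  \<open>l\<close>; read as columns, these monomials form an exponent matrix with column sums
  \<open>l\<close>. Conversely the basis tensors of such matrices are pure.\<close>

lemma mspace_sym_tensor_module: "mspace (sym_tensor_module n l) = tensor_of n ` col_space n l"
proof -
  have "cs.span {pure_tensor fs |fs. length fs = n \<and> set fs \<subseteq> Sym n l} = tensor_of n ` col_space n l"
  proof
    have "Poly_Mapping.keys (pure_tensor fs) \<subseteq> column_list n ` col_monomials n l"
      if fs: "length fs = n" "set fs \<subseteq> Sym n l" for fs
    proof
      fix ms assume "ms \<in> Poly_Mapping.keys (pure_tensor fs)"
      hence ms: "length ms = n" "\<And>k. k < n \<Longrightarrow> ms ! k \<in> Poly_Mapping.keys (fs ! k)"
        using keys_pure_tensor[of ms fs] fs by (auto simp: list_all2_conv_all_nth)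
      have S: "Poly_Mapping.keys (ms ! k) \<subseteq> {..<n}" "(\<Sum>i<n. Poly_Mapping.lookup (ms ! k) i) = l" if "k < n" for k
      proof -
        have "fs ! k \<in> Sym n l" using nth_mem[of k fs] fs that by blast
        thus "Poly_Mapping.keys (ms ! k) \<subseteq> {..<n}" "(\<Sum>i<n. Poly_Mapping.lookup (ms ! k) i) = l"
          using ms(2)[OF that] by (auto simp: Sym_def)
      qed
      define m where "m = (\<Sum>x\<in>{..<n} \<times> {..<n}. Poly_Mapping.single x (Poly_Mapping.lookup (ms ! snd x) (fst x)))"
      have lm: "Poly_Mapping.lookup m (i, j) = (if i < n \<and> j < n then Poly_Mapping.lookup (ms ! j) i else 0)" for i j
      proof -
        have "Poly_Mapping.lookup m (i, j) =
            (\<Sum>x\<in>{..<n} \<times> {..<n}. if x = (i, j) then Poly_Mapping.lookup (ms ! j) i else 0)"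
          unfolding m_def lookup_sum lookup_single by (intro sum.cong) (auto simp: when_def)
        thus ?thesis by simp
      qed
      have "m \<in> col_monomials n l"
        using S(2) by (auto simp: col_monomials_def lm in_keys_iff split: if_splits)
      moreover have "column_list n m = ms"
      proof (rule nth_equalityI)
        fix k assume "k < length (column_list n m)"
        hence k: "k < n" by (simp add: length_column_list)
        show "column_list n m ! k = ms ! k"
        proof (rule poly_mapping_eqI)
          fix i
          show "Poly_Mapping.lookup (column_list n m ! k) i = Poly_Mapping.lookup (ms ! k) i"
            using S(1)[OF k] k by (cases "i < n") (auto simp: lookup_column_list lm in_keys_iff subset_iff)
        qed
      qed (simp add: length_column_list ms)
      ultimately show "ms \<in> column_list n ` col_monomials n l" by blast
    qed
    moreover have "cs.subspace {t :: tensor. Poly_Mapping.keys t \<subseteq> column_list n ` col_monomials n l}"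
      unfolding poly_span_singles[symmetric] by simp
    ultimately show "cs.span {pure_tensor fs |fs. length fs = n \<and> set fs \<subseteq> Sym n l} \<subseteq> tensor_of n ` col_space n l"
      unfolding tensor_of_image by (intro cs.span_minimal) auto
  next
    have "Poly_Mapping.single (column_list n m) 1 \<in> {pure_tensor fs |fs. length fs = n \<and> set fs \<subseteq> Sym n l}"
      if m: "m \<in> col_monomials n l" for m
    proof -
      have "Poly_Mapping.single f 1 \<in> Sym n l" if f: "f \<in> set (column_list n m)" for f
      proof -
        obtain k where k: "k < n" "f = column_list n m ! k"
          using f by (auto simp: in_set_conv_nth length_column_list)
        show ?thesis using m k unfolding k(2)
          by (auto simp: Sym_def lookup_column_list in_keys_iff col_monomials_def split: if_splits)
      qed
      thus ?thesis
        by (intro CollectI exI[of _ "map (\<lambda>m. Poly_Mapping.single m 1) (column_list n m)"])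
          (auto simp: pure_tensor_singles length_column_list)
    qed
    hence "cs.span ((\<lambda>k. Poly_Mapping.single k 1) ` column_list n ` col_monomials n l) \<subseteq>
        cs.span {pure_tensor fs |fs. length fs = n \<and> set fs \<subseteq> Sym n l}"
      by (intro cs.span_mono) auto
    thus "tensor_of n ` col_space n l \<subseteq> cs.span {pure_tensor fs |fs. length fs = n \<and> set fs \<subseteq> Sym n l}"
      unfolding tensor_of_image poly_span_singles .
  qed
  thus ?thesis by (simp add: sym_tensor_module_def)
qed

lemma tensor_act_single:
  "tensor_act i j (Poly_Mapping.single ms 1) = (\<Sum>k<length ms. cscale (of_nat (Poly_Mapping.lookup (ms ! k) j))
     (Poly_Mapping.single (ms[k := Poly_Mapping.single i 1 + (ms ! k - Poly_Mapping.single j 1)]) 1))"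
proof -
  have "tensor_act i j (Poly_Mapping.single ms 1) = (\<Sum>k<length ms. pure_tensor
      ((map (\<lambda>m. Poly_Mapping.single m 1) ms)[k := sym_act i j (Poly_Mapping.single (ms ! k) 1)]))"
    by (simp add: tensor_act_def Let_def)
  also have "\<dots> = (\<Sum>k<length ms. cscale (of_nat (Poly_Mapping.lookup (ms ! k) j))
     (Poly_Mapping.single (ms[k := Poly_Mapping.single i 1 + (ms ! k - Poly_Mapping.single j 1)]) 1))"
    by (intro sum.cong refl) (simp add: sym_act_def partial_deriv_single Var_mult_single pure_tensor_update)
  finally show ?thesis .
qed

lemma linear_tensor_act: "Vector_Spaces.linear cscale cscale (tensor_act i j)"
proof -
  have "tensor_act i j = lin_ext (\<lambda>ms. let fs = map (\<lambda>m. Poly_Mapping.single m 1) ms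
      in \<Sum>k<length fs. pure_tensor (fs[k := sym_act i j (fs ! k)]))"
    by (rule ext) (simp add: tensor_act_def lin_ext_def)
  thus ?thesis by (simp add: linear_lin_ext)
qed

text \<open>The Leibniz rule over the tensor factors matches, term by term, the sum over the columns
  in the action on polynomials.\<close>

lemma tensor_of_act:
  assumes "i < n" "j < n"
  shows "tensor_of n (poly_act n i j p) = tensor_act i j (tensor_of n p)"
proof (rule linear_agree[OF linear_cscale_compose[OF linear_tensor_of linear_poly_act]
      linear_cscale_compose[OF linear_tensor_act linear_tensor_of]])
  fix m
  interpret Vector_Spaces.linear cscale cscale "tensor_of n" by (rule linear_tensor_of)
  have "column_list n (move i j k m) =
      (column_list n m)[k := Poly_Mapping.single i 1 + (column_list n m ! k - Poly_Mapping.single j 1)]"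
    if k: "k < n" for k
  proof (rule nth_equalityI)
    fix b assume "b < length (column_list n (move i j k m))"
    hence b: "b < n" by (simp add: length_column_list)
    show "column_list n (move i j k m) ! b =
      (column_list n m)[k := Poly_Mapping.single i 1 + (column_list n m ! k - Poly_Mapping.single j 1)] ! b"
    proof (rule poly_mapping_eqI)
      fix a
      show "Poly_Mapping.lookup (column_list n (move i j k m) ! b) a = Poly_Mapping.lookup
         ((column_list n m)[k := Poly_Mapping.single i 1 + (column_list n m ! k - Poly_Mapping.single j 1)] ! b) a"
        using assms k b by (auto simp: nth_list_update length_column_list lookup_column_list lookup_move
          lookup_add lookup_minus lookup_single when_def)
    qed
  qed (simp add: length_column_list)
  thus "tensor_of n (poly_act n i j (Poly_Mapping.single m 1)) =
      tensor_act i j (tensor_of n (Poly_Mapping.single m 1))"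
    unfolding poly_act_mono tensor_of_single tensor_act_single length_column_list
    using assms by (simp add: sum scale tensor_of_single lookup_column_list del: cscale_single)
qed

lemma hw_vectors_sym_tensor_module:
  "hw_vectors n (sym_tensor_module n l) \<mu> = tensor_of n ` (hw_vectors n (poly_module n) \<mu> \<inter> col_space n l)"
proof -
  interpret Vector_Spaces.linear cscale cscale "tensor_of n" by (rule linear_tensor_of)
  have sym: "mact (sym_tensor_module n l) = tensor_act" "mscale (sym_tensor_module n l) = cscale"
    by (simp_all add: sym_tensor_module_def)
  have iff: "tensor_of n p \<in> hw_vectors n (sym_tensor_module n l) \<mu> \<longleftrightarrow> p \<in> hw_vectors n (poly_module n) \<mu>"
    if p: "p \<in> col_space n l" for p
  proof -
    have inj: "tensor_of n x = tensor_of n y \<longleftrightarrow> x = y" if "x \<in> col_space n l" "y \<in> col_space n l" for x y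
      using inj_on_eq_iff[OF tensor_of_inj that] .
    have act: "poly_act n i j p \<in> col_space n l" if "i < n" "j < n" for i j
      by (rule pm.is_submoduleD(3)[OF col_space_submodule that p])
    have 1: "tensor_act i j (tensor_of n p) = 0 \<longleftrightarrow> poly_act n i j p = 0" if "i < n" "j < n" for i j
      using inj[OF act[OF that] cs.subspace_0[OF subspace_col_space]] tensor_of_act[OF that, of p] zero by simp
    have 2: "tensor_act i i (tensor_of n p) = cscale c (tensor_of n p) \<longleftrightarrow> poly_act n i i p = cscale c p"
      if "i < n" for i c
      using inj[OF act[OF that that] cs.subspace_scale[OF subspace_col_space p], of c]
        tensor_of_act[OF that that, of p] by (simp add: scale)
    have "tensor_of n p \<in> mspace (sym_tensor_module n l)" using p by (simp add: mspace_sym_tensor_module)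
    moreover have "p \<in> mspace (poly_module n)" using p pm.is_submoduleD(1)[OF col_space_submodule] by blast
    moreover have "(\<forall>i j. i < j \<and> j < n \<longrightarrow> tensor_act i j (tensor_of n p) = 0) \<longleftrightarrow>
        (\<forall>i j. i < j \<and> j < n \<longrightarrow> poly_act n i j p = 0)" using 1 by (meson less_trans)
    ultimately show ?thesis by (simp add: hw_vectors_def sym 2)
  qed
  have "hw_vectors n (sym_tensor_module n l) \<mu> \<subseteq> tensor_of n ` col_space n l"
    by (auto simp: hw_vectors_def mspace_sym_tensor_module)
  thus ?thesis using iff by blast
qed

text \<open>The images \<open>y i\<close> of the given basis under \<open>Phi n l 0\<close> form a
  basis of \<open>H\<close>, the highest weight vectors in \<open>col_space n l\<close>. The images
  under \<open>Phi n l \<alpha>\<close> lie in \<open>H\<close> as well, so they have unique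
  coordinates with respect to the \<open>y i\<close>. These coordinates are the columns of the
  matrix, and its rank is the dimension of the span of the images.\<close>

lemma rank_transition_matrix:
  assumes "is_basis_family cscale K v (hw_vectors n (sym_tensor_module n l) \<mu>)"
    and K: "K = kostka \<mu> (replicate n l)"
  shows "mat_rank (transition_matrix n l \<alpha> \<mu> v) =
    cs.dim (hw_vectors n (poly_module n) \<mu> \<inter> T_map n l \<alpha> ` col_space n l)"
proof -
  define H where "H = hw_vectors n (poly_module n) \<mu> \<inter> col_space n l"
  have v: "inj_on v {..<K}" "cs.independent (v ` {..<K})" "cs.span (v ` {..<K}) = tensor_of n ` H"
    using assms(1) by (auto simp: is_basis_family_def hw_vectors_sym_tensor_module H_def)
  have H: "H \<subseteq> col_space n l" by (auto simp: H_def)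
  have PhiH: "Phi n l \<beta> ` cs.span (v ` {..<K}) = T_map n l \<beta> ` H" for \<beta>
    unfolding v(3) image_image using H by (intro image_cong refl Phi_tensor_of) blast
  have span_Phi: "cs.span (Phi n l \<beta> ` v ` {..<K}) = T_map n l \<beta> ` H" for \<beta>
  proof -
    interpret Vector_Spaces.linear cscale cscale "Phi n l \<beta>" by (rule linear_Phi)
    show ?thesis unfolding span_image by (rule PhiH)
  qed
  \<comment> \<open>At parameter 0 the image of \<open>col_space n l\<close> is
    \<open>col_space n l\<close> itself, so the lifting lemma equates \<open>H\<close> with its own
    image.\<close>
  have T0H: "T_map n l 0 ` H = H"
    using hw_vectors_T_map[of n \<mu> l 0] T_map_0_bij[of n l] by (simp add: H_def bij_betw_def)
  define y where "y i = Phi n l 0 (v i)" for i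
  have y_img: "y ` {..<K} = Phi n l 0 ` v ` {..<K}" by (simp add: y_def image_image)
  have inj0: "inj_on (Phi n l 0) (cs.span (v ` {..<K}))"
    unfolding v(3)
  proof (rule inj_onI)
    fix s t assume "s \<in> tensor_of n ` H" "t \<in> tensor_of n ` H" and eq: "Phi n l 0 s = Phi n l 0 t"
    then obtain p q where pq: "p \<in> col_space n l" "q \<in> col_space n l" "s = tensor_of n p" "t = tensor_of n q"
      using H by blast
    have "T_map n l 0 p = T_map n l 0 q" using eq pq by (simp add: Phi_tensor_of)
    thus "s = t" using T_map_0_bij[of n l] pq by (auto simp: bij_betw_def inj_on_def)
  qed
  have y_inj: "inj_on y {..<K}"
    using comp_inj_on[OF v(1) inj_on_subset[OF inj0 cs.span_superset]] by (simp add: y_def[abs_def] o_def)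
  have y_indep: "cs.independent (y ` {..<K})"
  proof -
    interpret Vector_Spaces.linear cscale cscale "Phi n l 0" by (rule linear_Phi)
    show ?thesis unfolding y_img using dependent_inj_imageD[OF _ inj0] v(2) by blast
  qed
  have coeff: "a i = b i" if eq: "(\<Sum>i<K. cscale (a i) (y i)) = (\<Sum>i<K. cscale (b i) (y i))" and i: "i < K" for a b i
  proof -
    let ?u = "\<lambda>w. a (the_inv_into {..<K} y w) - b (the_inv_into {..<K} y w)"
    have "(\<Sum>w\<in>y ` {..<K}. cscale (?u w) w) = (\<Sum>i<K. cscale (a i) (y i)) - (\<Sum>i<K. cscale (b i) (y i))"
      unfolding sum.reindex[OF y_inj] sum_subtractf[symmetric]
      by (intro sum.cong refl) (simp add: the_inv_into_f_f[OF y_inj] cs.scale_left_diff_distrib)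
    hence "(\<Sum>w\<in>y ` {..<K}. cscale (?u w) w) = 0" using eq by simp
    from cs.independentD[OF y_indep _ subset_refl this, of "y i"] i
    show ?thesis by (simp add: the_inv_into_f_f[OF y_inj])
  qed
  have "\<exists>a. Phi n l \<alpha> (v j) = (\<Sum>i<K. cscale (a i) (y i))" if j: "j < K" for j
  proof -
    have "Phi n l \<alpha> (v j) \<in> T_map n l \<alpha> ` H"
      using j unfolding span_Phi[symmetric] by (intro cs.span_base) auto
    also have "\<dots> \<subseteq> H" using hw_vectors_T_map[of n \<mu> l \<alpha>] T_map_col_space by (auto simp: H_def)
    also have "H = cs.span (y ` {..<K})" unfolding y_img span_Phi T0H ..
    finally obtain u where "Phi n l \<alpha> (v j) = (\<Sum>w\<in>y ` {..<K}. cscale (u w) w)"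
      using cs.span_finite[of "y ` {..<K}"] by auto
    thus ?thesis by (intro exI[of _ "\<lambda>i. u (y i)"]) (simp add: sum.reindex[OF y_inj])
  qed
  then obtain a where a: "\<And>j. j < K \<Longrightarrow> Phi n l \<alpha> (v j) = (\<Sum>i<K. cscale (a j i) (y i))" by metis
  define F where "F = mat K K (\<lambda>(i, j). a j i)"
  have F: "F \<in> carrier_mat K K" by (simp add: F_def)
  have F_eq: "Phi n l \<alpha> (v j) = (\<Sum>i<K. cscale (F $$ (i, j)) (y i))" if "j < K" for j
    unfolding a[OF that] using that by (intro sum.cong refl) (simp add: F_def)
  \<comment> \<open>Independence of the \<open>y i\<close> provides the uniqueness that gives
    \<open>THE\<close> its value.\<close>
  have "transition_matrix n l \<alpha> \<mu> v = F"
    unfolding transition_matrix_def Let_def K[symmetric] y_def[symmetric]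
  proof (rule the_equality)
    show "F \<in> carrier_mat K K \<and> (\<forall>j<K. Phi n l \<alpha> (v j) = (\<Sum>i<K. cscale (F $$ (i, j)) (y i)))"
      using F F_eq by blast
  next
    fix F' assume F': "F' \<in> carrier_mat K K \<and> (\<forall>j<K. Phi n l \<alpha> (v j) = (\<Sum>i<K. cscale (F' $$ (i, j)) (y i)))"
    show "F' = F"
    proof (rule eq_matI)
      fix i j assume "i < dim_row F" "j < dim_col F"
      hence ij: "i < K" "j < K" using F by auto
      show "F' $$ (i, j) = F $$ (i, j)"
        by (rule coeff[of "\<lambda>i. F' $$ (i, j)" "\<lambda>i. F $$ (i, j)"]) (use F' F_eq ij in auto)
    qed (use F F' in auto)
  qed
  moreover have "vec_space.rank K F = cs.dim (T_map n l \<alpha> ` H)"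
  proof -
    have "(\<lambda>j. \<Sum>i<K. cscale (F $$ (i, j)) (y i)) ` {..<K} = Phi n l \<alpha> ` v ` {..<K}"
      using F_eq by (auto simp: image_iff)
    thus ?thesis using rank_eq_dim[OF F y_inj y_indep] span_Phi[of \<alpha>] by (metis cs.dim_span)
  qed
  ultimately show ?thesis using F hw_vectors_T_map[of n \<mu> l \<alpha>] by (simp add: H_def)
qed

theorem theorem3p4:
  fixes n l :: nat and \<alpha> :: complex
    and v :: "nat list \<Rightarrow> nat \<Rightarrow> tensor"
    and \<M> :: "nat list \<Rightarrow> 'b::ab_group_add gl_module"
  assumes "n \<ge> 1" and "l \<ge> 1"
    and basis: "\<And>\<mu>. is_partition \<mu> (n * l) \<Longrightarrow>
      is_basis_family cscale (kostka \<mu> (replicate n l)) (v \<mu>)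
        (hw_vectors n (sym_tensor_module n l) \<mu>)"
    and irreps: "\<And>\<mu>. is_partition \<mu> (n * l) \<Longrightarrow> length \<mu> \<le> n \<Longrightarrow>
      irreducible_hw_module n (\<M> \<mu>) \<mu>"
  shows "gl_isomorphic n
    (cyclic_submodule n (poly_module n) (alpha_det \<alpha> (X_mat n) ^ l))
    (direct_sum
      {(\<mu>, k). is_partition \<mu> (n * l) \<and> length \<mu> \<le> n \<and>
               k < mat_rank (transition_matrix n l \<alpha> \<mu> (v \<mu>))}
      (\<lambda>(\<mu>, k). \<M> \<mu>))"
proof -
  let ?S = "T_map n l \<alpha> ` col_space n l"
  have eq: "cyclic_submodule n (poly_module n) (alpha_det \<alpha> (X_mat n) ^ l) = (poly_module n)\<lparr>mspace := ?S\<rparr>"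
    unfolding cyclic_alpha_det[symmetric] by (simp add: cyclic_submodule_def)
  have "alpha_det \<alpha> (X_mat n) ^ l \<in> col_space n l"
    unfolding T_map_diag_monomial[symmetric]
    by (intro T_map_col_space) (simp add: col_space_def diag_monomial_in)
  hence "is_submodule n (poly_module n) ?S"
    unfolding cyclic_alpha_det[symmetric]
    using pm.is_submoduleD(1)[OF col_space_submodule[of n l]] by (intro pm.cyclic_submodule_is_submodule) blast
  moreover have "?S \<subseteq> col_space n l" using T_map_col_space by blast
  \<comment> \<open>The rank of the transition matrix is taken as the multiplicity function
    \<open>r\<close>; it is the required dimension by \<open>rank_transition_matrix\<close>.\<close>
  ultimately show ?thesis
    unfolding eq using irreps rank_transition_matrix[OF basis refl] by (rule complete_reducibility)
qed

end
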